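(* Let $\Gamma$ be a projective Anosov subgroup of $\mathrm{SL}(n,\mathbb{R})$. Then $h_{12}(\Gamma)\le\delta_{12}(\Gamma)$ and $h_{1n}(\Gamma)=\delta_{1n}(\Gamma)$. Moreover, if $\Gamma$ is Zariski dense in $\mathrm{SL}(n,\mathbb{R})$, then $h_{12}(\Gamma)=\delta_{12}(\Gamma)$.
   Context: For $g\in\mathrm{SL}(n,\mathbb{R})$, $\mu_i(g)$ is the logarithm of the $i$-th eigenvalue (decreasing order) of $\sqrt{gg^T}$, and $\lambda_i(g)$ is the logarithm of the $i$-th largest modulus of the complex eigenvalues of $g$ (with multiplicity). A finitely generated $\Gamma\subset\mathrm{SL}(n,\mathbb{R})$ is projective Anosov if there are $C,C'>0$ with $\mu_1(g)-\mu_2(g)\ge C|g|-C'$ for all $g\in\Gamma$ ($|g|$ the word length). Define $\delta_{1j}(\Gamma)=\limsup_{R\to\infty}\frac1R\log\#\{\gamma\in\Gamma:\mu_1(\gamma)-\mu_j(\gamma)\le R\}$ and $h_{1j}(\Gamma)=\limsup_{R\to\infty}\frac1R\log\#\{[\gamma]\text{ conjugacy class in }\Gamma:\lambda_1(\gamma)-\lambda_j(\gamma)\le R\}$, for $j=2$ and $j=n$. *)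

theory Defs
  imports "Jordan_Normal_Form.Char_Poly" "HOL-Library.Extended_Real" "HOL-Library.Liminf_Limsup"
begin

definition SL :: "nat \<Rightarrow> real mat set" where
  "SL n = {A \<in> carrier_mat n n. det A = 1}"

definition subgroup_SL :: "nat \<Rightarrow> real mat set \<Rightarrow> bool" where
  "subgroup_SL n \<Gamma> \<longleftrightarrow> \<Gamma> \<subseteq> SL n \<and> 1\<^sub>m n \<in> \<Gamma> \<and>
     (\<forall>g\<in>\<Gamma>. \<forall>h\<in>\<Gamma>. g * h \<in> \<Gamma>) \<and>
     (\<forall>g\<in>\<Gamma>. \<exists>h\<in>\<Gamma>. g * h = 1\<^sub>m n)"

definition eig_moduli :: "real mat \<Rightarrow> real list" where
  "eig_moduli A = rev (sorted_list_of_multiset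
      (image_mset cmod (proots (char_poly (map_mat complex_of_real A)))))"

definition lam :: "nat \<Rightarrow> real mat \<Rightarrow> real" where
  "lam i g = ln (eig_moduli g ! (i - 1))"

text \<open>mu_i(g): log of the i-th eigenvalue (decreasing) of sqrt(g g^T); the eigenvalues of
  sqrt(g g^T) are the square roots of those of g g^T.\<close>
definition mu :: "nat \<Rightarrow> real mat \<Rightarrow> real" where
  "mu i g = ln (sqrt (eig_moduli (g * transpose_mat g) ! (i - 1)))"

definition letters :: "nat \<Rightarrow> real mat set \<Rightarrow> real mat set \<Rightarrow> real mat set" where
  "letters n \<Gamma> S = S \<union> {h \<in> \<Gamma>. \<exists>s\<in>S. s * h = 1\<^sub>m n}"

definition is_word :: "nat \<Rightarrow> real mat set \<Rightarrow> real mat set \<Rightarrow> real mat list \<Rightarrow> real mat \<Rightarrow> bool" where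
  "is_word n \<Gamma> S xs g \<longleftrightarrow> set xs \<subseteq> letters n \<Gamma> S \<and> g = foldr (*) xs (1\<^sub>m n)"

definition generates :: "nat \<Rightarrow> real mat set \<Rightarrow> real mat set \<Rightarrow> bool" where
  "generates n \<Gamma> S \<longleftrightarrow> S \<subseteq> \<Gamma> \<and> (\<forall>g\<in>\<Gamma>. \<exists>xs. is_word n \<Gamma> S xs g)"

definition word_length :: "nat \<Rightarrow> real mat set \<Rightarrow> real mat set \<Rightarrow> real mat \<Rightarrow> nat" where
  "word_length n \<Gamma> S g = (LEAST k. \<exists>xs. length xs = k \<and> is_word n \<Gamma> S xs g)"

definition projective_anosov :: "nat \<Rightarrow> real mat set \<Rightarrow> bool" where
  "projective_anosov n \<Gamma> \<longleftrightarrow>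
     (\<exists>S. finite S \<and> generates n \<Gamma> S \<and>
        (\<exists>C C'. C > 0 \<and> C' > 0 \<and>
           (\<forall>g\<in>\<Gamma>. mu 1 g - mu 2 g \<ge> C * real (word_length n \<Gamma> S g) - C')))"

inductive_set polyfun :: "nat \<Rightarrow> (real mat \<Rightarrow> real) set" for n where
  const: "(\<lambda>A. c) \<in> polyfun n"
| entry: "i < n \<Longrightarrow> j < n \<Longrightarrow> (\<lambda>A. A $$ (i, j)) \<in> polyfun n"
| add: "p \<in> polyfun n \<Longrightarrow> q \<in> polyfun n \<Longrightarrow> (\<lambda>A. p A + q A) \<in> polyfun n"
| mult: "p \<in> polyfun n \<Longrightarrow> q \<in> polyfun n \<Longrightarrow> (\<lambda>A. p A * q A) \<in> polyfun n"

definition zariski_dense_SL :: "nat \<Rightarrow> real mat set \<Rightarrow> bool" where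
  "zariski_dense_SL n \<Gamma> \<longleftrightarrow>
     (\<forall>p\<in>polyfun n. (\<forall>g\<in>\<Gamma>. p g = 0) \<longrightarrow> (\<forall>g\<in>SL n. p g = 0))"

definition log_count_rate :: "'a set \<Rightarrow> real \<Rightarrow> ereal" where
  "log_count_rate A R =
     (if infinite A then \<infinity> else if A = {} then -\<infinity> else ereal (ln (real (card A)) / R))"

definition growth_rate :: "(real \<Rightarrow> 'a set) \<Rightarrow> ereal" where
  "growth_rate N = Limsup at_top (\<lambda>R. log_count_rate (N R) R)"

definition conj_class :: "nat \<Rightarrow> real mat set \<Rightarrow> real mat \<Rightarrow> real mat set" where
  "conj_class n \<Gamma> g = {d * g * d' | d d'. d \<in> \<Gamma> \<and> d' \<in> \<Gamma> \<and> d * d' = 1\<^sub>m n}"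

definition delta1 :: "nat \<Rightarrow> real mat set \<Rightarrow> ereal" where
  "delta1 j \<Gamma> = growth_rate (\<lambda>R. {g \<in> \<Gamma>. mu 1 g - mu j g \<le> R})"

definition h1 :: "nat \<Rightarrow> nat \<Rightarrow> real mat set \<Rightarrow> ereal" where
  "h1 n j \<Gamma> = growth_rate (\<lambda>R. {conj_class n \<Gamma> g | g. g \<in> \<Gamma> \<and> lam 1 g - lam j g \<le> R})"

end

theory Submission
  imports Defs "HOL-Algebra.Group" "Jordan_Normal_Form.Schur_Decomposition" "Jordan_Normal_Form.Spectral_Radius"
begin

text \<open>
  Write \<open>a g\<close> for the logarithm of a norm of \<open>g\<close>, so that \<open>\<mu>\<^sub>1\<close> is \<open>a\<close> and \<open>\<mu>\<^sub>1 + \<mu>\<^sub>2\<close> is the logarithm of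
  the norm of the \<open>2 \<times> 2\<close> minors, up to bounded errors. A determinantal identity gives
  \<open>exp (a (xy) + a (yz)) \<le> exp (a (xyz) + a y) + K exp (a x + a z + 2 a y - (\<mu>\<^sub>1 - \<mu>\<^sub>2)(y))\<close>. With the
  Anosov gap this four-point inequality forces \<open>a\<close> to be additive up to a bounded error along every
  quasigeodesic word, and it lets bounded defects propagate from local to global products.

  Hence a cyclically reduced \<open>r\<close> satisfies \<open>a r \<le> \<lambda>\<^sub>1 r + c\<close>, which yields both inequalities \<open>h \<le> \<delta>\<close>.
  Conversely each \<open>g\<close> is \<open>p s p\<inverse>\<close> with \<open>s\<close> in a set of linear size attached to its conjugacy class
  and \<open>a p + a (p\<inverse>) + \<lambda>\<^sub>1 g \<le> a g + c\<close>. For the symmetric length \<open>\<mu>\<^sub>1 - \<mu>\<^sub>n\<close> the number of \<open>p\<close> grows at most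
  at rate \<open>\<delta> / 2\<close>, which gives \<open>\<delta> \<le> max h (\<delta> / 2)\<close>. For \<open>\<mu>\<^sub>1 - \<mu>\<^sub>2\<close> Zariski density provides a finite \<open>F \<subseteq> \<Gamma>\<close> such
  that some \<open>g f\<close> with \<open>f \<in> F\<close> has large trace both on the standard representation and on its exterior square;
  then \<open>\<lambda>\<^sub>1\<close> and \<open>\<lambda>\<^sub>2\<close> of \<open>g f\<close> are within bounded distance of \<open>\<mu>\<^sub>1 g\<close> and \<open>\<mu>\<^sub>2 g\<close>.
\<close>

section \<open>Almost additivity along sequences\<close>

text \<open>Neither hyperbolicity of \<open>\<Gamma>\<close> nor limit maps enter: the word metric
  contributes geodesics and the triangle inequality, and every estimate on products comes from the
  gap. The length is the logarithm of one norm because \<mu>_1 - \<mu>_2 need not be subadditive: in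
  \<open>2 * lnorm - lnorm2\<close> the second term has the wrong sign. It is handled one-sidedly,
  since \<open>lnorm2\<close> never drops below \<open>lrad2\<close>, which is constant on conjugacy
  classes. Sets of linear size attached to classes are harmless because polynomial factors do not
  affect exponential rates. Halving needs p and its inverse to cost the same; inversion turns
  \<mu>_1 - \<mu>_2 into \<mu>_(n-1) - \<mu>_n, so that gap takes another route. Traces serve there
  because a large trace forces large eigenvalues and because they are linear in the matrix
  coefficients, which lets one finite set work for all g.\<close>

definition four_point_path :: "real \<Rightarrow> real \<Rightarrow> real \<Rightarrow> nat \<Rightarrow> (nat \<Rightarrow> nat \<Rightarrow> real) \<Rightarrow> bool" where
  "four_point_path K\<^sub>0 K C m \<alpha> \<longleftrightarrow>
     (\<forall>i j. i \<le> j \<longrightarrow> j \<le> m \<longrightarrow> 0 \<le> \<alpha> i j) \<and>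
     (\<forall>i j. i \<le> j \<longrightarrow> j \<le> Suc i \<longrightarrow> j \<le> m \<longrightarrow> \<alpha> i j \<le> K\<^sub>0) \<and>
     (\<forall>i j. i < j \<longrightarrow> j \<le> m \<longrightarrow> \<bar>\<alpha> (Suc i) j - \<alpha> i j\<bar> \<le> K\<^sub>0) \<and>
     (\<forall>i j. i \<le> j \<longrightarrow> j < m \<longrightarrow> \<bar>\<alpha> i (Suc j) - \<alpha> i j\<bar> \<le> K\<^sub>0) \<and>
     (\<forall>i j k l. i \<le> j \<longrightarrow> j \<le> k \<longrightarrow> k \<le> l \<longrightarrow> l \<le> m \<longrightarrow>
        exp (\<alpha> i k + \<alpha> j l) \<le> exp (\<alpha> i l + \<alpha> j k)
           + K * exp (\<alpha> i j + \<alpha> k l + 2 * \<alpha> j k - C * real (k - j)))"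

text \<open>Think of \<open>\<alpha> i j\<close> as the length of the step from the i-th to the j-th
  point of a path; word distance has been replaced by index difference, so only real numbers remain.
  \<open>\<theta> i j k\<close> is the exponential of minus the defect of additivity at
  \<open>j\<close>: a large defect means a tiny \<open>\<theta>\<close>. Retracting the outer
  indices towards \<open>j\<close> changes \<open>\<theta>\<close> only by the tail of a geometric
  series. So one bad \<open>j0\<close> produces a window of length \<open>N\<close> in which every
  midpoint at scale \<open>t\<close> has a defect of at least \<open>C * t - C4\<close>.\<close>

lemma four_point_almost_additive:
  fixes K\<^sub>0 K C :: real
  assumes K\<^sub>0: "K\<^sub>0 \<ge> 0" and K: "K \<ge> 0" and C: "C > 0"
  obtains D where "D \<ge> 0"
    and "\<And>\<alpha> m j. four_point_path K\<^sub>0 K C m \<alpha> \<Longrightarrow> j \<le> m \<Longrightarrow> \<alpha> 0 j + \<alpha> j m \<le> \<alpha> 0 m + D"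
proof -
  \<comment> \<open>\<open>E * exp (- C * t)\<close> is the sum of the errors
    \<open>K * exp (2 * K\<^sub>0) * exp (- C * s)\<close> over all
    \<open>s \<ge> t\<close>.\<close>
  define E where "E = K * exp (2 * K\<^sub>0) / (1 - exp (- C))"
  have eC: "exp (- C) < 1" using C by simp
  have E: "E \<ge> 0" unfolding E_def using K eC by simp
  have E_step: "K * exp (2 * K\<^sub>0) * exp (- C * real t) + E * exp (- C * real (Suc t)) = E * exp (- C * real t)" for t
  proof -
    have "exp (- C * real (Suc t)) = exp (- C) * exp (- C * real t)"
      by (simp add: exp_add[symmetric] algebra_simps)
    moreover have "K * exp (2 * K\<^sub>0) = E * (1 - exp (- C))" unfolding E_def using eC by simp
    ultimately show ?thesis by (simp only:) (simp add: algebra_simps)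
  qed
  define C4 where "C4 = ln (2 + 2 * E)"
  have C4: "C4 > 0" unfolding C4_def using E by (intro ln_gt_zero) simp
  \<comment> \<open>Running through \<open>L\<close> dyadic scales saves \<open>L * C / 2\<close>
    per unit of length; this \<open>L\<close> pays for the initial cost
    \<open>K\<^sub>0 + C4\<close>.\<close>
  obtain L :: nat where L: "real L \<ge> 2 * (K\<^sub>0 + C4) / C" using real_arch_simple by blast
  define N where "N = (2::nat) ^ L"
  \<comment> \<open>Moving \<open>j0\<close> by up to \<open>N\<close> costs at most
    \<open>K\<^sub>0 * N\<close> in each of the two terms, and a surplus \<open>C * N\<close> must
    survive throughout the window. The last \<open>K\<^sub>0\<close> covers
    \<open>\<alpha> m m\<close> when the window is shown to end before \<open>m\<close>.\<close>
  define D where "D = (2 * K\<^sub>0 + C) * real N + K\<^sub>0"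
  have N1: "N \<ge> 1" unfolding N_def by simp
  have D0: "D \<ge> 0" unfolding D_def using K\<^sub>0 C by simp
  show thesis
  proof (rule that[of D, OF D0], rule ccontr)
    fix \<alpha> :: "nat \<Rightarrow> nat \<Rightarrow> real" and m j0 :: nat
    assume path: "four_point_path K\<^sub>0 K C m \<alpha>"
      and j0: "j0 \<le> m" and big: "\<not> \<alpha> 0 j0 + \<alpha> j0 m \<le> \<alpha> 0 m + D"
    have pos: "\<And>i j. i \<le> j \<Longrightarrow> j \<le> m \<Longrightarrow> 0 \<le> \<alpha> i j"
      and step: "\<And>i j. i \<le> j \<Longrightarrow> j \<le> Suc i \<Longrightarrow> j \<le> m \<Longrightarrow> \<alpha> i j \<le> K\<^sub>0"
      and lipl: "\<And>i j. i < j \<Longrightarrow> j \<le> m \<Longrightarrow> \<bar>\<alpha> (Suc i) j - \<alpha> i j\<bar> \<le> K\<^sub>0"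
      and lipr: "\<And>i j. i \<le> j \<Longrightarrow> j < m \<Longrightarrow> \<bar>\<alpha> i (Suc j) - \<alpha> i j\<bar> \<le> K\<^sub>0"
      and four: "\<And>i j k l. i \<le> j \<Longrightarrow> j \<le> k \<Longrightarrow> k \<le> l \<Longrightarrow> l \<le> m \<Longrightarrow>
        exp (\<alpha> i k + \<alpha> j l) \<le> exp (\<alpha> i l + \<alpha> j k)
           + K * exp (\<alpha> i j + \<alpha> k l + 2 * \<alpha> j k - C * real (k - j))"
      using path unfolding four_point_path_def by simp_all
    define \<theta> where "\<theta> i j k = exp (\<alpha> i k - \<alpha> i j - \<alpha> j k)" for i j k
    \<comment> \<open>The four-point inequality for \<open>i\<close>, \<open>Suc i\<close>,
      \<open>j\<close>, \<open>k\<close>, divided by \<open>exp ?s\<close>: its left side becomes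
      \<open>\<theta> (Suc i) j k\<close>, its first term \<open>\<theta> i j k\<close>, and the
      Lipschitz bounds turn the second term into the error.\<close>
    have left1: "\<theta> (Suc i) j k \<le> \<theta> i j k + K * exp (2 * K\<^sub>0) * exp (- C * real (j - Suc i))"
      if "Suc i \<le> j" "j \<le> k" "k \<le> m" for i j k
    proof -
      let ?s = "\<alpha> i j + \<alpha> (Suc i) j + \<alpha> j k"
      have "exp (\<alpha> i j + \<alpha> (Suc i) k - ?s) = exp (\<alpha> i j + \<alpha> (Suc i) k) * exp (- ?s)"
        by (simp add: exp_add[symmetric])
      also have "\<dots> \<le> (exp (\<alpha> i k + \<alpha> (Suc i) j)
           + K * exp (\<alpha> i (Suc i) + \<alpha> j k + 2 * \<alpha> (Suc i) j - C * real (j - Suc i))) * exp (- ?s)"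
        by (rule mult_right_mono[OF four]) (use that in auto)
      also have "\<dots> = exp (\<alpha> i k + \<alpha> (Suc i) j - ?s)
           + K * exp (\<alpha> i (Suc i) + \<alpha> j k + 2 * \<alpha> (Suc i) j - C * real (j - Suc i) - ?s)"
        by (simp add: distrib_right exp_add[symmetric] mult.assoc)
      also have "\<dots> \<le> exp (\<alpha> i k + \<alpha> (Suc i) j - ?s)
           + K * exp (2 * K\<^sub>0 - C * real (j - Suc i))"
        using step[of i "Suc i"] lipl[of i j] that K
        by (intro add_left_mono mult_left_mono) (auto simp: abs_le_iff)
      finally show ?thesis unfolding \<theta>_def
        by (simp add: exp_add[symmetric] mult.assoc algebra_simps)
    qed
    have right1: "\<theta> i j k \<le> \<theta> i j (Suc k) + K * exp (2 * K\<^sub>0) * exp (- C * real (k - j))"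
      if "i \<le> j" "j \<le> k" "Suc k \<le> m" for i j k
    proof -
      let ?s = "\<alpha> i j + \<alpha> j k + \<alpha> j (Suc k)"
      have "exp (\<alpha> i k + \<alpha> j (Suc k) - ?s) = exp (\<alpha> i k + \<alpha> j (Suc k)) * exp (- ?s)"
        by (simp add: exp_add[symmetric])
      also have "\<dots> \<le> (exp (\<alpha> i (Suc k) + \<alpha> j k)
           + K * exp (\<alpha> i j + \<alpha> k (Suc k) + 2 * \<alpha> j k - C * real (k - j))) * exp (- ?s)"
        by (rule mult_right_mono[OF four]) (use that in auto)
      also have "\<dots> = exp (\<alpha> i (Suc k) + \<alpha> j k - ?s)
           + K * exp (\<alpha> i j + \<alpha> k (Suc k) + 2 * \<alpha> j k - C * real (k - j) - ?s)"
        by (simp add: distrib_right exp_add[symmetric] mult.assoc)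
      also have "\<dots> \<le> exp (\<alpha> i (Suc k) + \<alpha> j k - ?s)
           + K * exp (2 * K\<^sub>0 - C * real (k - j))"
        using step[of k "Suc k"] lipr[of j k] that K
        by (intro add_left_mono mult_left_mono) (auto simp: abs_le_iff)
      finally show ?thesis unfolding \<theta>_def
        by (simp add: exp_add[symmetric] mult.assoc algebra_simps)
    qed
    have left: "i \<le> j \<Longrightarrow> \<theta> i j k \<le> \<theta> 0 j k + E * exp (- C * real (j - i))"
      if "j \<le> k" "k \<le> m" for i j k
    proof (induction i)
      case 0 thus ?case using E by simp
    next
      case (Suc i)
      have "j - i = Suc (j - Suc i)" using Suc.prems by simp
      hence "E * exp (- C * real (j - i)) + K * exp (2 * K\<^sub>0) * exp (- C * real (j - Suc i))
          = E * exp (- C * real (j - Suc i))"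
        using E_step[of "j - Suc i"] by simp
      thus ?case using Suc.IH Suc.prems left1[of i j k] that by linarith
    qed
    have right: "j + t \<le> m \<Longrightarrow> t \<le> u \<Longrightarrow> j + u \<le> m \<Longrightarrow>
        \<theta> i j (j + t) \<le> \<theta> i j (j + u) + E * exp (- C * real t)"
      if "i \<le> j" for i j t u
    proof (induction "u - t" arbitrary: t)
      case 0 thus ?case using E by simp
    next
      case (Suc v)
      have "\<theta> i j (j + Suc t) \<le> \<theta> i j (j + u) + E * exp (- C * real (Suc t))"
        by (rule Suc.hyps(1)) (use Suc.hyps(2) Suc.prems in auto)
      moreover have "\<theta> i j (j + t) \<le> \<theta> i j (j + Suc t) + K * exp (2 * K\<^sub>0) * exp (- C * real t)"
        using right1[of i j "j + t"] that Suc.hyps(2) Suc.prems by simp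
      ultimately show ?case using E_step[of t] by linarith
    qed
    have both: "\<theta> (j - t) j (j + t) \<le> \<theta> 0 j m + 2 * E * exp (- C * real t)"
      if "t \<le> j" "j + t \<le> m" for j t
    proof -
      have "t \<le> m - j" using that by simp
      thus ?thesis using left[of j "m" "j - t"] right[of "j - t" j t "m - j"] that by simp
    qed
    have lipl': "\<alpha> 0 (j0 + t) \<ge> \<alpha> 0 j0 - K\<^sub>0 * real t" if "j0 + t \<le> m" for t
      using that
    proof (induction t)
      case (Suc t)
      thus ?case using lipr[of 0 "j0 + t"] by (auto simp: abs_le_iff algebra_simps)
    qed simp
    have lipr': "\<alpha> (j0 + t) m \<ge> \<alpha> j0 m - K\<^sub>0 * real t" if "j0 + t \<le> m" for t
      using that
    proof (induction t)
      case (Suc t)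
      thus ?case using lipl[of "j0 + t" m] by (auto simp: abs_le_iff algebra_simps)
    qed simp
    have Nm: "j0 + N \<le> m"
    proof (rule ccontr)
      assume "\<not> j0 + N \<le> m"
      hence *: "m - j0 \<le> N" by simp
      have "\<alpha> 0 m \<ge> \<alpha> 0 j0 - K\<^sub>0 * real (m - j0)" using lipl'[of "m - j0"] j0 by simp
      moreover have "\<alpha> m m \<ge> \<alpha> j0 m - K\<^sub>0 * real (m - j0)" using lipr'[of "m - j0"] j0 by simp
      moreover have "K\<^sub>0 * real (m - j0) \<le> K\<^sub>0 * real N" using * K\<^sub>0 by (intro mult_left_mono) auto
      moreover have "C * real N > 0" using C N1 by simp
      moreover have "\<alpha> m m \<le> K\<^sub>0" using step[of m m] by simp
      ultimately show False using big unfolding D_def by (simp add: algebra_simps)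
    qed
    have defect: "\<alpha> s (s + 2 * t) \<le> \<alpha> s (s + t) + \<alpha> (s + t) (s + 2 * t) - (C * real t - C4)"
      if "j0 \<le> s" "s + 2 * t \<le> j0 + N" for s t
    proof -
      define u where "u = s + t - j0"
      have u: "s + t = j0 + u" "u \<le> N" "t \<le> N" using that unfolding u_def by auto
      have "\<theta> 0 (s + t) m \<le> exp (- C * real N)"
      proof -
        have "K\<^sub>0 * real u \<le> K\<^sub>0 * real N" using u K\<^sub>0 by (intro mult_left_mono) auto
        hence "\<alpha> 0 m - \<alpha> 0 (s + t) - \<alpha> (s + t) m \<le> - C * real N"
          using lipl'[of u] lipr'[of u] u Nm big K\<^sub>0 unfolding D_def by (simp add: algebra_simps)
        thus ?thesis unfolding \<theta>_def by simp
      qed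
      also have "\<dots> \<le> exp (- C * real t)" using C u by simp
      finally have "\<theta> 0 (s + t) m \<le> exp (- C * real t)" .
      moreover have "\<theta> s (s + t) (s + 2 * t) \<le> \<theta> 0 (s + t) m + 2 * E * exp (- C * real t)"
      proof -
        have eq: "s + t - t = s" "s + t + t = s + 2 * t" by simp_all
        show ?thesis using both[of t "s + t"] that Nm unfolding eq by simp
      qed
      moreover have "(2 + 2 * E) * exp (- C * real t) = 2 * exp (- C * real t) + 2 * E * exp (- C * real t)"
        by (simp only: distrib_right)
      ultimately have "\<theta> s (s + t) (s + 2 * t) \<le> (2 + 2 * E) * exp (- C * real t)"
        using exp_ge_zero[of "- C * real t"] by linarith
      also have "\<dots> = exp (C4 - C * real t)" unfolding C4_def using E by (simp add: exp_diff exp_minus divide_inverse)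
      finally show ?thesis unfolding \<theta>_def by simp
    qed
    txt \<open>Halving an interval of length \<open>2t\<close> in the window saves at least \<open>C t - C4\<close>. Summed over the
      scales \<open>1, 2, 4, \<dots>\<close> the savings exceed any multiple of the length, contradicting \<open>\<alpha> \<ge> 0\<close>.\<close>
    have dyadic: "\<alpha> s (s + 2 ^ l) \<le> 2 ^ l * (K\<^sub>0 + C4 - real l * C / 2) - C4"
      if "j0 \<le> s" "s + 2 ^ l \<le> j0 + N" for s l
      using that
    proof (induction l arbitrary: s)
      case 0
      thus ?case using step[of s "Suc s"] Nm by simp
    next
      case (Suc l)
      have "\<alpha> s (s + 2 ^ Suc l) \<le> \<alpha> s (s + 2 ^ l) + \<alpha> (s + 2 ^ l) (s + 2 ^ Suc l) - (C * 2 ^ l - C4)"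
        using defect[of s "2 ^ l"] Suc.prems by simp
      moreover have "\<alpha> s (s + 2 ^ l) \<le> 2 ^ l * (K\<^sub>0 + C4 - real l * C / 2) - C4"
        using Suc.IH[of s] Suc.prems by simp
      moreover have "\<alpha> (s + 2 ^ l) (s + 2 ^ Suc l) \<le> 2 ^ l * (K\<^sub>0 + C4 - real l * C / 2) - C4"
        using Suc.IH[of "s + 2 ^ l"] Suc.prems by (simp add: mult_2 add.assoc)
      ultimately show ?case by (simp add: field_simps)
    qed
    have "\<alpha> j0 (j0 + N) \<le> 2 ^ L * (K\<^sub>0 + C4 - real L * C / 2) - C4"
      using dyadic[of j0 L] unfolding N_def by simp
    also have "K\<^sub>0 + C4 - real L * C / 2 \<le> 0" using L C by (simp add: field_simps)
    hence "2 ^ L * (K\<^sub>0 + C4 - real L * C / 2) - C4 < 0" using C4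
      by (smt (verit) mult_nonneg_nonpos zero_le_power)
    finally show False using pos[of j0 "j0 + N"] Nm by simp
  qed
qed

section \<open>Groups with a length function\<close>

text \<open>Word length for a finite generating set, axiomatised. \<open>len_split\<close> peels off
  one generator at a time, which yields geodesics indexed by all integers up to the length;
  \<open>finite_ball\<close> stands for finite generation.\<close>

locale length_group = group G for G (structure) +
  fixes len :: "'a \<Rightarrow> nat"
  assumes len_eq_0_iff: "x \<in> carrier G \<Longrightarrow> len x = 0 \<longleftrightarrow> x = \<one>"
    and len_mult: "x \<in> carrier G \<Longrightarrow> y \<in> carrier G \<Longrightarrow> len (x \<otimes> y) \<le> len x + len y"
    and len_inv: "x \<in> carrier G \<Longrightarrow> len (inv x) = len x"
    and finite_ball: "finite {x \<in> carrier G. len x \<le> k}"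
    and len_split: "x \<in> carrier G \<Longrightarrow> len x = Suc k \<Longrightarrow>
          \<exists>y\<in>carrier G. \<exists>z\<in>carrier G. x = y \<otimes> z \<and> len y = k \<and> len z = 1"
begin

lemma len_one [simp]: "len \<one> = 0"
  using len_eq_0_iff by simp

lemma cancel_left [simp]:
  assumes "x \<in> carrier G" "y \<in> carrier G"
  shows "x \<otimes> (inv x \<otimes> y) = y" "inv x \<otimes> (x \<otimes> y) = y"
  using assms by (simp_all add: m_assoc[symmetric])

definition dst :: "'a \<Rightarrow> 'a \<Rightarrow> nat" where "dst x y = len (inv x \<otimes> y)"

lemma dst_refl [simp]: "x \<in> carrier G \<Longrightarrow> dst x x = 0"
  by (simp add: dst_def len_one)

lemma dst_one [simp]: "x \<in> carrier G \<Longrightarrow> dst \<one> x = len x"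
  by (simp add: dst_def)

lemma dst_sym: "x \<in> carrier G \<Longrightarrow> y \<in> carrier G \<Longrightarrow> dst x y = dst y x"
  using len_inv[of "inv x \<otimes> y"] by (simp add: dst_def inv_mult_group)

lemma dst_triangle:
  assumes "x \<in> carrier G" "y \<in> carrier G" "z \<in> carrier G"
  shows "dst x z \<le> dst x y + dst y z"
  using len_mult[of "inv x \<otimes> y" "inv y \<otimes> z"] assms by (simp add: dst_def m_assoc)

lemma dst_left [simp]:
  "g \<in> carrier G \<Longrightarrow> x \<in> carrier G \<Longrightarrow> y \<in> carrier G \<Longrightarrow> dst (g \<otimes> x) (g \<otimes> y) = dst x y"
  by (simp add: dst_def inv_mult_group m_assoc)

definition geodesic :: "(nat \<Rightarrow> 'a) \<Rightarrow> nat \<Rightarrow> bool" where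
  "geodesic x m \<longleftrightarrow> (\<forall>i\<le>m. x i \<in> carrier G) \<and> (\<forall>i j. i \<le> j \<longrightarrow> j \<le> m \<longrightarrow> dst (x i) (x j) = j - i)"

lemma geodesic_carrier: "geodesic x m \<Longrightarrow> i \<le> m \<Longrightarrow> x i \<in> carrier G"
  by (simp add: geodesic_def)

lemma geodesic_dst: "geodesic x m \<Longrightarrow> i \<le> j \<Longrightarrow> j \<le> m \<Longrightarrow> dst (x i) (x j) = j - i"
  by (simp add: geodesic_def)

lemma dst_steps:
  assumes "\<And>i. i \<le> m \<Longrightarrow> x i \<in> carrier G" and "\<And>i. i < m \<Longrightarrow> dst (x i) (x (Suc i)) \<le> 1"
    and "i \<le> j" "j \<le> m"
  shows "dst (x i) (x j) \<le> j - i"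
  using assms(3,4)
proof (induction j)
  case 0
  thus ?case using assms(1)[of 0] by simp
next
  case (Suc j)
  show ?case
  proof (cases "i = Suc j")
    case True
    thus ?thesis using assms(1) Suc.prems by simp
  next
    case False
    hence "dst (x i) (x j) \<le> j - i" using Suc by simp
    moreover have "dst (x i) (x (Suc j)) \<le> dst (x i) (x j) + dst (x j) (x (Suc j))"
      using assms(1) Suc.prems by (intro dst_triangle) auto
    ultimately show ?thesis using assms(2)[of j] Suc.prems False by linarith
  qed
qed

text \<open>Unit steps bound each piece from above by its index difference, so a single shorter
  piece would bring the total below \<open>m\<close>.\<close>

lemma geodesicI:
  assumes "\<And>i. i \<le> m \<Longrightarrow> x i \<in> carrier G" and "\<And>i. i < m \<Longrightarrow> dst (x i) (x (Suc i)) \<le> 1"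
    and "dst (x 0) (x m) \<ge> m"
  shows "geodesic x m"
  unfolding geodesic_def
proof (intro conjI allI impI)
  fix i j assume ij: "i \<le> j" "j \<le> m"
  have "dst (x 0) (x m) \<le> dst (x 0) (x i) + dst (x i) (x m)"
    "dst (x i) (x m) \<le> dst (x i) (x j) + dst (x j) (x m)"
    using assms(1) ij by (auto intro!: dst_triangle)
  moreover have "dst (x 0) (x i) \<le> i" "dst (x i) (x j) \<le> j - i" "dst (x j) (x m) \<le> m - j"
    using dst_steps[of m x 0 i] dst_steps[of m x i j] dst_steps[of m x j m] assms(1,2) ij by auto
  ultimately show "dst (x i) (x j) = j - i" using assms(3) ij by linarith
qed (use assms in auto)

lemma geodesic_exists:
  assumes "g \<in> carrier G"
  obtains x where "geodesic x (len g)" "x 0 = \<one>" "x (len g) = g"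
proof -
  have "\<exists>x. (\<forall>i\<le>k. x i \<in> carrier G) \<and> (\<forall>i<k. dst (x i) (x (Suc i)) \<le> 1) \<and> x 0 = \<one> \<and> x k = g"
    if "g \<in> carrier G" "len g = k" for g k
    using that
  proof (induction k arbitrary: g)
    case 0
    thus ?case using len_eq_0_iff by (intro exI[of _ "\<lambda>_. \<one>"]) auto
  next
    case (Suc k)
    obtain y z where yz: "y \<in> carrier G" "z \<in> carrier G" "g = y \<otimes> z" "len y = k" "len z = 1"
      using len_split[OF Suc.prems] by blast
    obtain x where x: "\<forall>i\<le>k. x i \<in> carrier G" "\<forall>i<k. dst (x i) (x (Suc i)) \<le> 1" "x 0 = \<one>" "x k = y"
      using Suc.IH[OF yz(1,4)] by blast
    have "dst y g = 1" using yz by (simp add: dst_def)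
    thus ?case using x yz by (intro exI[of _ "x(Suc k := g)"]) (auto simp: le_Suc_eq less_Suc_eq)
  qed
  from this[OF assms refl] obtain x where x: "\<forall>i\<le>len g. x i \<in> carrier G"
    "\<forall>i<len g. dst (x i) (x (Suc i)) \<le> 1" "x 0 = \<one>" "x (len g) = g" by blast
  have "geodesic x (len g)" by (rule geodesicI) (use x assms in auto)
  thus thesis using that x by blast
qed

end

section \<open>Hyperbolic lengths\<close>

text \<open>In the applications \<open>a\<close> is the logarithm of a matrix norm and \<open>tau\<close> that of the spectral radius.\<close>

locale hyperbolic_length = length_group +
  fixes a tau :: "'a \<Rightarrow> real" and K C C\<^sub>1 C\<^sub>2 :: real
  assumes K: "K > 0" and C: "C > 0" and C\<^sub>1: "C\<^sub>1 > 0"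
    and a_nonneg: "x \<in> carrier G \<Longrightarrow> 0 \<le> a x"
    and a_mult: "x \<in> carrier G \<Longrightarrow> y \<in> carrier G \<Longrightarrow> a (x \<otimes> y) \<le> a x + a y"
    and a_four: "x \<in> carrier G \<Longrightarrow> y \<in> carrier G \<Longrightarrow> z \<in> carrier G \<Longrightarrow>
      exp (a (x \<otimes> y) + a (y \<otimes> z)) \<le> exp (a (x \<otimes> y \<otimes> z) + a y)
        + K * exp (a x + a z + 2 * a y - C * real (len y))"
    and a_lower: "x \<in> carrier G \<Longrightarrow> C\<^sub>1 * real (len x) - C\<^sub>2 \<le> a x"
    and tau_conj: "p \<in> carrier G \<Longrightarrow> x \<in> carrier G \<Longrightarrow> tau (p \<otimes> x \<otimes> inv p) = tau x"
    and tau_nonneg: "x \<in> carrier G \<Longrightarrow> 0 \<le> tau x"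
    and tau_le: "x \<in> carrier G \<Longrightarrow> tau x \<le> a x"
    and tau_growth: "x \<in> carrier G \<Longrightarrow> tau x < u \<Longrightarrow> \<exists>c. \<forall>k::nat. a (x [^] k) \<le> c + u * real k"
begin

text \<open>Gelfand's formula in use: \<open>tau_growth\<close> caps the growth of powers at any
  rate above \<open>tau x\<close>, so powers growing at rate \<open>t\<close> leave no room for a
  rate \<open>u\<close> between \<open>tau x\<close> and \<open>t\<close>.\<close>

lemma tau_ge:
  assumes x: "x \<in> carrier G" and low: "\<And>k. real (Suc k) * t \<le> a (x [^] Suc k)"
  shows "t \<le> tau x"
proof (rule ccontr)
  assume "\<not> t \<le> tau x"
  then obtain u where u: "tau x < u" "u < t" using dense[of "tau x" t] by auto
  obtain c where c: "\<And>k::nat. a (x [^] k) \<le> c + u * real k" using tau_growth[OF x u(1)] by auto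
  obtain k :: nat where k: "c / (t - u) < real k" using reals_Archimedean2 by blast
  have "c < (t - u) * real (Suc k)" using k u(2) by (simp add: field_simps)
  thus False using low[of k] c[of "Suc k"] by (simp add: algebra_simps)
qed

lemma a_bounded_on_balls:
  obtains M where "M \<ge> 0" "\<And>x. x \<in> carrier G \<Longrightarrow> len x \<le> B \<Longrightarrow> a x \<le> M"
proof -
  let ?A = "a ` {x \<in> carrier G. len x \<le> B}"
  have "finite ?A" using finite_ball by simp
  hence "a x \<le> max 0 (Max ?A)" if "x \<in> carrier G" "len x \<le> B" for x
    using that by (intro max.coboundedI2 Max_ge) auto
  thus thesis using that[of "max 0 (Max ?A)"] by simp
qed

definition ad :: "'a \<Rightarrow> 'a \<Rightarrow> real" where "ad x y = a (inv x \<otimes> y)"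

lemma ad_nonneg: "x \<in> carrier G \<Longrightarrow> y \<in> carrier G \<Longrightarrow> 0 \<le> ad x y"
  by (simp add: ad_def a_nonneg)

lemma ad_one [simp]: "x \<in> carrier G \<Longrightarrow> ad \<one> x = a x"
  by (simp add: ad_def)

lemma ad_triangle:
  assumes "x \<in> carrier G" "y \<in> carrier G" "z \<in> carrier G"
  shows "ad x z \<le> ad x y + ad y z"
  using a_mult[of "inv x \<otimes> y" "inv y \<otimes> z"] assms by (simp add: ad_def m_assoc)

lemma ad_four:
  assumes "x \<in> carrier G" "y \<in> carrier G" "z \<in> carrier G" "w \<in> carrier G"
  shows "exp (ad x z + ad y w) \<le> exp (ad x w + ad y z)
        + K * exp (ad x y + ad z w + 2 * ad y z - C * real (dst y z))"
  using a_four[of "inv x \<otimes> y" "inv y \<otimes> z" "inv z \<otimes> w"] assms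
  by (simp add: ad_def dst_def m_assoc)

definition quasigeodesic :: "real \<Rightarrow> real \<Rightarrow> nat \<Rightarrow> (nat \<Rightarrow> 'a) \<Rightarrow> nat \<Rightarrow> bool" where
  "quasigeodesic \<kappa> c B x m \<longleftrightarrow> (\<forall>i\<le>m. x i \<in> carrier G) \<and> (\<forall>i<m. dst (x i) (x (Suc i)) \<le> B) \<and>
     (\<forall>i j. i \<le> j \<longrightarrow> j \<le> m \<longrightarrow> \<kappa> * real (j - i) - c \<le> real (dst (x i) (x j)))"

text \<open>The lower bound \<open>\<kappa> * (k - j) - c\<close> on distances replaces word
  distance by index difference: \<open>C\<close> becomes \<open>C * \<kappa>\<close>, and the loss
  \<open>c\<close> is absorbed into \<open>K * exp (C * c)\<close>. The point is that
  \<open>D\<close> depends on \<open>\<kappa>\<close>, \<open>c\<close> and \<open>B\<close> but not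
  on the path or its length.\<close>

lemma quasigeodesic_almost_additive:
  assumes "\<kappa> > 0"
  obtains D where "D \<ge> 0" "\<And>x m j. quasigeodesic \<kappa> c B x m \<Longrightarrow> j \<le> m \<Longrightarrow>
     ad (x 0) (x j) + ad (x j) (x m) \<le> ad (x 0) (x m) + D"
proof -
  obtain K\<^sub>0 where K\<^sub>0: "K\<^sub>0 \<ge> 0" "\<And>x. x \<in> carrier G \<Longrightarrow> len x \<le> B \<Longrightarrow> a x \<le> K\<^sub>0"
    using a_bounded_on_balls by blast
  have K\<^sub>0': "ad x y \<le> K\<^sub>0" if "x \<in> carrier G" "y \<in> carrier G" "dst x y \<le> B" for x y
    using K\<^sub>0(2)[of "inv x \<otimes> y"] that by (simp add: ad_def dst_def)
  have KC: "K * exp (C * c) \<ge> 0" "C * \<kappa> > 0" using K C assms by auto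
  obtain D where D0: "D \<ge> 0" and D: "\<And>\<alpha> m j. four_point_path K\<^sub>0 (K * exp (C * c)) (C * \<kappa>) m \<alpha> \<Longrightarrow>
      j \<le> m \<Longrightarrow> \<alpha> 0 j + \<alpha> j m \<le> \<alpha> 0 m + D"
    using four_point_almost_additive[OF K\<^sub>0(1) KC] by blast
  show thesis
  proof (rule that[OF D0])
    fix x :: "nat \<Rightarrow> 'a" and m j :: nat
    assume qg: "quasigeodesic \<kappa> c B x m" and j: "j \<le> m"
    have car: "\<And>i. i \<le> m \<Longrightarrow> x i \<in> carrier G"
      and step: "\<And>i. i < m \<Longrightarrow> dst (x i) (x (Suc i)) \<le> B"
      and low: "\<And>i j. i \<le> j \<Longrightarrow> j \<le> m \<Longrightarrow> \<kappa> * real (j - i) - c \<le> real (dst (x i) (x j))"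
      using qg unfolding quasigeodesic_def by simp_all
    have st: "ad (x i) (x (Suc i)) \<le> K\<^sub>0" "ad (x (Suc i)) (x i) \<le> K\<^sub>0" if "i < m" for i
      using K\<^sub>0' step[OF that] dst_sym[of "x i" "x (Suc i)"] car that by auto
    show "ad (x 0) (x j) + ad (x j) (x m) \<le> ad (x 0) (x m) + D"
    proof (rule D[OF _ j], unfold four_point_path_def, intro conjI allI impI)
      show "ad (x i) (x j) \<le> K\<^sub>0" if "i \<le> j" "j \<le> Suc i" "j \<le> m" for i j
      proof -
        have "j = i \<or> j = Suc i" using that by auto
        thus ?thesis using st[of i] K\<^sub>0'[of "x i" "x i"] car that by auto
      qed
      show "\<bar>ad (x (Suc i)) (x j) - ad (x i) (x j)\<bar> \<le> K\<^sub>0" if "i < j" "j \<le> m" for i j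
        using ad_triangle[of "x i" "x (Suc i)" "x j"] ad_triangle[of "x (Suc i)" "x i" "x j"] st[of i] car that
        by (simp add: abs_le_iff)
      show "\<bar>ad (x i) (x (Suc j)) - ad (x i) (x j)\<bar> \<le> K\<^sub>0" if "i \<le> j" "j < m" for i j
        using ad_triangle[of "x i" "x (Suc j)" "x j"] ad_triangle[of "x i" "x j" "x (Suc j)"] st[of j] car that
        by (simp add: abs_le_iff)
      show "exp (ad (x i) (x k) + ad (x j) (x l)) \<le> exp (ad (x i) (x l) + ad (x j) (x k))
           + K * exp (C * c) * exp (ad (x i) (x j) + ad (x k) (x l) + 2 * ad (x j) (x k) - C * \<kappa> * real (k - j))"
        if "i \<le> j" "j \<le> k" "k \<le> l" "l \<le> m" for i j k l
      proof -
        have "C * (\<kappa> * real (k - j) - c) \<le> C * real (dst (x j) (x k))"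
          using low[of j k] that C by (intro mult_left_mono) auto
        hence "exp (ad (x i) (x j) + ad (x k) (x l) + 2 * ad (x j) (x k) - C * real (dst (x j) (x k)))
          \<le> exp (C * c + (ad (x i) (x j) + ad (x k) (x l) + 2 * ad (x j) (x k) - C * \<kappa> * real (k - j)))"
          by (simp add: algebra_simps)
        hence "K * exp (ad (x i) (x j) + ad (x k) (x l) + 2 * ad (x j) (x k) - C * real (dst (x j) (x k)))
          \<le> K * exp (C * c) * exp (ad (x i) (x j) + ad (x k) (x l) + 2 * ad (x j) (x k) - C * \<kappa> * real (k - j))"
          using K by (simp only: exp_add mult.assoc) (simp add: mult_left_mono)
        thus ?thesis using ad_four[of "x i" "x j" "x k" "x l"] car that by auto
      qed
    qed (use ad_nonneg car in auto)
  qed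
qed

text \<open>Two geodesics joined by \<open>s\<close> without backtracking across the joint. Only
  distances between the two pieces occur, because inside a geodesic nothing has to be
  checked.\<close>

definition concatenable :: "real \<Rightarrow> (nat \<Rightarrow> 'a) \<Rightarrow> nat \<Rightarrow> 'a \<Rightarrow> (nat \<Rightarrow> 'a) \<Rightarrow> nat \<Rightarrow> bool" where
  "concatenable \<kappa> x m s y m' \<longleftrightarrow> geodesic x m \<and> x 0 = \<one> \<and> geodesic y m' \<and> y 0 = \<one> \<and> s \<in> carrier G \<and>
     (\<forall>i\<le>m. \<forall>j\<le>m'. \<kappa> * real ((m - i) + j) \<le> real (dst (x i) (x m \<otimes> s \<otimes> y j)))"

lemma concatenableI:
  assumes "geodesic x m" "x 0 = \<one>" "geodesic y m'" "y 0 = \<one>" "s \<in> carrier G"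
    and "\<And>i j. i \<le> m \<Longrightarrow> j \<le> m' \<Longrightarrow> \<kappa> * real ((m - i) + j) \<le> real (dst (x i) (x m \<otimes> s \<otimes> y j))"
  shows "concatenable \<kappa> x m s y m'"
  using assms by (simp add: concatenable_def)

lemma concatenation_almost_additive:
  assumes \<kappa>: "0 < \<kappa>" "\<kappa> \<le> 1"
  obtains D where "D \<ge> 0" "\<And>x y m m' s. concatenable \<kappa> x m s y m' \<Longrightarrow> len s \<le> B \<Longrightarrow>
     a (x m) + a (y m') \<le> a (x m \<otimes> s \<otimes> y m') + D"
proof -
  obtain D where D0: "D \<ge> 0" and D: "\<And>x m j. quasigeodesic \<kappa> \<kappa> (max 1 B) x m \<Longrightarrow> j \<le> m \<Longrightarrow>
     ad (x 0) (x j) + ad (x j) (x m) \<le> ad (x 0) (x m) + D"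
    using quasigeodesic_almost_additive[OF \<kappa>(1)] by blast
  obtain M where M: "M \<ge> 0" "\<And>x. x \<in> carrier G \<Longrightarrow> len x \<le> B \<Longrightarrow> a x \<le> M"
    using a_bounded_on_balls by blast
  show thesis
  proof (rule that[of "D + M"])
    fix x y :: "nat \<Rightarrow> 'a" and m m' :: nat and s
    assume "concatenable \<kappa> x m s y m'" and sB: "len s \<le> B"
    hence x: "geodesic x m" "x 0 = \<one>" and y: "geodesic y m'" "y 0 = \<one>" and s: "s \<in> carrier G" "len s \<le> B"
      and low: "\<And>i j. i \<le> m \<Longrightarrow> j \<le> m' \<Longrightarrow>
         \<kappa> * real ((m - i) + j) \<le> real (dst (x i) (x m \<otimes> s \<otimes> y j))"
      unfolding concatenable_def by auto
    note xc = geodesic_carrier[OF x(1)] and yc = geodesic_carrier[OF y(1)]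
    have xm: "x m \<in> carrier G" using xc by simp
    \<comment> \<open>The jump by \<open>s\<close> takes one index, so the second piece starts at
      \<open>Suc m\<close>. The additive constant \<open>\<kappa>\<close> of the quasigeodesic pays
      for this index, and \<open>max 1 B\<close> bounds both kinds of step.\<close>
    define z where "z k = (if k \<le> m then x k else x m \<otimes> s \<otimes> y (k - Suc m))" for k
    have geo_low: "\<kappa> * real (j - i) - \<kappa> \<le> real (j - i)" for i j :: nat
    proof -
      have "\<kappa> * real (j - i) \<le> 1 * real (j - i)" using \<kappa> by (intro mult_right_mono) auto
      thus ?thesis using \<kappa> by simp
    qed
    have "ad (z 0) (z m) + ad (z m) (z (Suc m + m')) \<le> ad (z 0) (z (Suc m + m')) + D"
    proof (rule D, unfold quasigeodesic_def, intro conjI allI impI)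
      show "z i \<in> carrier G" if "i \<le> Suc m + m'" for i
        using that xc yc xm s by (auto simp: z_def)
      show "dst (z i) (z (Suc i)) \<le> max 1 B" if "i < Suc m + m'" for i
      proof -
        consider "i < m" | "i = m" | "i > m" by linarith
        thus ?thesis
        proof cases
          case 1
          thus ?thesis using geodesic_dst[OF x(1), of i "Suc i"] by (simp add: z_def)
        next
          case 2
          have "dst (x m) (x m \<otimes> s) = len s" using xm s by (simp add: dst_def)
          thus ?thesis using 2 s xm y by (simp add: z_def)
        next
          case 3
          hence "dst (z i) (z (Suc i)) = dst (y (i - Suc m)) (y (Suc (i - Suc m)))"
            using that s xm yc by (simp add: z_def Suc_diff_Suc)
          thus ?thesis using geodesic_dst[OF y(1), of "i - Suc m" "Suc (i - Suc m)"] 3 that by simp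
        qed
      qed
      show "\<kappa> * real (j - i) - \<kappa> \<le> real (dst (z i) (z j))" if "i \<le> j" "j \<le> Suc m + m'" for i j
      proof -
        consider "j \<le> m" | "i \<le> m" "m < j" | "m < i" using that by linarith
        thus ?thesis
        proof cases
          case 1
          thus ?thesis using geodesic_dst[OF x(1), of i j] geo_low[of j i] that by (simp add: z_def)
        next
          case 2
          have "j - i = Suc ((m - i) + (j - Suc m))" using 2 by simp
          hence "\<kappa> * real (j - i) = \<kappa> * real ((m - i) + (j - Suc m)) + \<kappa>" by (simp add: algebra_simps)
          thus ?thesis using low[of i "j - Suc m"] 2 that by (simp add: z_def)
        next
          case 3
          hence "dst (z i) (z j) = dst (y (i - Suc m)) (y (j - Suc m))"
            using that s xm yc by (simp add: z_def)
          also have "\<dots> = j - i" using geodesic_dst[OF y(1), of "i - Suc m" "j - Suc m"] 3 that by simp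
          finally show ?thesis using geo_low[of j i] by simp
        qed
      qed
    qed simp
    moreover have "ad (z m) (z (Suc m + m')) = a (s \<otimes> y m')"
      using xm s yc[of m'] by (simp add: ad_def z_def m_assoc)
    moreover have "a (y m') \<le> a (inv s) + a (s \<otimes> y m')"
      using a_mult[of "inv s" "s \<otimes> y m'"] s yc[of m'] by simp
    moreover have "a (inv s) \<le> M" using M s len_inv by simp
    ultimately show "a (x m) + a (y m') \<le> a (x m \<otimes> s \<otimes> y m') + (D + M)"
      using x(2) xm s yc[of m'] by (simp add: z_def)
  qed (use D0 M in simp)
qed

text \<open>Once \<open>y\<close> is long compared with both defects, the error term of the
  four-point inequality is at most half of its left side. What matters is that the new defect
  \<open>d' + ln 2\<close> does not depend on \<open>d\<close>: the lemma can be applied again and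
  again along a product without the error growing.\<close>

lemma local_to_global:
  assumes car: "x \<in> carrier G" "y \<in> carrier G" "z \<in> carrier G"
    and xy: "a x + a y \<le> a (x \<otimes> y) + d" and yz: "a y + a z \<le> a (y \<otimes> z) + d'"
    and y: "C * real (len y) \<ge> d + d' + ln (2 * K)"
  shows "a (x \<otimes> y) + a z \<le> a (x \<otimes> y \<otimes> z) + (d' + ln 2)"
proof -
  let ?A = "exp (a (x \<otimes> y) + a (y \<otimes> z))"
  have "K * exp (a x + a z + 2 * a y - C * real (len y))
      \<le> K * exp (a (x \<otimes> y) + a (y \<otimes> z) - ln (2 * K))"
    using xy yz y K by simp
  also have "\<dots> = ?A / 2" using K by (simp add: exp_diff)
  finally have "?A / 2 \<le> exp (a (x \<otimes> y \<otimes> z) + a y)" using a_four[OF car] by simp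
  hence "?A \<le> exp (a (x \<otimes> y \<otimes> z) + a y + ln 2)" by (simp add: exp_add)
  hence "a (x \<otimes> y) + a (y \<otimes> z) \<le> a (x \<otimes> y \<otimes> z) + a y + ln 2" by simp
  thus ?thesis using yz by simp
qed

end

section \<open>Reduced conjugates\<close>

lemma (in length_group) geodesic_reverse:
  assumes x: "geodesic x m" and g: "g \<in> carrier G"
  shows "geodesic (\<lambda>j. g \<otimes> x (m - j)) m"
  unfolding geodesic_def
proof (intro conjI allI impI)
  fix i j assume ij: "i \<le> j" "j \<le> m"
  have "dst (x (m - i)) (x (m - j)) = dst (x (m - j)) (x (m - i))"
    by (rule dst_sym) (use geodesic_carrier[OF x] in auto)
  thus "dst (g \<otimes> x (m - i)) (g \<otimes> x (m - j)) = j - i"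
    using geodesic_dst[OF x, of "m - j" "m - i"] geodesic_carrier[OF x] g ij by simp
qed (use geodesic_carrier[OF x] g in auto)

lemma (in length_group) geodesic_prefix:
  assumes "geodesic x m" "k \<le> m"
  shows "geodesic x k"
  unfolding geodesic_def
proof (intro conjI allI impI)
  fix i j assume "i \<le> j" "j \<le> k"
  thus "dst (x i) (x j) = j - i" using geodesic_dst[OF assms(1), of i j] assms(2) by simp
qed (use geodesic_carrier[OF assms(1)] assms(2) in simp)

lemma (in length_group) geodesic_shift:
  assumes x: "geodesic x m" and "k \<le> m" "g \<in> carrier G"
  shows "geodesic (\<lambda>j. g \<otimes> x (k + j)) (m - k)"
  unfolding geodesic_def
proof (intro conjI allI impI)
  fix i j assume ij: "i \<le> j" "j \<le> m - k"
  thus "dst (g \<otimes> x (k + i)) (g \<otimes> x (k + j)) = j - i"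
    using geodesic_dst[OF x, of "k + i" "k + j"] geodesic_carrier[OF x] assms by simp
qed (use geodesic_carrier[OF x] assms in auto)

context hyperbolic_length begin

text \<open>The powers of \<open>u \<otimes> v\<close> are read as the alternating product u v u v
  ..., in which neighbouring factors have defect at most \<open>d\<close>. Gluing one factor at a
  time keeps the defect at \<open>d + ln 2\<close>, so the lengths of the powers grow linearly and
  \<open>tau_ge\<close> applies. The threshold on the lengths combines a defect
  \<open>d + ln 2\<close> on the left with \<open>d\<close> on the right.\<close>

lemma product_tau_lower:
  assumes car: "u \<in> carrier G" "v \<in> carrier G" and d: "d \<ge> 0"
    and uv: "a u + a v \<le> a (u \<otimes> v) + d" and vu: "a v + a u \<le> a (v \<otimes> u) + d"
    and u: "C * real (len u) \<ge> 2 * d + ln 2 + ln (2 * K)"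
    and v: "C * real (len v) \<ge> 2 * d + ln 2 + ln (2 * K)"
  shows "a (u \<otimes> v) \<le> tau (u \<otimes> v) + 2 * (d + ln 2)"
proof -
  define r where "r = u \<otimes> v"
  have ln2: "ln (2::real) \<ge> 0" by simp
  have r: "r \<in> carrier G" using car by (simp add: r_def)
  \<comment> \<open>The first conjunct is the invariant for the next gluing: the power reached so
    far has small defect against the factor \<open>u\<close> that follows it.\<close>
  have "a (r [^] Suc k) + a u \<le> a (r [^] Suc k \<otimes> u) + (d + ln 2) \<and>
        real (Suc k) * (a r - 2 * (d + ln 2)) \<le> a (r [^] Suc k)" for k
  proof (induction k)
    case 0
    have "a (u \<otimes> v) + a u \<le> a (u \<otimes> v \<otimes> u) + (d + ln 2)"
      by (rule local_to_global[OF car car(1) uv vu]) (use v ln2 in linarith)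
    thus ?case using add_nonneg_nonneg[OF d ln2] r by (simp add: r_def)
  next
    case (Suc k)
    define X where "X = r [^] Suc k"
    have X: "X \<in> carrier G" using r by (simp add: X_def)
    have Xr: "r [^] Suc (Suc k) = X \<otimes> u \<otimes> v"
      using X car unfolding X_def by (simp add: r_def m_assoc)
    have 1: "a X + a u \<le> a (X \<otimes> u) + (d + ln 2)" using Suc.IH by (simp only: X_def)
    have 2: "a (X \<otimes> u) + a v \<le> a (X \<otimes> u \<otimes> v) + (d + ln 2)"
      by (rule local_to_global[OF X car 1 uv]) (use u in simp)
    have 3: "a (X \<otimes> u \<otimes> v) + a u \<le> a (X \<otimes> u \<otimes> v \<otimes> u) + (d + ln 2)"
      by (rule local_to_global[OF _ car(2,1) 2 vu]) (use v X car in simp_all)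
    have "a r \<le> a u + a v" using a_mult car by (simp add: r_def)
    hence "a X + (a r - 2 * (d + ln 2)) \<le> a (X \<otimes> u \<otimes> v)" using 1 2 by simp
    moreover have "real (Suc k) * (a r - 2 * (d + ln 2)) \<le> a X" using Suc.IH by (simp only: X_def)
    ultimately have "real (Suc (Suc k)) * (a r - 2 * (d + ln 2)) \<le> a (X \<otimes> u \<otimes> v)"
      by (simp add: algebra_simps)
    thus ?case using 3 unfolding Xr by simp
  qed
  hence "a r - 2 * (d + ln 2) \<le> tau r" using r by (intro tau_ge) blast+
  thus ?thesis by (simp add: r_def)
qed

text \<open>A weak form of being cyclically reduced: moving a prefix \<open>u\<close> to the end may
  shorten \<open>r\<close>, but by at most half of \<open>len u\<close>. This much follows from
  minimising \<open>2 * len r + len p\<close>, whereas a shortest element of a conjugacy class loses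
  nothing.\<close>

definition reduced :: "'a \<Rightarrow> bool" where
  "reduced r \<longleftrightarrow> (\<forall>u\<in>carrier G. \<forall>v\<in>carrier G. r = u \<otimes> v \<longrightarrow> len r = len u + len v \<longrightarrow>
     2 * len r \<le> 2 * len (v \<otimes> u) + len u)"

text \<open>A prefix \<open>u\<close> of fixed length is cut off a long \<open>r\<close>, leaving a
  remainder v. The product u v has bounded defect because the word is geodesic, and v u because
  \<open>r\<close> is reduced; then \<open>product_tau_lower\<close> applies. Elements of length at
  most \<open>2 * L\<close> are finitely many.\<close>

lemma reduced_tau:
  obtains c where "c \<ge> 0" "\<And>r. r \<in> carrier G \<Longrightarrow> reduced r \<Longrightarrow> a r \<le> tau r + c"
proof -
  have k: "0 < (1/2::real)" "(1/2::real) \<le> 1" by simp_all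
  obtain D where D0: "D \<ge> 0" and D: "\<And>x y m m' s. concatenable (1/2) x m s y m' \<Longrightarrow> len s \<le> 0 \<Longrightarrow>
     a (x m) + a (y m') \<le> a (x m \<otimes> s \<otimes> y m') + D"
    using concatenation_almost_additive[OF k] by blast
  obtain L :: nat where "real L \<ge> (2 * D + ln 2 + ln (2 * K)) / C" using real_arch_simple by blast
  hence L: "C * real L \<ge> 2 * D + ln 2 + ln (2 * K)" using C by (simp add: field_simps)
  obtain M where M: "M \<ge> 0" "\<And>x. x \<in> carrier G \<Longrightarrow> len x \<le> 2 * L \<Longrightarrow> a x \<le> M"
    using a_bounded_on_balls by blast
  show thesis
  proof (rule that[of "M + 2 * (D + ln 2)"])
    fix r assume r: "r \<in> carrier G" "reduced r"
    show "a r \<le> tau r + (M + 2 * (D + ln 2))"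
    proof (cases "len r \<le> 2 * L")
      case True
      have "0 \<le> 2 * (D + ln 2)" using D0 by simp
      thus ?thesis using M(2)[OF r(1) True] tau_nonneg[OF r(1)] D0 by linarith
    next
      case False
      define l where "l = len r"
      have l: "2 * L < l" using False by (simp add: l_def)
      obtain w where w: "geodesic w l" "w 0 = \<one>" "w l = r"
        using geodesic_exists[OF r(1)] unfolding l_def by blast
      note wc = geodesic_carrier[OF w(1)]
      define u where "u = w L"
      define y where "y j = inv u \<otimes> w (L + j)" for j
      have u: "u \<in> carrier G" using wc l by (simp add: u_def)
      have gu: "geodesic w L" using geodesic_prefix[OF w(1)] l by simp
      have gy: "geodesic y (l - L)"
        unfolding y_def using geodesic_shift[OF w(1)] l u by simp
      have y0: "y 0 = \<one>" using u by (simp add: y_def u_def)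
      have yl: "y (l - L) = inv u \<otimes> r" using l w by (simp add: y_def)
      have yc: "y (l - L) \<in> carrier G" using geodesic_carrier[OF gy] by simp
      have uy: "u \<otimes> y (l - L) = r" using u r yl by simp
      have "a u + a (y (l - L)) \<le> a (u \<otimes> \<one> \<otimes> y (l - L)) + D"
        unfolding u_def
      proof (rule D[OF concatenableI[OF gu w(2) gy y0]])
        fix i j assume ij: "i \<le> L" "j \<le> l - L"
        have "dst (w i) (w L \<otimes> \<one> \<otimes> y j) = L + j - i"
          using ij l u wc[of "L + j"] geodesic_dst[OF w(1), of i "L + j"] by (simp add: y_def u_def)
        thus "1/2 * real ((L - i) + j) \<le> real (dst (w i) (w L \<otimes> \<one> \<otimes> y j))" using ij by simp
      qed simp_all
      moreover have "a (y (l - L)) + a (w L) \<le> a (y (l - L) \<otimes> \<one> \<otimes> w L) + D"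
      proof (rule D[OF concatenableI[OF gy y0 gu w(2)]])
        fix i j assume ij: "i \<le> l - L" "j \<le> L"
        have cs: "w j \<in> carrier G" "w (L + i) \<in> carrier G" using wc ij l by auto
        have "len (inv (w j) \<otimes> r) = l - j" "len (w j) = j"
          using geodesic_dst[OF w(1), of j l] geodesic_dst[OF w(1), of 0 j] w ij l cs by (auto simp: dst_def)
        hence 1: "len r = len (w j) + len (inv (w j) \<otimes> r)" and lj: "len (w j) = j"
          using ij l by (simp_all add: l_def)
        have 2: "inv (w j) \<otimes> r \<in> carrier G" "r = w j \<otimes> (inv (w j) \<otimes> r)" using cs r(1) by simp_all
        \<comment> \<open>Reducedness at the prefix \<open>w j\<close> puts \<open>w j\<close> and
          \<open>r \<otimes> w j\<close> at distance at least \<open>l - j / 2\<close>. Subtracting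
          the way from \<open>w j\<close> to \<open>w (L + i)\<close> leaves
          \<open>(l - L - i) + j / 2\<close>, hence the factor 1/2.\<close>
        have "2 * len r \<le> 2 * len (inv (w j) \<otimes> r \<otimes> w j) + len (w j)"
          by (rule r(2)[unfolded reduced_def, rule_format, OF cs(1) 2 1])
        hence "2 * l \<le> 2 * len (inv (w j) \<otimes> r \<otimes> w j) + j" unfolding l_def[symmetric] lj .
        moreover have "len (inv (w j) \<otimes> r \<otimes> w j) = dst (w j) (r \<otimes> w j)"
          using cs r by (simp add: dst_def m_assoc)
        moreover have "dst (w j) (r \<otimes> w j) \<le> dst (w j) (w (L + i)) + dst (w (L + i)) (r \<otimes> w j)"
          using cs r by (intro dst_triangle) auto
        moreover have "dst (w j) (w (L + i)) = L + i - j" using geodesic_dst[OF w(1), of j "L + i"] ij l by simp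
        moreover have "dst (w (L + i)) (r \<otimes> w j) = dst (y i) (y (l - L) \<otimes> \<one> \<otimes> w j)"
          using cs r u yl by (simp add: y_def m_assoc)
        ultimately have "(l - L - i) + j \<le> 2 * dst (y i) (y (l - L) \<otimes> \<one> \<otimes> w j)"
          using ij l by linarith
        thus "1/2 * real ((l - L - i) + j) \<le> real (dst (y i) (y (l - L) \<otimes> \<one> \<otimes> w j))" by simp
      qed simp_all
      ultimately have "a u + a (y (l - L)) \<le> a (u \<otimes> y (l - L)) + D" "a (y (l - L)) + a u \<le> a (y (l - L) \<otimes> u) + D"
        using u yc by (auto simp: u_def)
      moreover have "len u = L" "len (y (l - L)) = l - L"
        using geodesic_dst[OF gu, of 0 L] geodesic_dst[OF gy, of 0 "l - L"] w y0 yc u by (auto simp: u_def)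
      moreover have "C * real (l - L) \<ge> C * real L" using l C by simp
      ultimately have "a (u \<otimes> y (l - L)) \<le> tau (u \<otimes> y (l - L)) + 2 * (D + ln 2)"
        using L by (intro product_tau_lower[OF u yc D0]) auto
      thus ?thesis using uy M(1) by simp
    qed
  qed (use M(1) D0 in simp)
qed

text \<open>Minimising \<open>2 |r| + |p|\<close> over all factorisations \<open>g = p r p\<inverse>\<close> makes \<open>r\<close> cyclically reduced and at the
  same time forces the word \<open>p r p\<inverse>\<close> to be a quasigeodesic.\<close>

lemma reduced_conjugate:
  assumes g: "g \<in> carrier G"
  obtains p r where "p \<in> carrier G" "r \<in> carrier G" "g = p \<otimes> r \<otimes> inv p" "reduced r"
    "\<And>x. x \<in> carrier G \<Longrightarrow> 2 * len r + len p \<le> 2 * dst x (g \<otimes> x) + len x"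
proof -
  define p where "p = arg_min (\<lambda>x. 2 * dst x (g \<otimes> x) + len x) (\<lambda>x. x \<in> carrier G)"
  have p: "p \<in> carrier G" and min: "2 * dst p (g \<otimes> p) + len p \<le> 2 * dst x (g \<otimes> x) + len x"
    if "x \<in> carrier G" for x
    using arg_min_nat_lemma[of "\<lambda>x. x \<in> carrier G" \<one> "\<lambda>x. 2 * dst x (g \<otimes> x) + len x"] that
    unfolding p_def by auto
  have p: "p \<in> carrier G" using p[of \<one>] by simp
  define r where "r = inv p \<otimes> (g \<otimes> p)"
  have r: "r \<in> carrier G" "len r = dst p (g \<otimes> p)" using p g by (auto simp: r_def dst_def)
  have gp: "g \<otimes> p = p \<otimes> r" using p g by (simp add: r_def)
  show thesis
  proof (rule that[OF p r(1)])
    show "g = p \<otimes> r \<otimes> inv p" using p g unfolding gp[symmetric] by (simp add: m_assoc)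
    show "reduced r" unfolding reduced_def
    proof (intro ballI impI)
      fix u v assume uv: "u \<in> carrier G" "v \<in> carrier G" "r = u \<otimes> v" "len r = len u + len v"
      have "g \<otimes> (p \<otimes> u) = p \<otimes> u \<otimes> (v \<otimes> u)"
        using gp uv p g by (metis m_assoc m_closed)
      hence "dst (p \<otimes> u) (g \<otimes> (p \<otimes> u)) = len (v \<otimes> u)" using p uv by (simp add: dst_def)
      thus "2 * len r \<le> 2 * len (v \<otimes> u) + len u"
        using min[of "p \<otimes> u"] len_mult[of p u] p uv r by simp
    qed
  qed (use min r in simp)
qed

text \<open>A bound on \<open>tau\<close> bounds the length of the reduced conjugate
  \<open>r\<close>, so \<open>r\<close> can serve as the joint between a geodesic to
  \<open>p\<close> and its reversal. The minimality of \<open>2 * len r + len p\<close> excludes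
  backtracking between the two.\<close>

lemma bounded_tau_decomposition:
  obtains c L where "c \<ge> 0" "\<And>g. g \<in> carrier G \<Longrightarrow> tau g \<le> B \<Longrightarrow>
     \<exists>p\<in>carrier G. \<exists>r\<in>carrier G. g = p \<otimes> r \<otimes> inv p \<and> len r \<le> L \<and> a p + a (inv p) \<le> a g + c"
proof -
  obtain cR where cR: "cR \<ge> 0" "\<And>r. r \<in> carrier G \<Longrightarrow> reduced r \<Longrightarrow> a r \<le> tau r + cR"
    using reduced_tau by blast
  obtain L :: nat where "real L \<ge> (B + cR + C\<^sub>2) / C\<^sub>1" using real_arch_simple by blast
  hence L: "C\<^sub>1 * real L \<ge> B + cR + C\<^sub>2" using C\<^sub>1 by (simp add: field_simps)
  have k: "0 < (1/8::real)" "(1/8::real) \<le> 1" by simp_all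
  obtain D where D0: "D \<ge> 0" and D: "\<And>x y m m' s. concatenable (1/8) x m s y m' \<Longrightarrow> len s \<le> L \<Longrightarrow>
     a (x m) + a (y m') \<le> a (x m \<otimes> s \<otimes> y m') + D"
    using concatenation_almost_additive[OF k] by blast
  show thesis
  proof (rule that[of D L, OF D0])
    fix g assume g: "g \<in> carrier G" "tau g \<le> B"
    obtain p r where p: "p \<in> carrier G" and r: "r \<in> carrier G" and gpr: "g = p \<otimes> r \<otimes> inv p"
      and red: "reduced r"
      and min: "\<And>x. x \<in> carrier G \<Longrightarrow> 2 * len r + len p \<le> 2 * dst x (g \<otimes> x) + len x"
      using reduced_conjugate[OF g(1)] by blast
    have "tau r = tau g" using tau_conj p r gpr by simp
    hence "C\<^sub>1 * real (len r) \<le> C\<^sub>1 * real L" using L cR(2)[OF r red] a_lower[OF r] g by simp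
    hence rL: "len r \<le> L" using C\<^sub>1 by simp
    define m where "m = len p"
    obtain x where x: "geodesic x m" "x 0 = \<one>" "x m = p" using geodesic_exists[OF p] unfolding m_def by blast
    note xc = geodesic_carrier[OF x(1)] and xd = geodesic_dst[OF x(1)]
    define y where "y j = inv p \<otimes> x (m - j)" for j
    have gy: "geodesic y m" unfolding y_def using geodesic_reverse[OF x(1)] p by simp
    have "a (x m) + a (y m) \<le> a (x m \<otimes> r \<otimes> y m) + D"
    proof (rule D[OF concatenableI[OF x(1,2) gy _ r] rL])
      show "y 0 = \<one>" using x p by (simp add: y_def)
      fix i j assume ij: "i \<le> m" "j \<le> m"
      define t where "t = m - j"
      have t: "t \<le> m" "j = m - t" using ij by (auto simp: t_def)
      have cs: "x i \<in> carrier G" "x t \<in> carrier G" "g \<otimes> x i \<in> carrier G" "g \<otimes> x t \<in> carrier G" "g \<otimes> p \<in> carrier G"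
        using xc ij t g p by auto
      define W where "W = dst (x i) (g \<otimes> x t)"
      have W: "dst (x i) (x m \<otimes> r \<otimes> y j) = W"
        using cs p r by (simp add: W_def y_def t_def x gpr m_assoc)
      have gp: "dst p (g \<otimes> p) = len r" using p r by (simp add: gpr dst_def m_assoc)
      have mi: "2 * len r + (m - i) \<le> 2 * dst (x i) (g \<otimes> x i)"
        using min[OF cs(1)] xd[of 0 i] x cs ij by (simp add: m_def)
      have mt: "2 * len r + (m - t) \<le> 2 * dst (x t) (g \<otimes> x t)"
        using min[OF cs(2)] xd[of 0 t] x cs t by (simp add: m_def)
      have di: "dst (x i) p = m - i" "dst (x t) p = m - t" "dst (g \<otimes> x t) (g \<otimes> p) = m - t"
        using xd[of i m] xd[of t m] x ij t cs g p by auto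
      \<comment> \<open>If \<open>i \<le> t\<close>, minimality at \<open>x i\<close> gives
        \<open>2 * len r + (m - i) \<le> 2 * W + 2 * (t - i)\<close>, and the route through
        \<open>p\<close> gives \<open>t - i \<le> W + len r\<close>. The weight 2 in the minimised
        quantity makes \<open>len r\<close> cancel, leaving \<open>m - i \<le> 4 * W\<close>. The
        other case is symmetric.\<close>
      have "(m - i) + (m - t) \<le> 8 * W"
      proof (cases "i \<le> t")
        case True
        have "dst (x i) (g \<otimes> x i) \<le> W + dst (g \<otimes> x t) (g \<otimes> x i)"
          unfolding W_def using cs by (intro dst_triangle) auto
        moreover have "dst (g \<otimes> x t) (g \<otimes> x i) = t - i"
          using xd[of i t] True t cs g dst_sym by simp
        moreover have "dst (x i) p \<le> W + dst (g \<otimes> x t) p"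
          unfolding W_def using cs p by (intro dst_triangle) auto
        moreover have "dst (g \<otimes> x t) p \<le> dst (g \<otimes> x t) (g \<otimes> p) + dst (g \<otimes> p) p"
          using cs p by (intro dst_triangle) auto
        moreover have "dst (g \<otimes> p) p = len r" using gp dst_sym cs p by simp
        ultimately show ?thesis using mi di True t ij by linarith
      next
        case False
        have "dst (x t) (g \<otimes> x t) \<le> dst (x t) (x i) + W"
          unfolding W_def using cs by (intro dst_triangle) auto
        moreover have "dst (x t) (x i) = i - t"
          using xd[of t i] False ij by simp
        moreover have "dst (g \<otimes> x t) (g \<otimes> p) \<le> dst (g \<otimes> x t) (x i) + dst (x i) (g \<otimes> p)"
          using cs p by (intro dst_triangle) auto
        moreover have "dst (g \<otimes> x t) (x i) = W" unfolding W_def using dst_sym cs by simp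
        moreover have "dst (x i) (g \<otimes> p) \<le> dst (x i) p + dst p (g \<otimes> p)"
          using cs p by (intro dst_triangle) auto
        ultimately show ?thesis using mt di gp False t ij by linarith
      qed
      thus "1/8 * real ((m - i) + j) \<le> real (dst (x i) (x m \<otimes> r \<otimes> y j))"
        unfolding W using t by simp
    qed
    moreover have "y m = inv p" using x p by (simp add: y_def)
    ultimately show "\<exists>p\<in>carrier G. \<exists>r\<in>carrier G. g = p \<otimes> r \<otimes> inv p \<and> len r \<le> L \<and> a p + a (inv p) \<le> a g + D"
      using p r rL x gpr by auto
  qed
qed

end

section \<open>Decomposition of conjugacy classes\<close>

context hyperbolic_length begin

text \<open>The forward half of an axis of \<open>r\<close>, made of copies of one geodesic word
  laid end to end. Windows straddling two copies are not claimed to be geodesic; that comes later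
  from \<open>r\<close> being shortest in its class.\<close>

lemma periodic_path:
  assumes r: "r \<in> carrier G" and l: "0 < len r"
  obtains z where "\<And>k. z k \<in> carrier G" "z 0 = \<one>" "\<And>k. z (k + len r) = r \<otimes> z k"
    "\<And>k. dst (z k) (z (Suc k)) \<le> 1"
proof -
  define l where "l = len r"
  obtain w where w: "geodesic w l" "w 0 = \<one>" "w l = r" using geodesic_exists[OF r] unfolding l_def by blast
  note wc = geodesic_carrier[OF w(1)] and wd = geodesic_dst[OF w(1)]
  have l0: "l > 0" using l by (simp add: l_def)
  define z where "z k = r [^] (k div l) \<otimes> w (k mod l)" for k :: nat
  have wm: "w (k mod l) \<in> carrier G" for k using wc[of "k mod l"] l0 by (simp add: less_imp_le)
  show thesis
  proof (rule that[of z])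
    show "z k \<in> carrier G" for k using r wm by (simp add: z_def)
    show "z 0 = \<one>" using w by (simp add: z_def)
    show "z (k + len r) = r \<otimes> z k" for k
      using r wm[of k] l0 nat_pow_Suc2[OF r, of "k div l"] unfolding l_def[symmetric] z_def by (simp add: m_assoc)
    show "dst (z k) (z (Suc k)) \<le> 1" for k
    proof (cases "Suc (k mod l) = l")
      case True
      have *: "Suc k mod l = 0" "Suc k div l = Suc (k div l)"
        using True by (simp_all add: mod_Suc div_Suc)
      have "z (Suc k) = r [^] (k div l) \<otimes> w l" using * w r by (simp add: z_def)
      hence "dst (z k) (z (Suc k)) = dst (w (k mod l)) (w l)" using r wm[of k] w by (simp add: z_def)
      thus ?thesis using wd[of "k mod l" l] True by simp
    next
      case False
      hence *: "Suc k mod l = Suc (k mod l)" "Suc k div l = k div l" by (simp_all add: mod_Suc div_Suc)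
      have "Suc (k mod l) \<le> l" using l0 by (simp add: Suc_leI)
      thus ?thesis using * r wm[of k] wm[of "Suc k"] wd[of "k mod l" "Suc (k mod l)"] by (simp add: z_def)
    qed
  qed
qed

text \<open>The set \<open>X\<close> consists of the cyclic permutations of a geodesic word for \<open>r\<close>. A shortest \<open>p\<close> that
  conjugates some \<open>s \<in> X\<close> to the given element is a shortest path to the axis of \<open>s\<close>, so
  \<open>p s\<close> and \<open>s p\<inverse>\<close> are quasigeodesic.\<close>

lemma long_class_decomposition:
  obtains c L where "c \<ge> 0" "\<And>r. r \<in> carrier G \<Longrightarrow> L \<le> len r \<Longrightarrow>
     (\<And>q. q \<in> carrier G \<Longrightarrow> len r \<le> len (q \<otimes> r \<otimes> inv q)) \<Longrightarrow>
     \<exists>X. finite X \<and> X \<subseteq> carrier G \<and> card X \<le> len r \<and>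
       (\<forall>q\<in>carrier G. \<exists>p\<in>carrier G. \<exists>s\<in>X. q \<otimes> r \<otimes> inv q = p \<otimes> s \<otimes> inv p \<and>
          a p + a (inv p) + tau r \<le> a (q \<otimes> r \<otimes> inv q) + c)"
proof -
  have k: "0 < (1/3::real)" "(1/3::real) \<le> 1" by simp_all
  obtain D where D0: "D \<ge> 0" and D: "\<And>x y m m' s. concatenable (1/3) x m s y m' \<Longrightarrow> len s \<le> 0 \<Longrightarrow>
     a (x m) + a (y m') \<le> a (x m \<otimes> s \<otimes> y m') + D"
    using concatenation_almost_additive[OF k] by blast
  obtain L' :: nat where "real L' \<ge> (2 * D + ln (2 * K)) / C" using real_arch_simple by blast
  hence L': "C * real L' \<ge> D + D + ln (2 * K)" using C by (simp add: field_simps)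
  show thesis
  proof (rule that[of "2 * D + ln 2" "Suc L'"])
    fix r assume r: "r \<in> carrier G" "Suc L' \<le> len r"
      and rmin: "\<And>q. q \<in> carrier G \<Longrightarrow> len r \<le> len (q \<otimes> r \<otimes> inv q)"
    define l where "l = len r"
    have l: "0 < l" using r by (simp add: l_def)
    obtain z where zc: "\<And>k. z k \<in> carrier G" and z0: "z 0 = \<one>" and zl: "\<And>k. z (k + l) = r \<otimes> z k"
      and zs: "\<And>k. dst (z k) (z (Suc k)) \<le> 1"
      using periodic_path[OF r(1)] l unfolding l_def by blast
    define S where "S i = inv (z i) \<otimes> (r \<otimes> z i)" for i
    have Sc: "S i \<in> carrier G" for i using zc r by (simp add: S_def)
    have Sl: "S (i + l) = S i" for i
      using zc[of i] r unfolding S_def zl by (simp add: inv_mult_group m_assoc)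
    have Smod: "S i = S (i mod l)" for i
    proof -
      have "S (t * l + j) = S j" for t j
      proof (induction t)
        case (Suc t)
        have "Suc t * l + j = (t * l + j) + l" by simp
        thus ?case using Sl[of "t * l + j"] Suc by metis
      qed simp
      from this[of "i div l" "i mod l"] show ?thesis by simp
    qed
    define X where "X = S ` {..<l}"
    have SX: "S i \<in> X" for i unfolding X_def using Smod[of i] l by (auto intro!: imageI)
    \<comment> \<open>A window of one period spells the cyclic permutation \<open>S i\<close>, which
      is a conjugate of \<open>r\<close> and therefore not shorter than \<open>r\<close>. With unit
      steps this makes the window geodesic.\<close>
    have geoz: "geodesic (\<lambda>j. inv (z i) \<otimes> z (i + j)) l" for i
    proof (rule geodesicI)
      have "len r \<le> len (inv (z i) \<otimes> r \<otimes> inv (inv (z i)))" by (rule rmin) (use zc in simp)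
      also have "inv (z i) \<otimes> r \<otimes> inv (inv (z i)) = S i" using zc r by (simp add: S_def m_assoc)
      finally show "l \<le> dst (inv (z i) \<otimes> z (i + 0)) (inv (z i) \<otimes> z (i + l))"
        using zc r by (simp add: S_def l_def[symmetric] zl)
    qed (use zc zs in auto)
    have "\<exists>p\<in>carrier G. \<exists>s\<in>X. q \<otimes> r \<otimes> inv q = p \<otimes> s \<otimes> inv p \<and>
          a p + a (inv p) + tau r \<le> a (q \<otimes> r \<otimes> inv q) + (2 * D + ln 2)" if q: "q \<in> carrier G" for q
    proof -
      define g where "g = q \<otimes> r \<otimes> inv q"
      have g: "g \<in> carrier G" using q r by (simp add: g_def)
      \<comment> \<open>All cyclic permutations compete at once, so that the end of a conjugator may
        slide along the axis.\<close>
      define P where "P p \<longleftrightarrow> p \<in> carrier G \<and> (\<exists>i. g = p \<otimes> S i \<otimes> inv p)" for p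
      have "P q" unfolding P_def g_def using q r z0 by (auto simp: S_def intro!: exI[of _ 0])
      define p where "p = arg_min len P"
      have Pp: "P p" and pmin: "\<And>x. P x \<Longrightarrow> len p \<le> len x"
        using arg_min_nat_lemma[of P q len] \<open>P q\<close> unfolding p_def by auto
      from Pp obtain i where p: "p \<in> carrier G" and gi: "g = p \<otimes> S i \<otimes> inv p" by (auto simp: P_def)
      define s where "s = S i"
      have s: "s \<in> carrier G" "s \<in> X" using Sc SX by (auto simp: s_def)
      define y where "y j = inv (z i) \<otimes> z (i + j)" for j
      have gy: "geodesic y l" using geoz[of i] unfolding y_def .
      have y0: "y 0 = \<one>" using zc by (simp add: y_def)
      have yl: "y l = s" using zc r by (simp add: y_def s_def S_def zl)
      have yc: "y j \<in> carrier G" for j using zc by (simp add: y_def)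
      \<comment> \<open>Sliding the end of \<open>p\<close> along the axis turns \<open>S i\<close>
        into \<open>S (i + j)\<close> and gives another admissible conjugator, so \<open>p\<close>
        ends at a point of this period nearest to \<open>\<one>\<close>. \<open>min2\<close> says
        the same for the preceding period, which is the one that matters for
        \<open>s \<otimes> inv p\<close>.\<close>
      have min1: "len p \<le> len (p \<otimes> y j)" for j
      proof (rule pmin)
        have "g = p \<otimes> y j \<otimes> S (i + j) \<otimes> inv (p \<otimes> y j)"
          using p zc r unfolding gi S_def y_def by (simp add: inv_mult_group m_assoc)
        thus "P (p \<otimes> y j)" unfolding P_def using p yc by blast
      qed
      have min2: "len p \<le> len (p \<otimes> (inv s \<otimes> y j))" for j
      proof (rule pmin)
        have "g = p \<otimes> (inv s \<otimes> y j) \<otimes> S (i + j) \<otimes> inv (p \<otimes> (inv s \<otimes> y j))"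
          using p zc r unfolding gi s_def S_def y_def by (simp add: inv_mult_group m_assoc)
        thus "P (p \<otimes> (inv s \<otimes> y j))" unfolding P_def using p yc s by blast
      qed
      define m where "m = len p"
      obtain x where x: "geodesic x m" "x 0 = \<one>" "x m = p" using geodesic_exists[OF p] unfolding m_def by blast
      note xc = geodesic_carrier[OF x(1)] and xd = geodesic_dst[OF x(1)] and yd = geodesic_dst[OF gy]
      have ps: "a p + a s \<le> a (p \<otimes> s) + D"
      proof -
        have "a (x m) + a (y l) \<le> a (x m \<otimes> \<one> \<otimes> y l) + D"
        proof (rule D[OF concatenableI[OF x(1,2) gy y0]])
          \<comment> \<open>For the distance W in question, minimality gives \<open>m - i'\<close>
            at most W, and the triangle inequality gives \<open>j\<close> at most
            \<open>m - i'\<close> plus W; the sum is at most 3 W, hence the factor 1/3.\<close>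
          fix i' j assume ij: "i' \<le> m" "j \<le> l"
          have cs: "x i' \<in> carrier G" "p \<otimes> y j \<in> carrier G" using xc ij p yc by auto
          have "m \<le> dst \<one> (p \<otimes> y j)" using min1 cs by (simp add: m_def)
          also have "\<dots> \<le> dst \<one> (x i') + dst (x i') (p \<otimes> y j)" using cs by (intro dst_triangle) auto
          also have "dst \<one> (x i') = i'" using xd[of 0 i'] x ij by simp
          finally have 1: "m \<le> i' + dst (x i') (p \<otimes> y j)" .
          have "dst p (p \<otimes> y j) \<le> dst p (x i') + dst (x i') (p \<otimes> y j)" using cs p by (intro dst_triangle) auto
          moreover have "dst p (x i') = m - i'" using xd[of i' m] x ij dst_sym[OF p cs(1)] by simp
          moreover have "dst p (p \<otimes> y j) = j" using yd[of 0 j] y0 ij p yc by (simp add: dst_def)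
          ultimately have "m - i' + j \<le> 3 * dst (x i') (p \<otimes> y j)" using 1 ij by linarith
          thus "1/3 * real ((m - i') + j) \<le> real (dst (x i') (x m \<otimes> \<one> \<otimes> y j))"
            using x p by simp
        qed simp_all
        thus ?thesis using x yl p by simp
      qed
      have sp: "a s + a (inv p) \<le> a (s \<otimes> inv p) + D"
      proof -
        define x' where "x' j = inv p \<otimes> x (m - j)" for j
        have gx': "geodesic x' m" unfolding x'_def using geodesic_reverse[OF x(1)] p by simp
        have x'0: "x' 0 = \<one>" using x p by (simp add: x'_def)
        have "a (y l) + a (x' m) \<le> a (y l \<otimes> \<one> \<otimes> x' m) + D"
        proof (rule D[OF concatenableI[OF gy y0 gx' x'0]])
          fix j i' assume ij: "j \<le> l" "i' \<le> m"
          define t where "t = m - i'"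
          have t: "t \<le> m" "i' = m - t" using ij by (auto simp: t_def)
          define v where "v = p \<otimes> (inv s \<otimes> y j)"
          have cs: "x t \<in> carrier G" "v \<in> carrier G" using xc t p yc s by (auto simp: v_def)
          have W: "dst (y j) (y l \<otimes> \<one> \<otimes> x' i') = dst v (x t)"
          proof -
            have "dst v (x t) = dst (s \<otimes> (inv p \<otimes> v)) (s \<otimes> (inv p \<otimes> x t))"
              using cs p s by simp
            thus ?thesis using p s yc[of j] by (simp add: v_def yl x'_def t_def)
          qed
          have "m \<le> dst \<one> v" using min2[of j] cs by (simp add: m_def v_def)
          also have "\<dots> \<le> dst \<one> (x t) + dst (x t) v" using cs by (intro dst_triangle) auto
          also have "dst \<one> (x t) = t" using xd[of 0 t] x t by simp
          finally have 1: "m \<le> t + dst v (x t)" using dst_sym cs by simp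
          have "dst v p \<le> dst v (x t) + dst (x t) p" using cs p by (intro dst_triangle) auto
          moreover have "dst (x t) p = m - t" using xd[of t m] x t by simp
          moreover have "dst v p = l - j"
          proof -
            have "dst v p = dst (p \<otimes> (inv s \<otimes> y j)) (p \<otimes> (inv s \<otimes> y l))"
              using p s by (simp add: v_def yl)
            also have "\<dots> = dst (y j) (y l)" using p s yc by (simp only: dst_left inv_closed m_closed)
            finally show ?thesis using yd[of j l] ij by simp
          qed
          ultimately have "l - j + i' \<le> 3 * dst v (x t)" using 1 t by linarith
          thus "1/3 * real ((l - j) + i') \<le> real (dst (y j) (y l \<otimes> \<one> \<otimes> x' i'))"
            unfolding W by simp
        qed simp_all
        moreover have "x' m = inv p" using x p by (simp add: x'_def)
        ultimately show ?thesis using yl s by simp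
      qed
      have "len s = l" using yd[of 0 l] y0 yl s by simp
      moreover have "C * real L' \<le> C * real l" using r C by (simp add: l_def)
      ultimately have "C * real (len s) \<ge> D + D + ln (2 * K)" using L' by simp
      \<comment> \<open>The middle factor \<open>s\<close> is longer than the threshold set by
        \<open>L'\<close>, so the bounded defects at its two ends combine into one for the whole
        product.\<close>
      from local_to_global[OF p s(1) _ ps sp this]
      have "a (p \<otimes> s) + a (inv p) \<le> a g + (D + ln 2)" using p gi by (simp add: s_def)
      moreover have "tau r = tau s"
      proof -
        have "tau (inv (z i) \<otimes> r \<otimes> inv (inv (z i))) = tau r" by (rule tau_conj) (use zc r in auto)
        thus ?thesis using zc r by (simp add: s_def S_def m_assoc)
      qed
      ultimately have "a p + a (inv p) + tau r \<le> a g + (2 * D + ln 2)" using ps tau_le[OF s(1)] by simp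
      thus ?thesis using p s gi unfolding g_def s_def by blast
    qed
    moreover have "finite X" "X \<subseteq> carrier G" unfolding X_def using Sc by auto
    moreover have "card X \<le> len r" unfolding X_def using card_image_le[of "{..<l}" S] by (simp add: l_def)
    ultimately show "\<exists>X. finite X \<and> X \<subseteq> carrier G \<and> card X \<le> len r \<and>
       (\<forall>q\<in>carrier G. \<exists>p\<in>carrier G. \<exists>s\<in>X. q \<otimes> r \<otimes> inv q = p \<otimes> s \<otimes> inv p \<and>
          a p + a (inv p) + tau r \<le> a (q \<otimes> r \<otimes> inv q) + (2 * D + ln 2))"
      by blast
  qed (use D0 in simp)
qed

theorem conjugate_close_to_tau:
  obtains c where "\<And>g. g \<in> carrier G \<Longrightarrow>
    \<exists>p\<in>carrier G. a (p \<otimes> g \<otimes> inv p) \<le> tau g + c"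
proof -
  obtain c where c: "\<And>r. r \<in> carrier G \<Longrightarrow> reduced r \<Longrightarrow> a r \<le> tau r + c"
    using reduced_tau by blast
  show thesis
  proof (rule that[of c])
    fix g assume g: "g \<in> carrier G"
    obtain p r where p: "p \<in> carrier G" "r \<in> carrier G" "g = p \<otimes> r \<otimes> inv p" "reduced r"
      "\<And>x. x \<in> carrier G \<Longrightarrow> 2 * len r + len p \<le> 2 * dst x (g \<otimes> x) + len x"
      using reduced_conjugate[OF g] by blast
    have "inv p \<otimes> g \<otimes> inv (inv p) = r" using p(1-3) by (simp add: m_assoc)
    moreover have "tau g = tau r" using tau_conj p(1-3) by simp
    ultimately show "\<exists>p\<in>carrier G. a (p \<otimes> g \<otimes> inv p) \<le> tau g + c"
      using p(1,2,4) c[of r] by (intro bexI[of _ "inv p"]) auto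
  qed
qed

text \<open>The shortest representative \<open>r\<close> of the class decides. If it is long, the
  cyclic permutations serve as the set, and their number is linear in \<open>tau g\<close> because a
  shortest representative is reduced, so that \<open>a r\<close> is close to \<open>tau g\<close>.
  If it is short, then \<open>tau g \<le> M\<close>, one fixed ball serves all these classes, and
  the term \<open>tau g\<close> costs at most \<open>M\<close>.\<close>

theorem class_decomposition:
  obtains c where "c \<ge> 0" "\<And>g. g \<in> carrier G \<Longrightarrow>
     \<exists>X. finite X \<and> X \<subseteq> carrier G \<and> real (card X) \<le> c * (1 + tau g) \<and>
       (\<forall>q\<in>carrier G. \<exists>p\<in>carrier G. \<exists>s\<in>X. q \<otimes> g \<otimes> inv q = p \<otimes> s \<otimes> inv p \<and>
          a p + a (inv p) + tau g \<le> a (q \<otimes> g \<otimes> inv q) + c)"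
proof (rule long_class_decomposition)
  fix cL L assume cL: "cL \<ge> 0" and long: "\<And>r. r \<in> carrier G \<Longrightarrow> L \<le> len r \<Longrightarrow>
     (\<And>q. q \<in> carrier G \<Longrightarrow> len r \<le> len (q \<otimes> r \<otimes> inv q)) \<Longrightarrow>
     \<exists>X. finite X \<and> X \<subseteq> carrier G \<and> card X \<le> len r \<and>
       (\<forall>q\<in>carrier G. \<exists>p\<in>carrier G. \<exists>s\<in>X. q \<otimes> r \<otimes> inv q = p \<otimes> s \<otimes> inv p \<and>
          a p + a (inv p) + tau r \<le> a (q \<otimes> r \<otimes> inv q) + cL)"
  obtain cR where cR: "cR \<ge> 0" "\<And>r. r \<in> carrier G \<Longrightarrow> reduced r \<Longrightarrow> a r \<le> tau r + cR"
    using reduced_tau by blast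
  obtain M where M: "M \<ge> 0" "\<And>x. x \<in> carrier G \<Longrightarrow> len x \<le> L \<Longrightarrow> a x \<le> M"
    using a_bounded_on_balls by blast
  show thesis
  proof (rule bounded_tau_decomposition[of M])
    fix cS L' assume cS: "cS \<ge> 0" and short: "\<And>g. g \<in> carrier G \<Longrightarrow> tau g \<le> M \<Longrightarrow>
       \<exists>p\<in>carrier G. \<exists>r\<in>carrier G. g = p \<otimes> r \<otimes> inv p \<and> len r \<le> L' \<and> a p + a (inv p) \<le> a g + cS"
    define Y where "Y = {x \<in> carrier G. len x \<le> L'}"
    define e where "e = (cR + \<bar>C\<^sub>2\<bar> + 1) / C\<^sub>1"
    have e: "e \<ge> 0" unfolding e_def using cR C\<^sub>1 by simp
    define c where "c = cL + (cS + M) + real (card Y) + e"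
    have c: "c \<ge> 0" "c \<ge> cL" "c \<ge> cS + M" "c \<ge> real (card Y)" "c \<ge> e"
      unfolding c_def using cL cS M e by auto
    show thesis
    proof (rule that[OF c(1)])
      fix g assume g: "g \<in> carrier G"
      define q\<^sub>0 where "q\<^sub>0 = arg_min (\<lambda>q. len (q \<otimes> g \<otimes> inv q)) (\<lambda>q. q \<in> carrier G)"
      have q\<^sub>0: "q\<^sub>0 \<in> carrier G \<and> (\<forall>q. q \<in> carrier G \<longrightarrow> len (q\<^sub>0 \<otimes> g \<otimes> inv q\<^sub>0) \<le> len (q \<otimes> g \<otimes> inv q))"
        using arg_min_nat_lemma[of "\<lambda>q. q \<in> carrier G" \<one> "\<lambda>q. len (q \<otimes> g \<otimes> inv q)"]
        unfolding q\<^sub>0_def by auto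
      define r where "r = q\<^sub>0 \<otimes> g \<otimes> inv q\<^sub>0"
      have r: "r \<in> carrier G" "tau r = tau g" using q\<^sub>0 g tau_conj by (auto simp: r_def)
      have conj: "q \<otimes> r \<otimes> inv q = (q \<otimes> q\<^sub>0) \<otimes> g \<otimes> inv (q \<otimes> q\<^sub>0)" if "q \<in> carrier G" for q
        using that q\<^sub>0 g by (simp add: r_def inv_mult_group m_assoc)
      have conj': "q \<otimes> g \<otimes> inv q = (q \<otimes> inv q\<^sub>0) \<otimes> r \<otimes> inv (q \<otimes> inv q\<^sub>0)" if "q \<in> carrier G" for q
        using that q\<^sub>0 g by (simp add: r_def inv_mult_group m_assoc)
      have rmin: "len r \<le> len (q \<otimes> r \<otimes> inv q)" if "q \<in> carrier G" for q
        unfolding conj[OF that] using q\<^sub>0 that unfolding r_def by simp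
      have tau0: "tau g \<ge> 0" using tau_nonneg g by simp
      show "\<exists>X. finite X \<and> X \<subseteq> carrier G \<and> real (card X) \<le> c * (1 + tau g) \<and>
         (\<forall>q\<in>carrier G. \<exists>p\<in>carrier G. \<exists>s\<in>X. q \<otimes> g \<otimes> inv q = p \<otimes> s \<otimes> inv p \<and>
            a p + a (inv p) + tau g \<le> a (q \<otimes> g \<otimes> inv q) + c)"
      proof (cases "L \<le> len r")
        case True
        from long[OF r(1) True rmin] obtain X where X: "finite X" "X \<subseteq> carrier G" "card X \<le> len r"
          and XX: "\<And>q. q \<in> carrier G \<Longrightarrow> \<exists>p\<in>carrier G. \<exists>s\<in>X. q \<otimes> r \<otimes> inv q = p \<otimes> s \<otimes> inv p \<and>
            a p + a (inv p) + tau r \<le> a (q \<otimes> r \<otimes> inv q) + cL" by blast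
        have "reduced r" unfolding reduced_def
        proof (intro ballI impI)
          fix u v assume uv: "u \<in> carrier G" "v \<in> carrier G" "r = u \<otimes> v"
          have "len r \<le> len (inv u \<otimes> r \<otimes> inv (inv u))" by (rule rmin) (use uv(1) in simp)
          also have "inv u \<otimes> r \<otimes> inv (inv u) = v \<otimes> u" using uv by (simp add: m_assoc)
          finally show "2 * len r \<le> 2 * len (v \<otimes> u) + len u" by linarith
        qed
        hence "a r \<le> tau g + cR" using cR(2)[OF r(1)] r(2) by simp
        hence "C\<^sub>1 * real (len r) \<le> tau g + (cR + \<bar>C\<^sub>2\<bar>)" using a_lower[OF r(1)] by linarith
        also have "\<dots> \<le> (cR + \<bar>C\<^sub>2\<bar> + 1) * (1 + tau g)"
          using tau0 cR(1) by (simp add: algebra_simps)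
        finally have "real (len r) \<le> e * (1 + tau g)" unfolding e_def using C\<^sub>1 by (simp add: field_simps)
        also have "\<dots> \<le> c * (1 + tau g)" using c tau0 by (intro mult_right_mono) auto
        finally have "real (card X) \<le> c * (1 + tau g)" using X(3) by simp
        moreover have "\<exists>p\<in>carrier G. \<exists>s\<in>X. q \<otimes> g \<otimes> inv q = p \<otimes> s \<otimes> inv p \<and>
            a p + a (inv p) + tau g \<le> a (q \<otimes> g \<otimes> inv q) + c" if "q \<in> carrier G" for q
          unfolding conj'[OF that] using XX[of "q \<otimes> inv q\<^sub>0"] that q\<^sub>0 r(2) c(2) by fastforce
        ultimately show ?thesis using X by blast
      next
        case False
        hence "tau g \<le> M" using tau_le[OF r(1)] M(2)[OF r(1)] r(2) by simp
        have "real (card Y) \<le> c * (1 + tau g)"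
        proof -
          have "c * 1 \<le> c * (1 + tau g)" using c tau0 by (intro mult_left_mono) auto
          thus ?thesis using c by simp
        qed
        moreover have "finite Y" "Y \<subseteq> carrier G" using finite_ball by (auto simp: Y_def)
        moreover have "\<exists>p\<in>carrier G. \<exists>s\<in>Y. q \<otimes> g \<otimes> inv q = p \<otimes> s \<otimes> inv p \<and>
            a p + a (inv p) + tau g \<le> a (q \<otimes> g \<otimes> inv q) + c" if q: "q \<in> carrier G" for q
        proof -
          have "tau (q \<otimes> g \<otimes> inv q) \<le> M" using tau_conj[OF q g] \<open>tau g \<le> M\<close> by simp
          from short[OF _ this] obtain p s where "p \<in> carrier G" "s \<in> carrier G"
            "q \<otimes> g \<otimes> inv q = p \<otimes> s \<otimes> inv p" "len s \<le> L'" "a p + a (inv p) \<le> a (q \<otimes> g \<otimes> inv q) + cS"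
            using q g by auto
          thus ?thesis using \<open>tau g \<le> M\<close> c(3) by (intro bexI[of _ p] bexI[of _ s]) (auto simp: Y_def)
        qed
        ultimately show ?thesis by blast
      qed
    qed
  qed
qed

end

section \<open>Matrix norms and second compound matrices\<close>

text \<open>Submultiplicativity of the entrywise l1 norm, over an arbitrary index set so that it
  applies to matrices and to their compounds indexed by pairs.\<close>

lemma sum_norm_product_le:
  fixes f g :: "'i \<Rightarrow> 'i \<Rightarrow> 'a :: real_normed_field"
  assumes I: "finite I"
  shows "(\<Sum>x\<in>I. \<Sum>y\<in>I. norm (\<Sum>z\<in>I. f x z * g z y)) \<le>
         (\<Sum>x\<in>I. \<Sum>z\<in>I. norm (f x z)) * (\<Sum>z\<in>I. \<Sum>y\<in>I. norm (g z y))"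
proof -
  let ?N = "\<Sum>z\<in>I. \<Sum>y\<in>I. norm (g z y)"
  have "(\<Sum>x\<in>I. \<Sum>y\<in>I. norm (\<Sum>z\<in>I. f x z * g z y)) \<le> (\<Sum>x\<in>I. \<Sum>y\<in>I. \<Sum>z\<in>I. norm (f x z) * norm (g z y))"
    by (intro sum_mono order.trans[OF norm_sum]) (simp add: norm_mult)
  also have "\<dots> = (\<Sum>x\<in>I. \<Sum>z\<in>I. norm (f x z) * (\<Sum>y\<in>I. norm (g z y)))"
    by (subst sum.swap) (simp add: sum_distrib_left)
  also have "\<dots> \<le> (\<Sum>x\<in>I. \<Sum>z\<in>I. norm (f x z) * ?N)"
    by (intro sum_mono mult_left_mono member_le_sum[of _ I "\<lambda>z. \<Sum>y\<in>I. norm (g z y)"]) (auto simp: I sum_nonneg)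
  also have "\<dots> = (\<Sum>x\<in>I. \<Sum>z\<in>I. norm (f x z)) * ?N" by (simp add: sum_distrib_right)
  finally show ?thesis .
qed

definition mnorm :: "nat \<Rightarrow> 'a :: real_normed_field mat \<Rightarrow> real" where
  "mnorm n A = (\<Sum>i<n. \<Sum>j<n. norm (A $$ (i, j)))"

definition idx2 :: "nat \<Rightarrow> (nat \<times> nat) set" where
  "idx2 n = {..<n} \<times> {..<n}"

text \<open>The second compound matrix, indexed by all ordered pairs of rows and columns; each genuine
  minor therefore occurs four times, up to sign.\<close>

definition compound2 :: "'a :: comm_ring_1 mat \<Rightarrow> nat \<times> nat \<Rightarrow> nat \<times> nat \<Rightarrow> 'a" where
  "compound2 A x y = A $$ (fst x, fst y) * A $$ (snd x, snd y) - A $$ (fst x, snd y) * A $$ (snd x, fst y)"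

definition mnorm2 :: "nat \<Rightarrow> 'a :: real_normed_field mat \<Rightarrow> real" where
  "mnorm2 n A = (\<Sum>x\<in>idx2 n. \<Sum>y\<in>idx2 n. norm (compound2 A x y))"

definition mtrace :: "nat \<Rightarrow> 'a :: comm_ring_1 mat \<Rightarrow> 'a" where
  "mtrace n A = (\<Sum>i<n. A $$ (i, i))"

text \<open>Twice the trace on the exterior square: every unordered pair occurs in both orders, and
  equal indices contribute zero.\<close>

definition mtrace2 :: "nat \<Rightarrow> 'a :: comm_ring_1 mat \<Rightarrow> 'a" where
  "mtrace2 n A = (\<Sum>x\<in>idx2 n. compound2 A x x)"

lemma finite_idx2 [simp]: "finite (idx2 n)"
  by (simp add: idx2_def)

lemma mnorm_nonneg: "0 \<le> mnorm n A" and mnorm2_nonneg: "0 \<le> mnorm2 n A"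
  by (simp_all add: mnorm_def mnorm2_def sum_nonneg)

lemma mult_entry:
  assumes "A \<in> carrier_mat n n" "B \<in> carrier_mat n n" "i < n" "j < n"
  shows "(A * B) $$ (i, j) = (\<Sum>k<n. A $$ (i, k) * B $$ (k, j))"
  using assms by (auto simp: scalar_prod_def atLeast0LessThan intro!: sum.cong)

lemma mnorm_mult:
  assumes "A \<in> carrier_mat n n" "B \<in> carrier_mat n n"
  shows "mnorm n (A * B) \<le> mnorm n A * mnorm n B"
proof -
  have "mnorm n (A * B) = (\<Sum>i<n. \<Sum>j<n. norm (\<Sum>k<n. A $$ (i, k) * B $$ (k, j)))"
    unfolding mnorm_def by (intro sum.cong refl) (simp add: mult_entry[OF assms] del: index_mult_mat)
  thus ?thesis unfolding mnorm_def
    using sum_norm_product_le[of "{..<n}" "\<lambda>i k. A $$ (i, k)" "\<lambda>k j. B $$ (k, j)"] by simp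
qed

lemma sum_idx2: "(\<Sum>x\<in>idx2 n. f x) = (\<Sum>p<n. \<Sum>q<n. f (p, q))"
  by (simp add: idx2_def sum.cartesian_product)

lemma compound2_swap: "compound2 B (q, p) y = - compound2 B (p, q) y"
  by (simp add: compound2_def algebra_simps)

text \<open>Cauchy-Binet; the factor 2 is due to summing over ordered pairs. The expansion
  \<open>S1\<close> is added to \<open>S2\<close>, its copy with the summation indices exchanged,
  which flips the sign of the minor of \<open>B\<close>.\<close>

lemma compound2_mult:
  fixes A B :: "'a :: real_normed_field mat"
  assumes A: "A \<in> carrier_mat n n" and B: "B \<in> carrier_mat n n" and x: "x \<in> idx2 n" and y: "y \<in> idx2 n"
  shows "2 * compound2 (A * B) x y = (\<Sum>z\<in>idx2 n. compound2 A x z * compound2 B z y)"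
proof -
  obtain i k j l where xy: "x = (i, k)" "y = (j, l)" by (cases x, cases y) auto
  have ik: "i < n" "k < n" "j < n" "l < n" using x y by (auto simp: xy idx2_def)
  let ?S = "\<lambda>f. \<Sum>p<n. \<Sum>q<n. f p q"
  have S1: "compound2 (A * B) x y = ?S (\<lambda>p q. A $$ (i, p) * A $$ (k, q) * compound2 B (p, q) y)"
  proof -
    have "compound2 (A * B) x y = ?S (\<lambda>p q. (A $$ (i, p) * B $$ (p, j)) * (A $$ (k, q) * B $$ (q, l)))
       - ?S (\<lambda>p q. (A $$ (i, p) * B $$ (p, l)) * (A $$ (k, q) * B $$ (q, j)))"
      by (simp add: compound2_def xy mult_entry[OF A B] ik sum_product del: index_mult_mat)
    also have "\<dots> = ?S (\<lambda>p q. (A $$ (i, p) * B $$ (p, j)) * (A $$ (k, q) * B $$ (q, l))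
       - (A $$ (i, p) * B $$ (p, l)) * (A $$ (k, q) * B $$ (q, j)))"
      by (simp add: sum_subtractf)
    also have "\<dots> = ?S (\<lambda>p q. A $$ (i, p) * A $$ (k, q) * compound2 B (p, q) y)"
      by (intro sum.cong refl) (simp add: compound2_def xy algebra_simps)
    finally show ?thesis .
  qed
  also have "\<dots> = ?S (\<lambda>q p. A $$ (i, p) * A $$ (k, q) * compound2 B (p, q) y)"
    by (rule sum.swap)
  finally have S2: "compound2 (A * B) x y = ?S (\<lambda>p q. - (A $$ (i, q) * A $$ (k, p) * compound2 B (p, q) y))"
    by (subst (asm) compound2_swap) simp
  have "2 * compound2 (A * B) x y = compound2 (A * B) x y + compound2 (A * B) x y" by simp
  also have "\<dots> = ?S (\<lambda>p q. A $$ (i, p) * A $$ (k, q) * compound2 B (p, q) y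
      + - (A $$ (i, q) * A $$ (k, p) * compound2 B (p, q) y))"
    by (subst S1, subst S2) (simp only: sum.distrib)
  also have "\<dots> = (\<Sum>z\<in>idx2 n. compound2 A x z * compound2 B z y)"
    unfolding sum_idx2 by (intro sum.cong refl) (simp add: compound2_def xy algebra_simps)
  finally show ?thesis .
qed

lemma mnorm2_mult:
  assumes A: "A \<in> carrier_mat n n" and B: "B \<in> carrier_mat n n"
  shows "mnorm2 n (A * B) \<le> mnorm2 n A * mnorm2 n B"
proof -
  have "mnorm2 n (A * B) \<le> 2 * mnorm2 n (A * B)" using mnorm2_nonneg[of n "A * B"] by simp
  also have "\<dots> = (\<Sum>x\<in>idx2 n. \<Sum>y\<in>idx2 n. norm (\<Sum>z\<in>idx2 n. compound2 A x z * compound2 B z y))"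
    unfolding mnorm2_def sum_distrib_left
    by (intro sum.cong refl) (simp add: compound2_mult[OF A B, symmetric] norm_mult)
  also have "\<dots> \<le> mnorm2 n A * mnorm2 n B" unfolding mnorm2_def
    by (rule sum_norm_product_le) simp
  finally show ?thesis .
qed

lemma mtrace_mult_commute:
  assumes A: "A \<in> carrier_mat n n" and B: "B \<in> carrier_mat n n"
  shows "mtrace n (A * B) = mtrace n (B * A)"
proof -
  have "mtrace n (A * B) = (\<Sum>i<n. \<Sum>k<n. A $$ (i, k) * B $$ (k, i))"
    unfolding mtrace_def by (intro sum.cong refl) (simp add: mult_entry[OF A B] del: index_mult_mat)
  also have "\<dots> = (\<Sum>k<n. \<Sum>i<n. A $$ (i, k) * B $$ (k, i))" by (rule sum.swap)
  also have "\<dots> = mtrace n (B * A)"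
    unfolding mtrace_def by (intro sum.cong refl) (simp add: mult_entry[OF B A] mult.commute del: index_mult_mat)
  finally show ?thesis .
qed

lemma mtrace2_mult:
  fixes A B :: "'a :: real_normed_field mat"
  assumes A: "A \<in> carrier_mat n n" and B: "B \<in> carrier_mat n n"
  shows "2 * mtrace2 n (A * B) = (\<Sum>x\<in>idx2 n. \<Sum>z\<in>idx2 n. compound2 A x z * compound2 B z x)"
  unfolding mtrace2_def sum_distrib_left by (intro sum.cong refl) (simp add: compound2_mult[OF A B])

lemma mtrace2_mult_commute:
  fixes A B :: "'a :: real_normed_field mat"
  assumes A: "A \<in> carrier_mat n n" and B: "B \<in> carrier_mat n n"
  shows "mtrace2 n (A * B) = mtrace2 n (B * A)"
proof -
  have "2 * mtrace2 n (A * B) = (\<Sum>z\<in>idx2 n. \<Sum>x\<in>idx2 n. compound2 A x z * compound2 B z x)"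
    unfolding mtrace2_mult[OF A B] by (rule sum.swap)
  also have "\<dots> = 2 * mtrace2 n (B * A)" unfolding mtrace2_mult[OF B A] by (simp add: mult.commute)
  finally show ?thesis by simp
qed

text \<open>With \<open>p\<close> and \<open>q\<close> fixed, the pairs \<open>(p, c)\<close> and
  \<open>(b, q)\<close> determine \<open>b\<close> and \<open>c\<close>, so the sum runs over
  distinct entries of the compound.\<close>

lemma compound2_row_col_le:
  assumes "p < n" "q < n"
  shows "(\<Sum>b<n. \<Sum>c<n. norm (compound2 A (p, c) (b, q))) \<le> mnorm2 n A"
proof -
  have "(\<Sum>b<n. \<Sum>c<n. norm (compound2 A (p, c) (b, q)))
      = (\<Sum>w\<in>idx2 n. norm (compound2 A (p, snd w) (fst w, q)))"
    by (simp add: sum_idx2)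
  also have "\<dots> = (\<Sum>v\<in>(\<lambda>w. ((p, snd w), (fst w, q))) ` idx2 n. norm (compound2 A (fst v) (snd v)))"
    by (subst sum.reindex) (auto simp: inj_on_def prod_eq_iff)
  also have "\<dots> \<le> (\<Sum>v\<in>idx2 n \<times> idx2 n. norm (compound2 A (fst v) (snd v)))"
    using assms by (intro sum_mono2) (auto simp: idx2_def)
  also have "\<dots> = mnorm2 n A" unfolding mnorm2_def by (simp add: sum.cartesian_product case_prod_unfold)
  finally show ?thesis .
qed

text \<open>Entrywise, \<open>(XY)\<^sub>a\<^sub>b (YZ)\<^sub>c\<^sub>d - (XYZ)\<^sub>a\<^sub>d Y\<^sub>c\<^sub>b\<close> is a sum of terms \<open>X\<^sub>a\<^sub>p m Z\<^sub>q\<^sub>d\<close> in which \<open>m\<close> is a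
  \<open>2 \<times> 2\<close> minor of \<open>Y\<close>.\<close>

lemma mnorm_four_point:
  fixes X Y Z :: "'a :: real_normed_field mat"
  assumes X: "X \<in> carrier_mat n n" and Y: "Y \<in> carrier_mat n n" and Z: "Z \<in> carrier_mat n n"
  shows "mnorm n (X * Y) * mnorm n (Y * Z) \<le>
         mnorm n (X * Y * Z) * mnorm n Y + mnorm n X * mnorm n Z * mnorm2 n Y"
proof -
  define rx where "rx a = (\<Sum>p<n. norm (X $$ (a, p)))" for a
  define cz where "cz d = (\<Sum>q<n. norm (Z $$ (q, d)))" for d
  have XY: "X * Y \<in> carrier_mat n n" using X Y by simp
  have entry: "norm ((X * Y) $$ (a, b)) * norm ((Y * Z) $$ (c, d)) \<le>
      norm ((X * Y * Z) $$ (a, d)) * norm (Y $$ (c, b)) +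
      (\<Sum>v\<in>idx2 n. norm (X $$ (a, fst v)) * norm (Z $$ (snd v, d)) * norm (compound2 Y (fst v, c) (b, snd v)))"
    if "a < n" "b < n" "c < n" "d < n" for a b c d
  proof -
    let ?R = "\<Sum>p<n. \<Sum>q<n. X $$ (a, p) * compound2 Y (p, c) (b, q) * Z $$ (q, d)"
    have 1: "(X * Y) $$ (a, b) * (Y * Z) $$ (c, d)
        = (\<Sum>p<n. \<Sum>q<n. (X $$ (a, p) * Y $$ (p, b)) * (Y $$ (c, q) * Z $$ (q, d)))"
      using that by (simp add: mult_entry[OF X Y] mult_entry[OF Y Z] sum_product del: index_mult_mat)
    have "(X * Y * Z) $$ (a, d) = (\<Sum>q<n. \<Sum>p<n. X $$ (a, p) * Y $$ (p, q) * Z $$ (q, d))"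
      using that by (simp add: mult_entry[OF XY Z] mult_entry[OF X Y] sum_distrib_right del: index_mult_mat)
    also have "\<dots> = (\<Sum>p<n. \<Sum>q<n. X $$ (a, p) * Y $$ (p, q) * Z $$ (q, d))" by (rule sum.swap)
    finally have 2: "(X * Y * Z) $$ (a, d) * Y $$ (c, b) = (\<Sum>p<n. \<Sum>q<n. X $$ (a, p) * Y $$ (p, q) * Z $$ (q, d) * Y $$ (c, b))"
      by (simp add: sum_distrib_right)
    have "(X * Y) $$ (a, b) * (Y * Z) $$ (c, d) = (X * Y * Z) $$ (a, d) * Y $$ (c, b) + ?R"
      unfolding 1 2 sum.distrib[symmetric]
      by (intro sum.cong refl) (simp add: compound2_def algebra_simps)
    hence "norm ((X * Y) $$ (a, b)) * norm ((Y * Z) $$ (c, d)) = norm ((X * Y * Z) $$ (a, d) * Y $$ (c, b) + ?R)"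
      by (simp only: norm_mult[symmetric])
    also have "\<dots> \<le> norm ((X * Y * Z) $$ (a, d) * Y $$ (c, b)) + norm ?R" by (rule norm_triangle_ineq)
    finally have "norm ((X * Y) $$ (a, b)) * norm ((Y * Z) $$ (c, d)) \<le>
       norm ((X * Y * Z) $$ (a, d)) * norm (Y $$ (c, b)) + norm ?R" by (simp only: norm_mult)
    moreover have "norm ?R \<le> (\<Sum>v\<in>idx2 n. norm (X $$ (a, fst v)) * norm (Z $$ (snd v, d)) * norm (compound2 Y (fst v, c) (b, snd v)))"
      unfolding sum_idx2
      by (intro order.trans[OF norm_sum] sum_mono) (simp add: norm_mult mult_ac)
    ultimately show ?thesis by linarith
  qed
  have row: "(\<Sum>b<n. norm ((X * Y) $$ (a, b))) * (\<Sum>c<n. norm ((Y * Z) $$ (c, d))) \<le>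
      norm ((X * Y * Z) $$ (a, d)) * mnorm n Y + rx a * cz d * mnorm2 n Y" if "a < n" "d < n" for a d
  proof -
    have "(\<Sum>b<n. norm ((X * Y) $$ (a, b))) * (\<Sum>c<n. norm ((Y * Z) $$ (c, d)))
       = (\<Sum>b<n. \<Sum>c<n. norm ((X * Y) $$ (a, b)) * norm ((Y * Z) $$ (c, d)))" by (rule sum_product)
    also have "\<dots> \<le> (\<Sum>b<n. \<Sum>c<n. norm ((X * Y * Z) $$ (a, d)) * norm (Y $$ (c, b)) +
      (\<Sum>v\<in>idx2 n. norm (X $$ (a, fst v)) * norm (Z $$ (snd v, d)) * norm (compound2 Y (fst v, c) (b, snd v))))"
      by (intro sum_mono entry) (use that in auto)
    also have "\<dots> = (\<Sum>b<n. \<Sum>c<n. norm ((X * Y * Z) $$ (a, d)) * norm (Y $$ (c, b))) +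
      (\<Sum>b<n. \<Sum>c<n. \<Sum>v\<in>idx2 n. norm (X $$ (a, fst v)) * norm (Z $$ (snd v, d)) * norm (compound2 Y (fst v, c) (b, snd v)))"
      by (simp only: sum.distrib)
    also have "(\<Sum>b<n. \<Sum>c<n. norm ((X * Y * Z) $$ (a, d)) * norm (Y $$ (c, b))) = norm ((X * Y * Z) $$ (a, d)) * mnorm n Y"
      unfolding mnorm_def by (subst sum.swap) (simp only: sum_distrib_left)
    also have "(\<Sum>b<n. \<Sum>c<n. \<Sum>v\<in>idx2 n. norm (X $$ (a, fst v)) * norm (Z $$ (snd v, d)) * norm (compound2 Y (fst v, c) (b, snd v)))
      = (\<Sum>b<n. \<Sum>v\<in>idx2 n. \<Sum>c<n. norm (X $$ (a, fst v)) * norm (Z $$ (snd v, d)) * norm (compound2 Y (fst v, c) (b, snd v)))"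
      by (intro sum.cong refl sum.swap)
    also have "\<dots> = (\<Sum>v\<in>idx2 n. \<Sum>b<n. \<Sum>c<n. norm (X $$ (a, fst v)) * norm (Z $$ (snd v, d)) * norm (compound2 Y (fst v, c) (b, snd v)))"
      by (rule sum.swap)
    also have "\<dots> = (\<Sum>v\<in>idx2 n. norm (X $$ (a, fst v)) * norm (Z $$ (snd v, d)) * (\<Sum>b<n. \<Sum>c<n. norm (compound2 Y (fst v, c) (b, snd v))))"
      by (simp only: sum_distrib_left)
    also have "\<dots> \<le> (\<Sum>v\<in>idx2 n. norm (X $$ (a, fst v)) * norm (Z $$ (snd v, d)) * mnorm2 n Y)"
      by (intro sum_mono mult_left_mono compound2_row_col_le) (auto simp: idx2_def)
    also have "\<dots> = rx a * cz d * mnorm2 n Y"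
      unfolding rx_def cz_def sum_product sum_idx2 by (simp add: sum_distrib_right)
    finally show ?thesis by simp
  qed
  have "mnorm n (X * Y) * mnorm n (Y * Z)
      = (\<Sum>a<n. \<Sum>d<n. (\<Sum>b<n. norm ((X * Y) $$ (a, b))) * (\<Sum>c<n. norm ((Y * Z) $$ (c, d))))"
  proof -
    have "mnorm n (Y * Z) = (\<Sum>d<n. \<Sum>c<n. norm ((Y * Z) $$ (c, d)))" unfolding mnorm_def by (rule sum.swap)
    thus ?thesis unfolding mnorm_def[of n "X * Y"] by (simp only: sum_product)
  qed
  also have "\<dots> \<le> (\<Sum>a<n. \<Sum>d<n. norm ((X * Y * Z) $$ (a, d)) * mnorm n Y + rx a * cz d * mnorm2 n Y)"
    by (intro sum_mono row) auto
  also have "\<dots> = mnorm n (X * Y * Z) * mnorm n Y + (\<Sum>a<n. rx a) * (\<Sum>d<n. cz d) * mnorm2 n Y"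
    unfolding mnorm_def[of n "X * Y * Z"] sum_product by (simp only: sum.distrib sum_distrib_right)
  also have "(\<Sum>a<n. rx a) = mnorm n X" by (simp add: rx_def mnorm_def)
  also have "(\<Sum>d<n. cz d) = mnorm n Z" unfolding cz_def mnorm_def by (rule sum.swap)
  finally show ?thesis .
qed

section \<open>Moduli of eigenvalues\<close>

abbreviation cmat :: "real mat \<Rightarrow> complex mat" where "cmat A \<equiv> map_mat complex_of_real A"

text \<open>The eigenvalues are sorted by modulus before the Schur decomposition is taken, so that
  the diagonal of \<open>B\<close> comes in the order of \<open>eig_moduli\<close>.\<close>

lemma eig_moduli_schur:
  assumes A: "A \<in> carrier_mat n n"
  obtains es B P Q where "length es = n" "eig_moduli A = map cmod es" "sorted_wrt (\<ge>) (map cmod es)"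
    "char_poly (cmat A) = (\<Prod>e\<leftarrow>es. [:- e, 1:])"
    "similar_mat_wit (cmat A) B P Q" "upper_triangular B" "diag_mat B = es"
proof -
  have cA: "cmat A \<in> carrier_mat n n" using A by simp
  from char_poly_factorized[OF cA] obtain as where
    as: "char_poly (cmat A) = (\<Prod>a\<leftarrow>as. [:- a, 1:])" "length as = n" by blast
  define es where "es = rev (sort_key cmod as)"
  have mes: "mset es = mset as" by (simp add: es_def)
  have prod: "char_poly (cmat A) = (\<Prod>e\<leftarrow>es. [:- e, 1:])"
    unfolding as prod_mset_prod_list[symmetric] mset_map mes ..
  have "proots (char_poly (cmat A)) = (\<Sum>p\<leftarrow>map (\<lambda>a. [:- a, 1:]) as. proots p)"
    unfolding as by (subst proots_prod_list[of "map (\<lambda>a. [:- a, 1:]) as", simplified]) (auto simp: o_def)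
  also have "\<dots> = mset as" by (induction as) auto
  finally have pr: "image_mset cmod (proots (char_poly (cmat A))) = mset (map cmod as)" by simp
  have "map cmod (sort_key cmod as) = sort (map cmod as)"
    by (intro properties_for_sort[symmetric]) simp_all
  hence mes: "map cmod es = rev (sort (map cmod as))" by (simp only: es_def rev_map[symmetric])
  hence eig: "eig_moduli A = map cmod es"
    unfolding eig_moduli_def pr by (simp only: sorted_list_of_multiset_mset)
  have sorted: "sorted_wrt (\<ge>) (map cmod es)"
    unfolding mes sorted_wrt_rev by simp
  obtain B P Q where S: "schur_decomposition (cmat A) es = (B, P, Q)" by (metis prod_cases3)
  from schur_decomposition[OF cA prod S] show thesis
    using that[of es B P Q] as(2) eig sorted prod by (simp add: es_def)
qed

lemma upper_triangular_mult:
  fixes A B :: "'a :: semiring_0 mat"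
  assumes A: "A \<in> carrier_mat n n" "upper_triangular A" and B: "B \<in> carrier_mat n n" "upper_triangular B"
  shows "upper_triangular (A * B)" "i < n \<Longrightarrow> (A * B) $$ (i, i) = A $$ (i, i) * B $$ (i, i)"
proof -
  have e: "(A * B) $$ (i, j) = (\<Sum>k<n. A $$ (i, k) * B $$ (k, j))" if "i < n" "j < n" for i j
    using A B that by (auto simp: scalar_prod_def atLeast0LessThan intro!: sum.cong)
  show "upper_triangular (A * B)"
  proof
    fix i j assume "j < i" "i < dim_row (A * B)"
    hence ij: "j < i" "i < n" "j < n" using A by auto
    have "A $$ (i, k) * B $$ (k, j) = 0" if "k < n" for k
      using upper_triangularD[OF A(2), of k i] upper_triangularD[OF B(2), of j k] ij that A B
      by (cases "k < i") auto
    thus "(A * B) $$ (i, j) = 0" using e[OF ij(2,3)] by simp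
  qed
  assume i: "i < n"
  have "A $$ (i, k) * B $$ (k, i) = (if k = i then A $$ (i, i) * B $$ (i, i) else 0)" if "k < n" for k
    using upper_triangularD[OF A(2), of k i] upper_triangularD[OF B(2), of i k] i that A B
    by (cases "k < i") auto
  hence "(\<Sum>k<n. A $$ (i, k) * B $$ (k, i)) = (\<Sum>k<n. if k = i then A $$ (i, i) * B $$ (i, i) else 0)"
    by (intro sum.cong) auto
  thus "(A * B) $$ (i, i) = A $$ (i, i) * B $$ (i, i)" using e[OF i i] i by simp
qed

lemma upper_triangular_pow:
  fixes B :: "complex mat"
  assumes B: "B \<in> carrier_mat n n" "upper_triangular B"
  shows "upper_triangular (B ^\<^sub>m k) \<and> (\<forall>i<n. (B ^\<^sub>m k) $$ (i, i) = (B $$ (i, i)) ^ k)"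
proof (induction k)
  case 0
  thus ?case using B by auto
next
  case (Suc k)
  have Bk: "B ^\<^sub>m k \<in> carrier_mat n n" using B by simp
  show ?case using upper_triangular_mult[OF Bk _ B] Suc by (simp add: mult.commute del: index_mult_mat)
qed

lemma le_of_power_le:
  fixes x y c :: real
  assumes "0 \<le> x" "0 \<le> y" and le: "\<And>k::nat. x ^ k \<le> c * y ^ k"
  shows "x \<le> y"
proof (rule ccontr)
  assume "\<not> x \<le> y"
  hence yx: "y < x" by simp
  show False
  proof (cases "y = 0")
    case True
    thus False using le[of 1] yx by simp
  next
    case False
    hence y: "y > 0" using assms by simp
    hence "1 < x / y" using yx by simp
    then obtain k where k: "c < (x / y) ^ k" using real_arch_pow by blast
    have "(x / y) ^ k \<le> c" using le[of k] y by (simp add: power_divide divide_simps)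
    thus False using k by simp
  qed
qed

text \<open>An arbitrary \<open>\<nu>\<close> covers \<open>mnorm\<close> and \<open>mnorm2\<close>
  alike. The factor \<open>\<nu> (1\<^sub>m n)\<close> accounts for the zeroth power, as the norm of
  the identity need not be 1.\<close>

lemma submultiplicative_conjugate_pow:
  fixes \<nu> :: "complex mat \<Rightarrow> real"
  assumes mult: "\<And>A B. A \<in> carrier_mat n n \<Longrightarrow> B \<in> carrier_mat n n \<Longrightarrow> \<nu> (A * B) \<le> \<nu> A * \<nu> B"
    and nonneg: "\<And>A. 0 \<le> \<nu> A"
    and A: "A \<in> carrier_mat n n" and wit: "similar_mat_wit A B P Q"
  shows "\<nu> (B ^\<^sub>m k) \<le> \<nu> Q * \<nu> (1\<^sub>m n) * \<nu> P * \<nu> A ^ k"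
proof -
  note D = similar_mat_witD2[OF A wit]
  have "B ^\<^sub>m k = Q * A ^\<^sub>m k * P"
    by (rule similar_mat_wit_pow_id[OF similar_mat_wit_sym[OF wit]])
  hence "\<nu> (B ^\<^sub>m k) \<le> \<nu> Q * \<nu> (A ^\<^sub>m k) * \<nu> P"
    using mult[of "Q * A ^\<^sub>m k" P] mult[of Q "A ^\<^sub>m k"] mult_right_mono[of "\<nu> (Q * A ^\<^sub>m k)" "\<nu> Q * \<nu> (A ^\<^sub>m k)" "\<nu> P"]
      nonneg D A by (simp add: order_trans)
  also have "\<nu> (A ^\<^sub>m k) \<le> \<nu> (1\<^sub>m n) * \<nu> A ^ k"
  proof (induction k)
    case 0
    thus ?case using A by simp
  next
    case (Suc k)
    have "\<nu> (A ^\<^sub>m Suc k) \<le> \<nu> (A ^\<^sub>m k) * \<nu> A" using mult A by simp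
    also have "\<dots> \<le> \<nu> (1\<^sub>m n) * \<nu> A ^ k * \<nu> A" by (rule mult_right_mono[OF Suc nonneg])
    finally show ?case by (simp add: mult_ac)
  qed
  hence "\<nu> Q * \<nu> (A ^\<^sub>m k) * \<nu> P \<le> \<nu> Q * (\<nu> (1\<^sub>m n) * \<nu> A ^ k) * \<nu> P"
    by (intro mult_right_mono mult_left_mono nonneg)
  finally show ?thesis by (simp add: mult_ac)
qed

lemma cmat_norms:
  assumes A: "A \<in> carrier_mat n n"
  shows "mnorm n (cmat A) = mnorm n A" "mnorm2 n (cmat A) = mnorm2 n A"
    "mtrace n (cmat A) = complex_of_real (mtrace n A)" "mtrace2 n (cmat A) = complex_of_real (mtrace2 n A)"
proof -
  have c2: "compound2 (cmat A) x y = complex_of_real (compound2 A x y)" if "x \<in> idx2 n" "y \<in> idx2 n" for x y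
    using that A by (auto simp: compound2_def idx2_def)
  show "mnorm n (cmat A) = mnorm n A" unfolding mnorm_def using A by (intro sum.cong refl) simp
  show "mnorm2 n (cmat A) = mnorm2 n A" unfolding mnorm2_def by (intro sum.cong refl) (simp add: c2)
  show "mtrace n (cmat A) = complex_of_real (mtrace n A)" unfolding mtrace_def of_real_sum
    using A by (intro sum.cong refl) simp
  show "mtrace2 n (cmat A) = complex_of_real (mtrace2 n A)" unfolding mtrace2_def of_real_sum
    by (intro sum.cong refl) (simp add: c2)
qed

lemma norm_entry_le_mnorm:
  assumes "i < n" "j < n"
  shows "norm (A $$ (i, j)) \<le> mnorm n A"
proof -
  have "norm (A $$ (i, j)) \<le> (\<Sum>j<n. norm (A $$ (i, j)))"
    by (rule member_le_sum[of j "{..<n}" "\<lambda>j. norm (A $$ (i, j))"]) (use assms in auto)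
  also have "\<dots> \<le> mnorm n A" unfolding mnorm_def
    by (rule member_le_sum[of i "{..<n}" "\<lambda>i. \<Sum>j<n. norm (A $$ (i, j))"]) (use assms in \<open>auto simp: sum_nonneg\<close>)
  finally show ?thesis .
qed

lemma norm_compound2_le_mnorm2:
  assumes "x \<in> idx2 n" "y \<in> idx2 n"
  shows "norm (compound2 A x y) \<le> mnorm2 n A"
proof -
  have "norm (compound2 A x y) \<le> (\<Sum>y\<in>idx2 n. norm (compound2 A x y))"
    by (rule member_le_sum[of y "idx2 n" "\<lambda>y. norm (compound2 A x y)"]) (use assms in auto)
  also have "\<dots> \<le> mnorm2 n A" unfolding mnorm2_def
    by (rule member_le_sum[of x "idx2 n" "\<lambda>x. \<Sum>y\<in>idx2 n. norm (compound2 A x y)"]) (use assms in \<open>auto simp: sum_nonneg\<close>)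
  finally show ?thesis .
qed

lemma eig_moduli_nonneg:
  assumes A: "A \<in> carrier_mat n n" and "i < n"
  shows "0 \<le> eig_moduli A ! i"
  by (rule eig_moduli_schur[OF A]) (use assms in simp)

lemma eig_moduli_antimono:
  assumes A: "A \<in> carrier_mat n n" and "i \<le> j" "j < n"
  shows "eig_moduli A ! j \<le> eig_moduli A ! i"
proof (rule eig_moduli_schur[OF A])
  fix es assume "length es = n" "eig_moduli A = map cmod es" "sorted_wrt (\<ge>) (map cmod es)"
  thus ?thesis using assms by (cases "i = j") (auto simp: sorted_wrt_iff_nth_less)
qed

text \<open>The triangularising matrices are not unitary, but their norms are lost in the limit when the
  estimates are applied to the powers of \<open>A\<close>.\<close>

lemma eig_moduli_bounds:
  assumes A: "A \<in> carrier_mat n n" and n: "n \<ge> 2"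
  shows "eig_moduli A ! 0 \<le> mnorm n A"
    and "eig_moduli A ! 0 * eig_moduli A ! 1 \<le> mnorm2 n A"
    and "\<bar>mtrace n A\<bar> \<le> real n * eig_moduli A ! 0"
    and "\<bar>mtrace2 n A\<bar> \<le> (real n)\<^sup>2 * (eig_moduli A ! 0 * eig_moduli A ! 1)"
proof -
  have cA: "cmat A \<in> carrier_mat n n" using A by simp
  obtain es B P Q where es: "length es = n" "eig_moduli A = map cmod es"
    and wit: "similar_mat_wit (cmat A) B P Q" and ut: "upper_triangular B" and diag: "diag_mat B = es"
    by (rule eig_moduli_schur[OF A])
  note D = similar_mat_witD2[OF cA wit]
  have Bii: "B $$ (i, i) = es ! i" if "i < n" for i
    using that D(5) unfolding diag[symmetric] diag_mat_def by simp
  have m: "eig_moduli A ! i = cmod (es ! i)" if "i < n" for i using es that by simp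
  have utk: "(B ^\<^sub>m k) $$ (i, i) = es ! i ^ k" "upper_triangular (B ^\<^sub>m k)" if "i < n" for i k
    using upper_triangular_pow[OF D(5) ut, of k] Bii that by auto
  have Bk: "B ^\<^sub>m k \<in> carrier_mat n n" for k using D(5) by simp
  show "eig_moduli A ! 0 \<le> mnorm n A"
  proof (rule le_of_power_le)
    fix k :: nat
    have "(eig_moduli A ! 0) ^ k = norm ((B ^\<^sub>m k) $$ (0, 0))" using n m utk by (simp add: norm_power)
    also have "\<dots> \<le> mnorm n (B ^\<^sub>m k)" using n by (intro norm_entry_le_mnorm) auto
    also have "\<dots> \<le> mnorm n Q * mnorm n (1\<^sub>m n :: complex mat) * mnorm n P * mnorm n (cmat A) ^ k"
      by (rule submultiplicative_conjugate_pow[OF mnorm_mult mnorm_nonneg cA wit])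
    finally show "(eig_moduli A ! 0) ^ k \<le> mnorm n Q * mnorm n (1\<^sub>m n :: complex mat) * mnorm n P * mnorm n A ^ k"
      by (simp add: cmat_norms[OF A])
  qed (use n in \<open>auto simp: mnorm_nonneg m\<close>)
  show "eig_moduli A ! 0 * eig_moduli A ! 1 \<le> mnorm2 n A"
  proof (rule le_of_power_le)
    fix k :: nat
    have "(B ^\<^sub>m k) $$ (1, 0) = 0" using upper_triangularD[OF utk(2)[of 0 k], of 0 1] n D(5) by simp
    hence "compound2 (B ^\<^sub>m k) (0, 1) (0, 1) = (es ! 0 * es ! 1) ^ k"
      using utk(1)[of 0 k] utk(1)[of 1 k] n by (simp add: compound2_def power_mult_distrib)
    hence "(eig_moduli A ! 0 * eig_moduli A ! 1) ^ k = norm (compound2 (B ^\<^sub>m k) (0, 1) (0, 1))"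
      using n m by (simp add: norm_power norm_mult)
    also have "\<dots> \<le> mnorm2 n (B ^\<^sub>m k)" using n by (intro norm_compound2_le_mnorm2) (auto simp: idx2_def)
    also have "\<dots> \<le> mnorm2 n Q * mnorm2 n (1\<^sub>m n :: complex mat) * mnorm2 n P * mnorm2 n (cmat A) ^ k"
      by (rule submultiplicative_conjugate_pow[OF mnorm2_mult mnorm2_nonneg cA wit])
    finally show "(eig_moduli A ! 0 * eig_moduli A ! 1) ^ k
        \<le> mnorm2 n Q * mnorm2 n (1\<^sub>m n :: complex mat) * mnorm2 n P * mnorm2 n A ^ k"
      by (simp add: cmat_norms[OF A])
  qed (use n in \<open>auto simp: mnorm2_nonneg m\<close>)
  \<comment> \<open>By cyclicity of both traces, \<open>cmat A = P * (B * Q)\<close> has the same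
    traces as \<open>B * Q * P = B\<close>, whose diagonal is known.\<close>
  have BQP: "B * Q * P = B" using D by (simp add: assoc_mult_mat[of B n n Q n P n])
  have PBQ: "cmat A = P * (B * Q)" using D by (simp add: assoc_mult_mat[of P n n B n Q n])
  have BQ: "B * Q \<in> carrier_mat n n" using D by simp
  have m01: "eig_moduli A ! i \<le> eig_moduli A ! 0" if "i < n" for i
    using eig_moduli_antimono[OF A _ that, of 0] by simp
  have "complex_of_real (mtrace n A) = mtrace n B"
    unfolding cmat_norms[OF A, symmetric] PBQ mtrace_mult_commute[OF D(6) BQ] BQP ..
  hence "\<bar>mtrace n A\<bar> = norm (mtrace n B)" by (metis norm_of_real)
  also have "\<dots> \<le> (\<Sum>i<n. norm (B $$ (i, i)))" unfolding mtrace_def by (rule norm_sum)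
  also have "\<dots> \<le> (\<Sum>i<n. eig_moduli A ! 0)" using Bii m m01 by (intro sum_mono) fastforce
  finally show "\<bar>mtrace n A\<bar> \<le> real n * eig_moduli A ! 0" by simp
  have "complex_of_real (mtrace2 n A) = mtrace2 n B"
    unfolding cmat_norms[OF A, symmetric] PBQ mtrace2_mult_commute[OF D(6) BQ] BQP ..
  hence "\<bar>mtrace2 n A\<bar> = norm (mtrace2 n B)" by (metis norm_of_real)
  also have "\<dots> \<le> (\<Sum>x\<in>idx2 n. norm (compound2 B x x))" unfolding mtrace2_def by (rule norm_sum)
  also have "\<dots> \<le> (\<Sum>x\<in>idx2 n. eig_moduli A ! 0 * eig_moduli A ! 1)"
  proof (rule sum_mono)
    fix x assume x: "x \<in> idx2 n"
    obtain i k where ik: "x = (i, k)" by (cases x)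
    have lt: "i < n" "k < n" using x by (auto simp: ik idx2_def)
    have pos: "0 \<le> eig_moduli A ! 0 * eig_moduli A ! 1" using n m by simp
    have le: "eig_moduli A ! i * eig_moduli A ! k \<le> eig_moduli A ! 0 * eig_moduli A ! 1" if "i < k" "k < n" for i k
      using eig_moduli_antimono[OF A, of 0 i] eig_moduli_antimono[OF A, of 1 k] eig_moduli_nonneg[OF A] that n
      by (intro mult_mono) auto
    consider "i = k" | "i < k" | "k < i" by linarith
    thus "norm (compound2 B x x) \<le> eig_moduli A ! 0 * eig_moduli A ! 1"
    proof cases
      case 1
      thus ?thesis using pos by (simp add: ik compound2_def)
    next
      case 2
      hence "B $$ (k, i) = 0" using upper_triangularD[OF ut, of i k] lt D(5) by simp
      thus ?thesis using le[OF 2 lt(2)] Bii m lt by (simp add: ik compound2_def norm_mult)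
    next
      case 3
      hence "B $$ (i, k) = 0" using upper_triangularD[OF ut, of k i] lt D(5) by simp
      thus ?thesis using le[OF 3 lt(1)] Bii m lt by (simp add: ik compound2_def norm_mult mult.commute)
    qed
  qed
  finally show "\<bar>mtrace2 n A\<bar> \<le> (real n)\<^sup>2 * (eig_moduli A ! 0 * eig_moduli A ! 1)"
    by (simp add: idx2_def power2_eq_square)
qed

section \<open>Moduli of eigenvalues under similarity, inversion and powers\<close>

lemma eig_moduli_similar:
  assumes "P * Q = 1\<^sub>m n" "Q * P = 1\<^sub>m n" "A \<in> carrier_mat n n" "P \<in> carrier_mat n n" "Q \<in> carrier_mat n n"
  shows "eig_moduli (P * A * Q) = eig_moduli A"
proof -
  have "similar_mat (P * A * Q) A"
    using assms by (intro similar_matI[of _ _ P Q n]) auto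
  hence "char_poly (P * A * Q) = char_poly A" by (rule char_poly_similar)
  moreover have "P * A * Q \<in> carrier_mat n n" using assms by simp
  ultimately have "char_poly (cmat (P * A * Q)) = char_poly (cmat A)"
    using of_real_hom.char_poly_hom[of A n] of_real_hom.char_poly_hom[of "P * A * Q" n] assms by metis
  thus ?thesis by (simp only: eig_moduli_def)
qed

lemma prod_eig_moduli:
  assumes A: "A \<in> carrier_mat n n"
  shows "(\<Prod>i<n. eig_moduli A ! i) = \<bar>det A\<bar>"
proof -
  have cA: "cmat A \<in> carrier_mat n n" using A by simp
  obtain es B P Q where es: "length es = n" "eig_moduli A = map cmod es"
    and wit: "similar_mat_wit (cmat A) B P Q" and ut: "upper_triangular B" and diag: "diag_mat B = es"
    by (rule eig_moduli_schur[OF A])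
  note D = similar_mat_witD2[OF cA wit]
  have "det P * det Q = 1" using det_mult[OF D(6,7)] D(1) by simp
  moreover have "det (cmat A) = det P * det B * det Q"
    unfolding D(3) using D(5-7) by (simp add: det_mult[of _ n])
  ultimately have "det (cmat A) = det B" by (simp add: mult_ac)
  hence "complex_of_real (det A) = prod_list es"
    using det_upper_triangular[OF ut D(5)] diag by simp
  hence "\<bar>det A\<bar> = cmod (prod_list es)" by (metis norm_of_real)
  also have "\<dots> = prod_list (map cmod es)" by (induction es) (auto simp: norm_mult)
  also have "\<dots> = (\<Prod>i<n. eig_moduli A ! i)"
    using es by (simp add: prod.list_conv_set_nth atLeast0LessThan)
  finally show ?thesis by simp
qed

text \<open>For the product of the first two moduli: if the second is at least 1, so are both;
  otherwise all later ones are below 1, and the product of all of them is 1.\<close>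

lemma eig_moduli_SL:
  assumes A: "A \<in> SL n" and n: "n \<ge> 2"
  shows "i < n \<Longrightarrow> 0 < eig_moduli A ! i" "1 \<le> eig_moduli A ! 0" "1 \<le> eig_moduli A ! 0 * eig_moduli A ! 1"
proof -
  let ?m = "\<lambda>i. eig_moduli A ! i"
  have Ac: "A \<in> carrier_mat n n" and "det A = 1" using A by (auto simp: SL_def)
  hence prod: "(\<Prod>i<n. ?m i) = 1" using prod_eig_moduli[OF Ac] by simp
  note nn = eig_moduli_nonneg[OF Ac] and mono = eig_moduli_antimono[OF Ac]
  show pos: "0 < ?m i" if "i < n" for i
  proof -
    have "?m i \<noteq> 0" using prod that by (metis finite_lessThan lessThan_iff prod_zero_iff zero_neq_one)
    thus ?thesis using nn[OF that] by simp
  qed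
  have split: "(\<Prod>i<n. ?m i) = ?m 0 * ?m 1 * (\<Prod>i\<in>{2..<n}. ?m i)"
  proof -
    have "{..<n} = insert 0 (insert 1 {2..<n})" using n by auto
    thus ?thesis by (simp add: mult.assoc)
  qed
  show m01: "1 \<le> ?m 0 * ?m 1"
  proof (cases "?m 1 \<ge> 1")
    case True
    thus ?thesis using mono[of 0 1] n mult_mono[of 1 "?m 0" 1 "?m 1"] by simp
  next
    case False
    have "(\<Prod>i\<in>{2..<n}. ?m i) \<le> 1"
    proof (intro prod_le_1 conjI)
      fix i assume "i \<in> {2..<n}"
      thus "0 \<le> ?m i" "?m i \<le> 1" using nn[of i] mono[of 1 i] False by auto
    qed
    hence "?m 0 * ?m 1 * (\<Prod>i\<in>{2..<n}. ?m i) \<le> ?m 0 * ?m 1 * 1"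
      using pos[of 0] pos[of 1] n by (intro mult_left_mono) auto
    thus ?thesis using split prod by simp
  qed
  show "1 \<le> ?m 0"
  proof (rule ccontr)
    assume "\<not> 1 \<le> ?m 0"
    hence "?m 0 * ?m 1 < 1 * 1" using mono[of 0 1] n pos[of 0] pos[of 1]
      by (intro mult_strict_mono) auto
    thus False using m01 by simp
  qed
qed

lemma eig_moduli_eigenvalue:
  assumes A: "A \<in> carrier_mat n n"
  shows "i < n \<Longrightarrow> \<exists>e. eigenvalue (cmat A) e \<and> cmod e = eig_moduli A ! i"
    and "eigenvalue (cmat A) e \<Longrightarrow> \<exists>i<n. cmod e = eig_moduli A ! i"
proof -
  have cA: "cmat A \<in> carrier_mat n n" using A by simp
  obtain es B P Q where es: "length es = n" "eig_moduli A = map cmod es"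
    and cp: "char_poly (cmat A) = (\<Prod>e\<leftarrow>es. [:- e, 1:])"
    by (rule eig_moduli_schur[OF A])
  have ev: "eigenvalue (cmat A) e \<longleftrightarrow> e \<in> set es" for e
    unfolding eigenvalue_root_char_poly[OF cA] cp by (auto simp: poly_prod_list prod_list_zero_iff)
  show "\<exists>e. eigenvalue (cmat A) e \<and> cmod e = eig_moduli A ! i" if "i < n"
    using that es ev by (intro exI[of _ "es ! i"]) auto
  show "\<exists>i<n. cmod e = eig_moduli A ! i" if "eigenvalue (cmat A) e"
    using that es unfolding ev in_set_conv_nth by auto
qed

lemma eigenvalue_inverse:
  assumes A: "A \<in> carrier_mat n n" and B: "B \<in> carrier_mat n n" and BA: "B * A = 1\<^sub>m n"
    and e: "eigenvalue (cmat A) e"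
  shows "e \<noteq> 0" "eigenvalue (cmat B) (1 / e)"
proof -
  have cs: "cmat A \<in> carrier_mat n n" "cmat B \<in> carrier_mat n n" using A B by auto
  obtain v where v: "v \<in> carrier_vec n" "v \<noteq> 0\<^sub>v n" "cmat A *\<^sub>v v = e \<cdot>\<^sub>v v"
    using e A unfolding eigenvalue_def eigenvector_def by auto
  have "cmat B * cmat A = 1\<^sub>m n"
    unfolding of_real_hom.mat_hom_mult[OF B A, symmetric] BA by (rule of_real_hom.mat_hom_one)
  hence "v = cmat B *\<^sub>v (cmat A *\<^sub>v v)"
    using v cs assoc_mult_mat_vec[OF cs(2,1) v(1)] by simp
  also have "\<dots> = e \<cdot>\<^sub>v (cmat B *\<^sub>v v)" unfolding v(3) by (rule mult_mat_vec[OF cs(2) v(1)])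
  finally have veq: "v = e \<cdot>\<^sub>v (cmat B *\<^sub>v v)" .
  have Bv: "cmat B *\<^sub>v v \<in> carrier_vec n" using cs v by simp
  show e0: "e \<noteq> 0"
  proof
    assume "e = 0"
    hence "v $ i = 0" if "i < n" for i using arg_cong[OF veq, of "\<lambda>w. w $ i"] B that by simp
    hence "v = 0\<^sub>v n" using v(1) by (intro eq_vecI) auto
    thus False using v by simp
  qed
  have "cmat B *\<^sub>v v = (1 / e) \<cdot>\<^sub>v (e \<cdot>\<^sub>v (cmat B *\<^sub>v v))" using e0 by (simp add: smult_smult_assoc)
  hence "cmat B *\<^sub>v v = (1 / e) \<cdot>\<^sub>v v" using veq by simp
  thus "eigenvalue (cmat B) (1 / e)" unfolding eigenvalue_def eigenvector_def using v B by auto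
qed

text \<open>Reciprocals of eigenvalues of \<open>A\<close> are eigenvalues of \<open>B\<close>, and
  conversely. Each direction gives one inequality between the smallest modulus of \<open>A\<close>
  and the largest of \<open>B\<close>, so multiplicities need not be matched.\<close>

lemma eig_moduli_inverse:
  assumes A: "A \<in> carrier_mat n n" and B: "B \<in> carrier_mat n n" and AB: "A * B = 1\<^sub>m n" and n: "n \<ge> 1"
  shows "eig_moduli A ! (n - 1) * eig_moduli B ! 0 = 1"
proof -
  have BA: "B * A = 1\<^sub>m n" by (rule mat_mult_left_right_inverse[OF A B AB])
  obtain e where e: "eigenvalue (cmat A) e" "cmod e = eig_moduli A ! (n - 1)"
    using eig_moduli_eigenvalue(1)[OF A, of "n - 1"] n by auto
  obtain f where f: "eigenvalue (cmat B) f" "cmod f = eig_moduli B ! 0"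
    using eig_moduli_eigenvalue(1)[OF B, of 0] n by auto
  have e0: "e \<noteq> 0" "eigenvalue (cmat B) (1 / e)" using eigenvalue_inverse[OF A B BA e(1)] by auto
  have f0: "f \<noteq> 0" "eigenvalue (cmat A) (1 / f)" using eigenvalue_inverse[OF B A AB f(1)] by auto
  obtain i where i: "i < n" "cmod (1 / e) = eig_moduli B ! i" using eig_moduli_eigenvalue(2)[OF B e0(2)] by auto
  obtain j where j: "j < n" "cmod (1 / f) = eig_moduli A ! j" using eig_moduli_eigenvalue(2)[OF A f0(2)] by auto
  have "cmod (1 / e) \<le> cmod f" using i f eig_moduli_antimono[OF B, of 0 i] by simp
  moreover have "cmod e \<le> cmod (1 / f)" using j e eig_moduli_antimono[OF A, of j "n - 1"] by simp
  ultimately have "1 \<le> cmod f * cmod e" "cmod e * cmod f \<le> 1"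
    using e0(1) f0(1) by (auto simp: norm_divide field_simps)
  thus ?thesis using e f by (simp add: mult.commute)
qed

text \<open>Scaling by \<open>1 / t\<close> pushes the spectral radius below 1, and then all powers
  are bounded. The inequality on \<open>t\<close> is strict because Jordan blocks at the top modulus
  can add polynomial growth.\<close>

lemma mnorm_pow_bound:
  assumes A: "A \<in> carrier_mat n n" and n: "n \<ge> 1" and t: "eig_moduli A ! 0 < t"
  shows "\<exists>c. \<forall>k. mnorm n (A ^\<^sub>m k) \<le> c * t ^ k"
proof -
  have t0: "t > 0" using eig_moduli_nonneg[OF A, of 0] n t by simp
  define S where "S = complex_of_real (1 / t) \<cdot>\<^sub>m cmat A"
  have cA: "cmat A \<in> carrier_mat n n" and S: "S \<in> carrier_mat n n" using A by (auto simp: S_def)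
  have "spectral_radius S < 1"
  proof -
    obtain e where e: "eigenvalue S e" "spectral_radius S = cmod e"
      using spectral_radius_mem_max(1)[OF S] n by (auto simp: spectrum_def)
    obtain v where v: "v \<in> carrier_vec n" "v \<noteq> 0\<^sub>v n" "S *\<^sub>v v = e \<cdot>\<^sub>v v"
      using e(1) S unfolding eigenvalue_def eigenvector_def by auto
    have "cmat A *\<^sub>v v = complex_of_real t \<cdot>\<^sub>v (S *\<^sub>v v)"
      using t0 v(1) A by (intro eq_vecI) (auto simp: S_def scalar_prod_def sum_distrib_left)
    also have "\<dots> = (complex_of_real t * e) \<cdot>\<^sub>v v" unfolding v(3) by (simp add: smult_smult_assoc)
    finally have "eigenvalue (cmat A) (complex_of_real t * e)"
      unfolding eigenvalue_def eigenvector_def using v A by auto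
    then obtain i where i: "i < n" "cmod (complex_of_real t * e) = eig_moduli A ! i"
      using eig_moduli_eigenvalue(2)[OF A] by blast
    hence "t * cmod e \<le> eig_moduli A ! 0"
      using eig_moduli_antimono[OF A, of 0 i] t0 by (simp add: norm_mult)
    hence "t * cmod e < t * 1" using t by simp
    thus ?thesis using e t0 by simp
  qed
  from spectral_radius_jnf_norm_bound_less_1_upper_triangular[OF S this]
  obtain c where c: "\<And>k. norm_bound (S ^\<^sub>m k) c" by blast
  have pow: "S ^\<^sub>m k = complex_of_real ((1 / t) ^ k) \<cdot>\<^sub>m cmat (A ^\<^sub>m k)" for k
  proof (induction k)
    case 0
    thus ?case using A S by (auto simp: of_real_hom.mat_hom_one)
  next
    case (Suc k)
    have "S ^\<^sub>m Suc k = (complex_of_real ((1 / t) ^ k) \<cdot>\<^sub>m cmat (A ^\<^sub>m k)) * (complex_of_real (1 / t) \<cdot>\<^sub>m cmat A)"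
      using Suc by (simp add: S_def)
    also have "\<dots> = complex_of_real ((1 / t) ^ Suc k) \<cdot>\<^sub>m (cmat (A ^\<^sub>m k) * cmat A)"
      using A by (intro eq_matI) (auto simp: mult_ac)
    also have "cmat (A ^\<^sub>m k) * cmat A = cmat (A ^\<^sub>m Suc k)"
      unfolding pow_mat.simps by (rule of_real_hom.mat_hom_mult[OF pow_carrier_mat[OF A] A, symmetric])
    finally show ?case .
  qed
  have "mnorm n (A ^\<^sub>m k) \<le> (real n * real n * c) * t ^ k" for k
  proof -
    have "norm ((A ^\<^sub>m k) $$ (i, j)) \<le> c * t ^ k" if "i < n" "j < n" for i j
    proof -
      have "norm ((S ^\<^sub>m k) $$ (i, j)) \<le> c" using c[of k] S that unfolding norm_bound_def by simp
      moreover have "norm ((S ^\<^sub>m k) $$ (i, j)) = (1 / t) ^ k * norm ((A ^\<^sub>m k) $$ (i, j))"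
        unfolding pow using A that t0 by (simp add: norm_mult norm_power norm_divide)
      ultimately show ?thesis using t0 by (simp add: power_divide field_simps)
    qed
    hence "mnorm n (A ^\<^sub>m k) \<le> (\<Sum>i<n. \<Sum>j<n. c * t ^ k)" unfolding mnorm_def by (intro sum_mono) auto
    thus ?thesis by simp
  qed
  thus ?thesis by blast
qed

section \<open>Singular values compared with entrywise norms\<close>

lemma sum_abs_square_le:
  fixes f :: "'i \<Rightarrow> real"
  assumes I: "finite I"
  shows "(\<Sum>x\<in>I. \<bar>f x\<bar>)\<^sup>2 \<le> (real (card I))\<^sup>2 * (\<Sum>x\<in>I. (f x)\<^sup>2)"
proof -
  let ?s = "sqrt (\<Sum>x\<in>I. (f x)\<^sup>2)"
  have "\<bar>f x\<bar> \<le> ?s" if "x \<in> I" for x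
    using member_le_sum[of x I "\<lambda>x. (f x)\<^sup>2"] I that by (intro real_le_rsqrt) simp
  hence "(\<Sum>x\<in>I. \<bar>f x\<bar>) \<le> real (card I) * ?s" using sum_bounded_above[of I "\<lambda>x. \<bar>f x\<bar>" ?s] by simp
  hence "(\<Sum>x\<in>I. \<bar>f x\<bar>)\<^sup>2 \<le> (real (card I) * ?s)\<^sup>2" by (intro power_mono) (auto simp: sum_nonneg)
  thus ?thesis by (simp add: power_mult_distrib sum_nonneg)
qed

lemma SL_transpose: "A \<in> SL n \<Longrightarrow> transpose_mat A \<in> SL n"
  by (auto simp: SL_def det_transpose)

lemma SL_mult: "A \<in> SL n \<Longrightarrow> B \<in> SL n \<Longrightarrow> A * B \<in> SL n"
  by (auto simp: SL_def det_mult)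

lemma norms_transpose:
  assumes A: "(A :: real mat) \<in> carrier_mat n n"
  shows "mnorm n (transpose_mat A) = mnorm n A" "mnorm2 n (transpose_mat A) = mnorm2 n A"
    "x \<in> idx2 n \<Longrightarrow> y \<in> idx2 n \<Longrightarrow> compound2 (transpose_mat A) x y = compound2 A y x"
proof -
  show c: "compound2 (transpose_mat A) x y = compound2 A y x" if "x \<in> idx2 n" "y \<in> idx2 n" for x y
    using that A by (auto simp: compound2_def idx2_def)
  have "mnorm n (transpose_mat A) = (\<Sum>i<n. \<Sum>j<n. norm (A $$ (j, i)))"
    unfolding mnorm_def using A by (intro sum.cong refl) simp
  also have "\<dots> = mnorm n A" unfolding mnorm_def by (rule sum.swap)
  finally show "mnorm n (transpose_mat A) = mnorm n A" .
  have "mnorm2 n (transpose_mat A) = (\<Sum>x\<in>idx2 n. \<Sum>y\<in>idx2 n. norm (compound2 A y x))"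
    unfolding mnorm2_def by (intro sum.cong refl) (simp add: c)
  also have "\<dots> = mnorm2 n A" unfolding mnorm2_def by (rule sum.swap)
  finally show "mnorm2 n (transpose_mat A) = mnorm2 n A" .
qed

lemma mnorm_SL:
  assumes A: "A \<in> SL n" and n: "n \<ge> 2"
  shows "1 \<le> mnorm n A" "1 \<le> mnorm2 n A"
  using eig_moduli_SL[OF A n] eig_moduli_bounds[of A n] A n by (auto simp: SL_def intro: order_trans)

text \<open>The trace of \<open>G\<close> is the sum of the squared entries of \<open>A\<close>, and
  \<open>2 * mtrace2 n G\<close> is that of the squared compound entries. The constant comes from
  the compound: n^4 index pairs give the square of n^4 times 2 n^2. For the first norm n^5 would
  do.\<close>

lemma gram_bounds:
  assumes A: "A \<in> SL n" and n: "n \<ge> 2"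
  defines "G \<equiv> A * transpose_mat A"
  shows "eig_moduli G ! 0 \<le> (mnorm n A)\<^sup>2" "(mnorm n A)\<^sup>2 \<le> 2 * real n ^ 10 * eig_moduli G ! 0"
    "eig_moduli G ! 0 * eig_moduli G ! 1 \<le> (mnorm2 n A)\<^sup>2"
    "(mnorm2 n A)\<^sup>2 \<le> 2 * real n ^ 10 * (eig_moduli G ! 0 * eig_moduli G ! 1)"
proof -
  have Ac: "A \<in> carrier_mat n n" and At: "transpose_mat A \<in> carrier_mat n n" using A by (auto simp: SL_def)
  have G: "G \<in> carrier_mat n n" using Ac by (simp add: G_def)
  note b = eig_moduli_bounds[OF G n]
  have m0: "0 \<le> eig_moduli G ! 0" "0 \<le> eig_moduli G ! 1" using eig_moduli_nonneg[OF G] n by auto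
  show "eig_moduli G ! 0 \<le> (mnorm n A)\<^sup>2"
    using b(1) mnorm_mult[OF Ac At] norms_transpose[OF Ac] by (simp add: G_def power2_eq_square)
  show "eig_moduli G ! 0 * eig_moduli G ! 1 \<le> (mnorm2 n A)\<^sup>2"
    using b(2) mnorm2_mult[OF Ac At] norms_transpose[OF Ac] by (simp add: G_def power2_eq_square)
  have "mnorm n A = (\<Sum>x\<in>idx2 n. \<bar>A $$ x\<bar>)" unfolding mnorm_def sum_idx2 by simp
  hence "(mnorm n A)\<^sup>2 \<le> (real (card (idx2 n)))\<^sup>2 * (\<Sum>x\<in>idx2 n. (A $$ x)\<^sup>2)"
    using sum_abs_square_le[of "idx2 n" "\<lambda>x. A $$ x"] by simp
  also have "(\<Sum>x\<in>idx2 n. (A $$ x)\<^sup>2) = mtrace n G"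
    unfolding sum_idx2 mtrace_def G_def using Ac
    by (intro sum.cong refl) (simp add: mult_entry[OF Ac At] power2_eq_square del: index_mult_mat)
  also have "(real (card (idx2 n)))\<^sup>2 * mtrace n G \<le> (real (card (idx2 n)))\<^sup>2 * (real n * eig_moduli G ! 0)"
    using b(3) by (intro mult_left_mono) auto
  also have "\<dots> = real n ^ 5 * eig_moduli G ! 0" by (simp add: idx2_def power2_eq_square eval_nat_numeral)
  also have "\<dots> \<le> (2 * real n ^ 10) * eig_moduli G ! 0"
  proof (rule mult_right_mono[OF _ m0(1)])
    have "real n ^ 5 \<le> real n ^ 10" using n by (intro power_increasing) auto
    also have "\<dots> \<le> 2 * real n ^ 10" by simp
    finally show "real n ^ 5 \<le> 2 * real n ^ 10" .
  qed
  finally show "(mnorm n A)\<^sup>2 \<le> 2 * real n ^ 10 * eig_moduli G ! 0" .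
  have "mnorm2 n A = (\<Sum>x\<in>idx2 n \<times> idx2 n. \<bar>compound2 A (fst x) (snd x)\<bar>)"
    unfolding mnorm2_def by (simp add: sum.cartesian_product case_prod_unfold)
  hence "(mnorm2 n A)\<^sup>2 \<le> (real (card (idx2 n \<times> idx2 n)))\<^sup>2 * (\<Sum>x\<in>idx2 n \<times> idx2 n. (compound2 A (fst x) (snd x))\<^sup>2)"
    using sum_abs_square_le[of "idx2 n \<times> idx2 n" "\<lambda>x. compound2 A (fst x) (snd x)"] by simp
  also have "(\<Sum>x\<in>idx2 n \<times> idx2 n. (compound2 A (fst x) (snd x))\<^sup>2) = 2 * mtrace2 n G"
    unfolding G_def mtrace2_mult[OF Ac At]
    by (simp add: sum.cartesian_product case_prod_unfold norms_transpose(3)[OF Ac] power2_eq_square cong: sum.cong)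
  also have "(real (card (idx2 n \<times> idx2 n)))\<^sup>2 * (2 * mtrace2 n G)
      \<le> (real (card (idx2 n \<times> idx2 n)))\<^sup>2 * (2 * ((real n)\<^sup>2 * (eig_moduli G ! 0 * eig_moduli G ! 1)))"
    using b(4) by (intro mult_left_mono) auto
  also have "\<dots> = 2 * real n ^ 10 * (eig_moduli G ! 0 * eig_moduli G ! 1)"
    by (simp add: idx2_def power2_eq_square eval_nat_numeral)
  finally show "(mnorm2 n A)\<^sup>2 \<le> 2 * real n ^ 10 * (eig_moduli G ! 0 * eig_moduli G ! 1)" .
qed

text \<open>For the last claim, the inverse of \<open>g * transpose_mat g\<close> is
  \<open>transpose_mat h * h\<close>, the Gram matrix of \<open>transpose_mat h\<close>. So
  \<open>mu n g\<close> is minus \<open>mu 1\<close> of the transposed inverse, whose norm is that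
  of \<open>h\<close>.\<close>

lemma mu_estimates:
  assumes n: "n \<ge> 2"
  defines "c \<equiv> ln (2 * real n ^ 10)"
  shows "g \<in> SL n \<Longrightarrow> \<bar>mu 1 g - ln (mnorm n g)\<bar> \<le> c"
    and "g \<in> SL n \<Longrightarrow> \<bar>mu 1 g + mu 2 g - ln (mnorm2 n g)\<bar> \<le> c"
    and "g \<in> SL n \<Longrightarrow> h \<in> SL n \<Longrightarrow> g * h = 1\<^sub>m n \<Longrightarrow> \<bar>mu n g + ln (mnorm n h)\<bar> \<le> c"
proof -
  have K: "2 * real n ^ 10 \<ge> 1" using n by (simp add: one_le_power order_trans[of 1 "real n ^ 10"])
  hence c: "c \<ge> 0" by (simp add: c_def)
  have log_close: "\<bar>ln (sqrt x) - ln y\<bar> \<le> c" if "x > 0" "y > 0" "x \<le> y\<^sup>2" "y\<^sup>2 \<le> 2 * real n ^ 10 * x" for x y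
  proof -
    have "ln x \<le> ln (y\<^sup>2)" using that by (intro ln_mono) auto
    moreover have "ln (y\<^sup>2) \<le> ln (2 * real n ^ 10 * x)" using that by (intro ln_mono) auto
    moreover have "ln (2 * real n ^ 10 * x) = c + ln x" using that n unfolding c_def by (intro ln_mult_pos) auto
    ultimately show ?thesis using that c by (simp add: ln_sqrt ln_realpow abs_le_iff)
  qed
  show 1: "\<bar>mu 1 g - ln (mnorm n g)\<bar> \<le> c" if g: "g \<in> SL n" for g
    unfolding mu_def using gram_bounds[OF g n] mnorm_SL[OF g n] eig_moduli_SL(1)[OF SL_mult[OF g SL_transpose[OF g]] n, of 0] n
    by (intro log_close) auto
  show "\<bar>mu 1 g + mu 2 g - ln (mnorm2 n g)\<bar> \<le> c" if g: "g \<in> SL n" for g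
  proof -
    let ?m = "\<lambda>i. eig_moduli (g * transpose_mat g) ! i"
    have pos: "?m 0 > 0" "?m 1 > 0" using eig_moduli_SL(1)[OF SL_mult[OF g SL_transpose[OF g]] n] n by auto
    have "mu 1 g + mu 2 g = ln (sqrt (?m 0 * ?m 1))"
      using pos by (simp add: mu_def real_sqrt_mult ln_mult_pos)
    thus ?thesis using log_close[of "?m 0 * ?m 1" "mnorm2 n g"] gram_bounds[OF g n] mnorm_SL[OF g n] pos by simp
  qed
  show "\<bar>mu n g + ln (mnorm n h)\<bar> \<le> c" if g: "g \<in> SL n" and h: "h \<in> SL n" and gh: "g * h = 1\<^sub>m n"
  proof -
    have cs: "g \<in> carrier_mat n n" "h \<in> carrier_mat n n" using g h by (auto simp: SL_def)
    have cst: "transpose_mat g \<in> carrier_mat n n" "transpose_mat h \<in> carrier_mat n n" using cs by auto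
    have hg: "h * g = 1\<^sub>m n" by (rule mat_mult_left_right_inverse[OF cs gh])
    have "(g * transpose_mat g) * (transpose_mat h * h) = g * ((transpose_mat g * transpose_mat h) * h)"
      using cs cst by (simp add: assoc_mult_mat[of _ n n _ n _ n])
    also have "transpose_mat g * transpose_mat h = 1\<^sub>m n"
      using transpose_mult[OF cs(2,1)] hg by simp
    finally have inv: "(g * transpose_mat g) * (transpose_mat h * h) = 1\<^sub>m n" using cs gh by simp
    have eq: "eig_moduli (g * transpose_mat g) ! (n - 1) * eig_moduli (transpose_mat h * h) ! 0 = 1"
      by (rule eig_moduli_inverse[OF _ _ inv]) (use cs n in auto)
    have hT: "transpose_mat h \<in> SL n" by (rule SL_transpose[OF h])
    have "eig_moduli (transpose_mat h * h) ! 0 > 0"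
      by (rule eig_moduli_SL(1)[OF SL_mult[OF hT h] n]) (use n in simp)
    moreover from this have "eig_moduli (g * transpose_mat g) ! (n - 1) = 1 / eig_moduli (transpose_mat h * h) ! 0"
      using eq by (simp add: field_simps)
    ultimately have "mu n g = - ln (sqrt (eig_moduli (transpose_mat h * h) ! 0))"
      unfolding mu_def by (simp add: real_sqrt_divide ln_div)
    moreover have "\<bar>ln (sqrt (eig_moduli (transpose_mat h * h) ! 0)) - ln (mnorm n h)\<bar> \<le> c"
      using 1[OF hT] norms_transpose[OF cs(2)] unfolding mu_def by simp
    ultimately show ?thesis by (simp add: abs_le_iff)
  qed
qed

section \<open>Zariski density and traces\<close>

definition pairing :: "'i set \<Rightarrow> ('i \<Rightarrow> real) \<Rightarrow> ('i \<Rightarrow> real) \<Rightarrow> real" where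
  "pairing I c x = (\<Sum>i\<in>I. c i * x i)"

text \<open>On \<open>I\<close> this is the linear span of \<open>X\<close>, described by the
  equations that hold on it. In this form Zariski density yields membership at once, since a linear
  equation in polynomial coordinates is a polynomial equation.\<close>

definition biannihilator :: "'i set \<Rightarrow> ('i \<Rightarrow> real) set \<Rightarrow> ('i \<Rightarrow> real) set" where
  "biannihilator I X = {x. \<forall>c. (\<forall>y\<in>X. pairing I c y = 0) \<longrightarrow> pairing I c x = 0}"

lemma biannihilatorI:
  assumes "\<And>c. (\<And>y. y \<in> X \<Longrightarrow> pairing I c y = 0) \<Longrightarrow> pairing I c x = 0"
  shows "x \<in> biannihilator I X"
  using assms by (simp add: biannihilator_def)

lemma biannihilatorD:
  assumes "x \<in> biannihilator I X" and "\<And>y. y \<in> X \<Longrightarrow> pairing I c y = 0"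
  shows "pairing I c x = 0"
  using assms by (simp add: biannihilator_def)

text \<open>Gaussian elimination over the coordinates with control of the coefficients: a coordinate
  that does not vanish on \<open>X\<close> gives a pivot \<open>f\<^sub>0\<close>, the map
  \<open>\<phi>\<close> clears that coordinate, and the induction hypothesis applies to the image of
  \<open>X\<close>. The bound \<open>K\<close> must not depend on \<open>x\<close>.\<close>

lemma bounded_spanning_set:
  assumes "finite I"
  shows "\<exists>(N::nat) f K. (\<forall>k<N. f k \<in> X) \<and> K \<ge> 0 \<and>
     (\<forall>x\<in>biannihilator I X. \<exists>t. (\<forall>i\<in>I. x i = (\<Sum>k<N. t k * f k i)) \<and>
        (\<forall>k<N. \<bar>t k\<bar> \<le> K * (\<Sum>i\<in>I. \<bar>x i\<bar>)))"
  using assms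
proof (induction I arbitrary: X rule: finite_induct)
  case empty
  show ?case by (rule exI[of _ 0]) auto
next
  case (insert i\<^sub>0 J)
  show ?case
  proof (cases "\<forall>y\<in>X. y i\<^sub>0 = 0")
    case True
    obtain N :: nat and f K where N: "\<forall>k<N. f k \<in> X" "K \<ge> 0"
      and IH: "\<forall>x\<in>biannihilator J X. \<exists>t. (\<forall>i\<in>J. x i = (\<Sum>k<N. t k * f k i)) \<and>
        (\<forall>k<N. \<bar>t k\<bar> \<le> K * (\<Sum>i\<in>J. \<bar>x i\<bar>))"
      using insert.IH[of X] by (elim exE conjE) (rule that)
    show ?thesis
    proof (intro exI[of _ N] exI[of _ f] exI[of _ K] conjI ballI)
      fix x assume x: "x \<in> biannihilator (insert i\<^sub>0 J) X"
      have "pairing (insert i\<^sub>0 J) (\<lambda>i. if i = i\<^sub>0 then 1 else 0) x = 0"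
      proof -
        have "pairing (insert i\<^sub>0 J) (\<lambda>i. if i = i\<^sub>0 then 1 else 0) y = y i\<^sub>0" for y
          unfolding pairing_def using insert.hyps by (simp add: if_distrib[of "\<lambda>c. c * _"] cong: if_cong)
        thus ?thesis using True by (intro biannihilatorD[OF x]) simp
      qed
      hence x0: "x i\<^sub>0 = 0" unfolding pairing_def using insert.hyps
        by (simp add: if_distrib[of "\<lambda>c. c * _"] cong: if_cong)
      have ext: "pairing (insert i\<^sub>0 J) (c(i\<^sub>0 := 0)) y = pairing J c y" for c y
      proof -
        have "(\<Sum>i\<in>J. (c(i\<^sub>0 := 0)) i * y i) = (\<Sum>i\<in>J. c i * y i)"
          using insert.hyps by (intro sum.cong) auto
        thus ?thesis unfolding pairing_def using insert.hyps by simp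
      qed
      have "x \<in> biannihilator J X"
      proof (rule biannihilatorI)
        fix c assume "\<And>y. y \<in> X \<Longrightarrow> pairing J c y = 0"
        hence "pairing (insert i\<^sub>0 J) (c(i\<^sub>0 := 0)) x = 0" by (intro biannihilatorD[OF x]) (simp add: ext)
        thus "pairing J c x = 0" by (simp add: ext)
      qed
      from bspec[OF IH this] obtain t where tt: "(\<forall>i\<in>J. x i = (\<Sum>k<N. t k * f k i)) \<and>
        (\<forall>k<N. \<bar>t k\<bar> \<le> K * (\<Sum>i\<in>J. \<bar>x i\<bar>))" by (rule exE)
      note t = conjunct1[OF tt] and tb = conjunct2[OF tt]
      have z: "(\<Sum>k<N. t k * f k i\<^sub>0) = 0"
      proof (rule sum.neutral, rule ballI)
        fix k assume "k \<in> {..<N}"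
        thus "t k * f k i\<^sub>0 = 0" using bspec[OF True, of "f k"] N(1) by simp
      qed
      have sx: "(\<Sum>i\<in>insert i\<^sub>0 J. \<bar>x i\<bar>) = (\<Sum>i\<in>J. \<bar>x i\<bar>)" using x0 insert.hyps by simp
      show "\<exists>t. (\<forall>i\<in>insert i\<^sub>0 J. x i = (\<Sum>k<N. t k * f k i)) \<and>
          (\<forall>k<N. \<bar>t k\<bar> \<le> K * (\<Sum>i\<in>insert i\<^sub>0 J. \<bar>x i\<bar>))"
      proof (intro exI[of _ t] conjI ballI)
        show "x i = (\<Sum>k<N. t k * f k i)" if "i \<in> insert i\<^sub>0 J" for i
          using that bspec[OF t, of i] x0 z by (cases "i = i\<^sub>0") simp_all
      qed (use tb sx in simp)
    qed (fact N)+
  next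
    case False
    then obtain f\<^sub>0 where f\<^sub>0: "f\<^sub>0 \<in> X" "f\<^sub>0 i\<^sub>0 \<noteq> 0" by blast
    define \<phi> where "\<phi> y = (\<lambda>i. y i - y i\<^sub>0 / f\<^sub>0 i\<^sub>0 * f\<^sub>0 i)" for y
    obtain N :: nat and f K where N: "\<forall>k<N. f k \<in> \<phi> ` X" and K: "K \<ge> 0"
      and IH: "\<forall>x\<in>biannihilator J (\<phi> ` X). \<exists>t. (\<forall>i\<in>J. x i = (\<Sum>k<N. t k * f k i)) \<and>
        (\<forall>k<N. \<bar>t k\<bar> \<le> K * (\<Sum>i\<in>J. \<bar>x i\<bar>))"
      using insert.IH[of "\<phi> ` X"] by (elim exE conjE) (rule that)
    define g where "g k = inv_into X \<phi> (f k)" for k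
    have g: "g k \<in> X" "\<phi> (g k) = f k" if "k < N" for k
      using inv_into_into[of "f k" \<phi> X] f_inv_into_f[of "f k" \<phi> X] N that by (auto simp: g_def)
    \<comment> \<open>\<open>L\<close> bounds the l1 norm of \<open>\<phi> x\<close> on
      \<open>J\<close> relative to that of \<open>x\<close>; \<open>M\<close> will bound the
      coefficient \<open>T\<close> of the pivot.\<close>
    define L where "L = 1 + (\<Sum>i\<in>J. \<bar>f\<^sub>0 i\<bar>) / \<bar>f\<^sub>0 i\<^sub>0\<bar>"
    define M where "M = (1 + (\<Sum>k<N. K * L * \<bar>g k i\<^sub>0\<bar>)) / \<bar>f\<^sub>0 i\<^sub>0\<bar>"
    have L: "L \<ge> 0" unfolding L_def by (simp add: sum_nonneg)
    have M: "M \<ge> 0" unfolding M_def using K L by (simp add: sum_nonneg)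
    define h where "h = g(N := f\<^sub>0)"
    show ?thesis
    proof (intro exI[of _ "Suc N"] exI[of _ h] exI[of _ "K * L + M"] conjI ballI)
      show "\<forall>k<Suc N. h k \<in> X" using g f\<^sub>0 by (auto simp: h_def less_Suc_eq)
      show "0 \<le> K * L + M" using K L M by simp
      fix x assume x: "x \<in> biannihilator (insert i\<^sub>0 J) X"
      define s where "s = (\<Sum>i\<in>insert i\<^sub>0 J. \<bar>x i\<bar>)"
      have s: "s = \<bar>x i\<^sub>0\<bar> + (\<Sum>i\<in>J. \<bar>x i\<bar>)" "s \<ge> 0" unfolding s_def using insert.hyps by (auto simp: sum_nonneg)
      have s0: "\<bar>x i\<^sub>0\<bar> \<le> s" unfolding s(1) by (simp add: sum_nonneg)
      have "\<phi> x \<in> biannihilator J (\<phi> ` X)"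
      proof (rule biannihilatorI)
        fix c assume c: "\<And>y. y \<in> \<phi> ` X \<Longrightarrow> pairing J c y = 0"
        \<comment> \<open>The adjoint of \<open>\<phi>\<close>: pairing \<open>c'\<close> with
          \<open>y\<close> equals pairing \<open>c\<close> with \<open>\<phi> y\<close>, so
          equations for the image of \<open>X\<close> pull back to equations for
          \<open>X\<close>.\<close>
        define c' where "c' = c(i\<^sub>0 := - pairing J c f\<^sub>0 / f\<^sub>0 i\<^sub>0)"
        have c': "pairing (insert i\<^sub>0 J) c' y = pairing J c (\<phi> y)" for y
        proof -
          have "(\<Sum>i\<in>J. c' i * y i) = (\<Sum>i\<in>J. c i * y i)"
            using insert.hyps by (intro sum.cong) (auto simp: c'_def)
          hence "pairing (insert i\<^sub>0 J) c' y = - pairing J c f\<^sub>0 / f\<^sub>0 i\<^sub>0 * y i\<^sub>0 + (\<Sum>i\<in>J. c i * y i)"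
            unfolding pairing_def[of "insert i\<^sub>0 J"] using insert.hyps by (simp add: c'_def)
          also have "\<dots> = (\<Sum>i\<in>J. c i * y i) - y i\<^sub>0 / f\<^sub>0 i\<^sub>0 * (\<Sum>i\<in>J. c i * f\<^sub>0 i)"
            by (simp add: pairing_def)
          also have "\<dots> = pairing J c (\<phi> y)"
            unfolding pairing_def \<phi>_def by (simp add: sum_distrib_left sum_subtractf[symmetric] algebra_simps)
          finally show ?thesis .
        qed
        have "pairing (insert i\<^sub>0 J) c' x = 0" using c by (intro biannihilatorD[OF x]) (simp add: c')
        thus "pairing J c (\<phi> x) = 0" by (simp add: c')
      qed
      from bspec[OF IH this] obtain t where tt: "(\<forall>i\<in>J. \<phi> x i = (\<Sum>k<N. t k * f k i)) \<and>
        (\<forall>k<N. \<bar>t k\<bar> \<le> K * (\<Sum>i\<in>J. \<bar>\<phi> x i\<bar>))" by (rule exE)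
      note t = conjunct1[OF tt] and tb = conjunct2[OF tt]
      have "(\<Sum>i\<in>J. \<bar>\<phi> x i\<bar>) \<le> (\<Sum>i\<in>J. \<bar>x i\<bar> + \<bar>x i\<^sub>0\<bar> / \<bar>f\<^sub>0 i\<^sub>0\<bar> * \<bar>f\<^sub>0 i\<bar>)"
      proof (rule sum_mono)
        fix i
        have "\<bar>\<phi> x i\<bar> \<le> \<bar>x i\<bar> + \<bar>x i\<^sub>0 / f\<^sub>0 i\<^sub>0 * f\<^sub>0 i\<bar>" unfolding \<phi>_def by (rule abs_triangle_ineq4)
        thus "\<bar>\<phi> x i\<bar> \<le> \<bar>x i\<bar> + \<bar>x i\<^sub>0\<bar> / \<bar>f\<^sub>0 i\<^sub>0\<bar> * \<bar>f\<^sub>0 i\<bar>" by (simp add: abs_mult)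
      qed
      also have "\<dots> = (\<Sum>i\<in>J. \<bar>x i\<bar>) + \<bar>x i\<^sub>0\<bar> * ((\<Sum>i\<in>J. \<bar>f\<^sub>0 i\<bar>) / \<bar>f\<^sub>0 i\<^sub>0\<bar>)"
        unfolding sum.distrib sum_distrib_left[symmetric] by simp
      also have "\<dots> \<le> s + s * ((\<Sum>i\<in>J. \<bar>f\<^sub>0 i\<bar>) / \<bar>f\<^sub>0 i\<^sub>0\<bar>)"
        using s s0 by (intro add_mono mult_right_mono) (auto simp: sum_nonneg)
      also have "\<dots> = L * s" by (simp add: L_def algebra_simps)
      finally have "(\<Sum>i\<in>J. \<bar>\<phi> x i\<bar>) \<le> L * s" .
      hence tb': "\<bar>t k\<bar> \<le> K * L * s" if "k < N" for k
        using tb[rule_format, OF that] mult_left_mono[OF _ K, of "\<Sum>i\<in>J. \<bar>\<phi> x i\<bar>" "L * s"] by (simp add: mult.assoc)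
      \<comment> \<open>Lifting the \<open>f k\<close> to the \<open>g k\<close> restores their
        entries at \<open>i\<^sub>0\<close>; \<open>T\<close> is what the pivot has to contribute
        once these are subtracted.\<close>
      define T where "T = x i\<^sub>0 / f\<^sub>0 i\<^sub>0 - (\<Sum>k<N. t k * g k i\<^sub>0) / f\<^sub>0 i\<^sub>0"
      have "\<bar>T\<bar> \<le> \<bar>x i\<^sub>0\<bar> / \<bar>f\<^sub>0 i\<^sub>0\<bar> + \<bar>\<Sum>k<N. t k * g k i\<^sub>0\<bar> / \<bar>f\<^sub>0 i\<^sub>0\<bar>"
        unfolding T_def using abs_triangle_ineq4[of "x i\<^sub>0 / f\<^sub>0 i\<^sub>0" "(\<Sum>k<N. t k * g k i\<^sub>0) / f\<^sub>0 i\<^sub>0"] by simp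
      also have "\<dots> \<le> s / \<bar>f\<^sub>0 i\<^sub>0\<bar> + (\<Sum>k<N. K * L * \<bar>g k i\<^sub>0\<bar>) * s / \<bar>f\<^sub>0 i\<^sub>0\<bar>"
      proof (intro add_mono divide_right_mono)
        have "\<bar>\<Sum>k<N. t k * g k i\<^sub>0\<bar> \<le> (\<Sum>k<N. \<bar>t k\<bar> * \<bar>g k i\<^sub>0\<bar>)"
          using sum_abs[of "\<lambda>k. t k * g k i\<^sub>0" "{..<N}"] by (simp add: abs_mult)
        also have "\<dots> \<le> (\<Sum>k<N. (K * L * s) * \<bar>g k i\<^sub>0\<bar>)"
          using tb' by (intro sum_mono mult_right_mono) auto
        also have "\<dots> = (\<Sum>k<N. K * L * \<bar>g k i\<^sub>0\<bar>) * s"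
          unfolding sum_distrib_right by (intro sum.cong refl) (simp add: mult_ac)
        finally show "\<bar>\<Sum>k<N. t k * g k i\<^sub>0\<bar> \<le> (\<Sum>k<N. K * L * \<bar>g k i\<^sub>0\<bar>) * s" .
      qed (use s0 in auto)
      also have "\<dots> = M * s" unfolding M_def by (simp add: add_divide_distrib distrib_right)
      finally have T: "\<bar>T\<bar> \<le> M * s" .
      define t' where "t' = t(N := T)"
      have "x i = (\<Sum>k<Suc N. t' k * h k i)" if "i \<in> insert i\<^sub>0 J" for i
      proof -
        have "\<phi> x i = (\<Sum>k<N. t k * \<phi> (g k) i)"
        proof (cases "i = i\<^sub>0")
          case True
          thus ?thesis using f\<^sub>0 by (simp add: \<phi>_def)
        next
          case False
          thus ?thesis using bspec[OF t, of i] that g(2) by simp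
        qed
        hence "x i - x i\<^sub>0 / f\<^sub>0 i\<^sub>0 * f\<^sub>0 i = (\<Sum>k<N. t k * g k i - (t k * g k i\<^sub>0) / f\<^sub>0 i\<^sub>0 * f\<^sub>0 i)"
          by (simp add: \<phi>_def algebra_simps)
        also have "\<dots> = (\<Sum>k<N. t k * g k i) - (\<Sum>k<N. t k * g k i\<^sub>0) / f\<^sub>0 i\<^sub>0 * f\<^sub>0 i"
          by (simp add: sum_subtractf sum_distrib_right sum_divide_distrib)
        finally have "x i = (\<Sum>k<N. t k * g k i) + T * f\<^sub>0 i" by (simp add: T_def algebra_simps)
        moreover have "(\<Sum>k<N. t' k * h k i) = (\<Sum>k<N. t k * g k i)"
          by (intro sum.cong) (auto simp: t'_def h_def)
        ultimately show ?thesis by (simp add: t'_def h_def)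
      qed
      moreover have "\<bar>t' k\<bar> \<le> (K * L + M) * s" if "k < Suc N" for k
      proof -
        have "0 \<le> M * s" "0 \<le> K * L * s" using s(2) K L M by simp_all
        thus ?thesis using tb'[of k] T that by (cases "k = N") (auto simp: t'_def distrib_right)
      qed
      ultimately show "\<exists>t. (\<forall>i\<in>insert i\<^sub>0 J. x i = (\<Sum>k<Suc N. t k * h k i)) \<and>
        (\<forall>k<Suc N. \<bar>t k\<bar> \<le> (K * L + M) * (\<Sum>i\<in>insert i\<^sub>0 J. \<bar>x i\<bar>))"
        unfolding s_def[symmetric] by (intro exI[of _ t'] conjI ballI allI impI)
    qed
  qed
qed

text \<open>Expand one copy of \<open>x\<close> in the \<open>f k\<close> and pair it with
  \<open>x\<close> itself: the sum of squares is at most the l1 norm times \<open>K\<close> times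
  the sum of the pairings. Positivity of the sum of squares is the whole source of nondegeneracy
  here, with \<open>x\<close> used both as a vector and as a functional.\<close>

lemma bounded_below_pairing:
  assumes I: "finite I"
  shows "\<exists>(N::nat) f K. (\<forall>k<N. f k \<in> X) \<and> K \<ge> 0 \<and>
     (\<forall>x\<in>biannihilator I X. (\<Sum>i\<in>I. \<bar>x i\<bar>) \<le> K * (\<Sum>k<N. \<bar>pairing I x (f k)\<bar>))"
proof -
  obtain N :: nat and f K where N: "\<forall>k<N. f k \<in> X" and K: "K \<ge> 0"
    and span: "\<forall>x\<in>biannihilator I X. \<exists>t. (\<forall>i\<in>I. x i = (\<Sum>k<N. t k * f k i)) \<and>
        (\<forall>k<N. \<bar>t k\<bar> \<le> K * (\<Sum>i\<in>I. \<bar>x i\<bar>))"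
    using bounded_spanning_set[OF I, of X] by (elim exE conjE) (rule that)
  define c where "c = (real (card I))\<^sup>2 * K"
  have "(\<Sum>i\<in>I. \<bar>x i\<bar>) \<le> c * (\<Sum>k<N. \<bar>pairing I x (f k)\<bar>)" if x: "x \<in> biannihilator I X" for x
  proof (cases "(\<Sum>i\<in>I. \<bar>x i\<bar>) = 0")
    case True
    thus ?thesis using K by (simp add: c_def sum_nonneg)
  next
    case False
    define s where "s = (\<Sum>i\<in>I. \<bar>x i\<bar>)"
    have "s \<ge> 0" unfolding s_def by (simp add: sum_nonneg)
    moreover have "s \<noteq> 0" using False unfolding s_def .
    ultimately have s: "s > 0" by simp
    from bspec[OF span x] obtain t where tt: "(\<forall>i\<in>I. x i = (\<Sum>k<N. t k * f k i)) \<and> (\<forall>k<N. \<bar>t k\<bar> \<le> K * s)"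
      unfolding s_def by (rule exE)
    note t = conjunct1[OF tt] and tb = conjunct2[OF tt]
    have "(\<Sum>i\<in>I. (x i)\<^sup>2) = (\<Sum>i\<in>I. x i * (\<Sum>k<N. t k * f k i))"
      using t by (intro sum.cong) (auto simp: power2_eq_square)
    also have "\<dots> = (\<Sum>k<N. t k * pairing I x (f k))"
      unfolding pairing_def sum_distrib_left by (subst sum.swap) (simp add: mult_ac)
    also have "\<dots> \<le> (\<Sum>k<N. (K * s) * \<bar>pairing I x (f k)\<bar>)"
    proof (rule sum_mono)
      fix k assume "k \<in> {..<N}"
      hence "\<bar>t k\<bar> * \<bar>pairing I x (f k)\<bar> \<le> (K * s) * \<bar>pairing I x (f k)\<bar>" using tb by (intro mult_right_mono) auto
      thus "t k * pairing I x (f k) \<le> (K * s) * \<bar>pairing I x (f k)\<bar>"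
        using abs_ge_self[of "t k * pairing I x (f k)"] by (simp add: abs_mult)
    qed
    finally have "(\<Sum>i\<in>I. (x i)\<^sup>2) \<le> (K * s) * (\<Sum>k<N. \<bar>pairing I x (f k)\<bar>)" by (simp add: sum_distrib_left)
    hence "(real (card I))\<^sup>2 * (\<Sum>i\<in>I. (x i)\<^sup>2) \<le> (real (card I))\<^sup>2 * ((K * s) * (\<Sum>k<N. \<bar>pairing I x (f k)\<bar>))"
      by (intro mult_left_mono) auto
    hence "s\<^sup>2 \<le> s * (c * (\<Sum>k<N. \<bar>pairing I x (f k)\<bar>))"
      using sum_abs_square_le[OF I, of x] unfolding s_def[symmetric] c_def by (simp add: mult_ac)
    thus ?thesis using s unfolding s_def[symmetric] by (simp add: power2_eq_square)
  qed
  moreover have "c \<ge> 0" using K by (simp add: c_def)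
  ultimately show ?thesis using N by (intro exI[of _ N] exI[of _ f] exI[of _ c] conjI ballI) auto
qed

section \<open>Matrix coefficients as polynomial functions\<close>

lemma polyfun_sum:
  "finite I \<Longrightarrow> (\<And>i. i \<in> I \<Longrightarrow> f i \<in> polyfun n) \<Longrightarrow> (\<lambda>A. \<Sum>i\<in>I. f i A) \<in> polyfun n"
proof (induction I rule: finite_induct)
  case empty
  show ?case using polyfun.const[of 0 n] by simp
next
  case (insert i I)
  hence "(\<lambda>A. f i A + (\<Sum>i\<in>I. f i A)) \<in> polyfun n" by (intro polyfun.add) auto
  thus ?case using insert.hyps by simp
qed

text \<open>Matrix entries on the tensor product of the standard representation with its exterior
  square. The trace there is a product of the two traces, so one element of a finite set takes care
  of both. The first component is a row and a column, the others are a pair of rows and a pair of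
  columns.\<close>

definition tensor_coords :: "real mat \<Rightarrow> (nat \<times> nat) \<times> (nat \<times> nat) \<times> (nat \<times> nat) \<Rightarrow> real" where
  "tensor_coords B v = B $$ fst v * compound2 B (fst (snd v)) (snd (snd v))"

lemma tensor_coords_polyfun:
  assumes "v \<in> idx2 n \<times> idx2 n \<times> idx2 n"
  shows "(\<lambda>B. tensor_coords B v) \<in> polyfun n"
proof -
  obtain i j p q r s where v: "v = ((i, j), (p, q), (r, s))" by (metis prod.exhaust)
  have lt: "i < n" "j < n" "p < n" "q < n" "r < n" "s < n" using assms by (auto simp: v idx2_def)
  have "(\<lambda>B. B $$ (i, j) * (B $$ (p, r) * B $$ (q, s) + (-1) * (B $$ (p, s) * B $$ (q, r)))) \<in> polyfun n"
    by (intro polyfun.mult polyfun.add polyfun.entry polyfun.const lt)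
  thus ?thesis by (simp add: tensor_coords_def compound2_def v)
qed

text \<open>Since the span of the representation of \<^term>\<open>SL n\<close> on a tensor product is closed under
  transposition, the trace form on it is nondegenerate. Zariski density transfers this to the span of
  the image of the subgroup, without any irreducibility theorem.\<close>

lemma zariski_dense_large_trace:
  assumes n: "n \<ge> 2" and \<Gamma>: "\<Gamma> \<subseteq> SL n" and zd: "zariski_dense_SL n \<Gamma>"
  obtains F C where "finite F" "F \<subseteq> \<Gamma>" "C > 0"
    "\<And>g. g \<in> \<Gamma> \<Longrightarrow> (\<forall>f\<in>\<Gamma>. g * f \<in> \<Gamma>) \<Longrightarrow> \<exists>f\<in>F. mnorm n g * mnorm2 n g \<le>
        C * (eig_moduli (g * f) ! 0 * (eig_moduli (g * f) ! 0 * eig_moduli (g * f) ! 1))"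
proof -
  define I where "I = idx2 n \<times> idx2 n \<times> idx2 n"
  have I: "finite I" by (simp add: I_def)
  obtain N :: nat and f K where N: "\<forall>k<N. f k \<in> tensor_coords ` \<Gamma>" and K: "K \<ge> 0"
    and low: "\<forall>x\<in>biannihilator I (tensor_coords ` \<Gamma>).
        (\<Sum>i\<in>I. \<bar>x i\<bar>) \<le> K * (\<Sum>k<N. \<bar>pairing I x (f k)\<bar>)"
    using bounded_below_pairing[OF I, of "tensor_coords ` \<Gamma>"] by (elim exE conjE) (rule that)
  define b where "b k = inv_into \<Gamma> tensor_coords (f k)" for k
  have b: "b k \<in> \<Gamma>" "tensor_coords (b k) = f k" if "k < N" for k
    using inv_into_into[of "f k" tensor_coords \<Gamma>] f_inv_into_f[of "f k" tensor_coords \<Gamma>] N that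
    by (auto simp: b_def)
  \<comment> \<open>The summand 1 makes \<open>C\<close> positive and strictly larger than
    \<open>2 * K * real n ^ 3 * real N\<close>, which drives the contradiction below.\<close>
  define C where "C = 2 * K * real n ^ 3 * real N + 1"
  have C: "C > 0" using K by (simp add: C_def add_nonneg_pos)
  show thesis
  proof (rule that[of "b ` {..<N}" C])
    fix g assume g: "g \<in> \<Gamma>" and closed: "\<forall>f\<in>\<Gamma>. g * f \<in> \<Gamma>"
    have gS: "g \<in> SL n" and gc: "g \<in> carrier_mat n n" using g \<Gamma> by (auto simp: SL_def)
    \<comment> \<open>With the transpose of \<open>g\<close>, pairing with the coordinates of
      \<open>b k\<close> gives traces of \<open>g * b k\<close>. The transpose need not lie in
      \<open>\<Gamma>\<close>, but it lies in \<open>SL n\<close>, where the linear relations among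
      the coordinates of \<open>\<Gamma>\<close> persist by Zariski density.\<close>
    define x where "x = tensor_coords (transpose_mat g)"
    have "x \<in> biannihilator I (tensor_coords ` \<Gamma>)"
    proof (rule biannihilatorI)
      fix c assume c: "\<And>y. y \<in> tensor_coords ` \<Gamma> \<Longrightarrow> pairing I c y = 0"
      have "(\<lambda>B. \<Sum>i\<in>I. c i * tensor_coords B i) \<in> polyfun n"
      proof (rule polyfun_sum[OF I])
        fix i assume "i \<in> I"
        thus "(\<lambda>B. c i * tensor_coords B i) \<in> polyfun n"
          unfolding I_def by (intro polyfun.mult[OF polyfun.const] tensor_coords_polyfun)
      qed
      hence "(\<Sum>i\<in>I. c i * tensor_coords (transpose_mat g) i) = 0"
        by (rule zd[unfolded zariski_dense_SL_def, rule_format])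
          (use c SL_transpose[OF gS] in \<open>auto simp: pairing_def\<close>)
      thus "pairing I c x = 0" by (simp add: pairing_def x_def)
    qed
    note lowx = bspec[OF low this]
    have sumI: "(\<Sum>v\<in>I. F (fst v) * G (fst (snd v)) (snd (snd v)))
        = (\<Sum>u\<in>idx2 n. F u) * (\<Sum>y\<in>idx2 n. \<Sum>z\<in>idx2 n. G y z)" for F :: "nat \<times> nat \<Rightarrow> real" and G
    proof -
      have "(\<Sum>v\<in>I. F (fst v) * G (fst (snd v)) (snd (snd v)))
          = (\<Sum>u\<in>idx2 n. \<Sum>y\<in>idx2 n. \<Sum>z\<in>idx2 n. F u * G y z)"
        unfolding I_def by (simp add: sum.cartesian_product case_prod_unfold)
      also have "\<dots> = (\<Sum>u\<in>idx2 n. F u * (\<Sum>y\<in>idx2 n. \<Sum>z\<in>idx2 n. G y z))"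
        by (simp only: sum_distrib_left)
      finally show ?thesis by (simp only: sum_distrib_right)
    qed
    have "(\<Sum>i\<in>I. \<bar>x i\<bar>) = mnorm n (transpose_mat g) * mnorm2 n (transpose_mat g)"
      using sumI[of "\<lambda>u. \<bar>transpose_mat g $$ u\<bar>" "\<lambda>y z. \<bar>compound2 (transpose_mat g) y z\<bar>"]
      unfolding x_def tensor_coords_def abs_mult mnorm_def mnorm2_def by (simp add: sum_idx2)
    hence sx: "(\<Sum>i\<in>I. \<bar>x i\<bar>) = mnorm n g * mnorm2 n g" by (simp add: norms_transpose[OF gc])
    have pair: "pairing I x (f k) = mtrace n (g * b k) * (2 * mtrace2 n (g * b k))" if k: "k < N" for k
    proof -
      have bc: "b k \<in> carrier_mat n n" using b(1)[OF k] \<Gamma> by (auto simp: SL_def)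
      have "pairing I x (f k) = (\<Sum>v\<in>I. (transpose_mat g $$ fst v * b k $$ fst v) *
          (compound2 (transpose_mat g) (fst (snd v)) (snd (snd v)) * compound2 (b k) (fst (snd v)) (snd (snd v))))"
        unfolding pairing_def x_def b(2)[OF k, symmetric] tensor_coords_def by (simp add: mult_ac)
      also have "\<dots> = (\<Sum>u\<in>idx2 n. transpose_mat g $$ u * b k $$ u) *
          (\<Sum>y\<in>idx2 n. \<Sum>z\<in>idx2 n. compound2 (transpose_mat g) y z * compound2 (b k) y z)"
        by (rule sumI[of "\<lambda>u. transpose_mat g $$ u * b k $$ u"
              "\<lambda>y z. compound2 (transpose_mat g) y z * compound2 (b k) y z"])
      also have "(\<Sum>u\<in>idx2 n. transpose_mat g $$ u * b k $$ u) = mtrace n (g * b k)"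
      proof -
        have "(\<Sum>u\<in>idx2 n. transpose_mat g $$ u * b k $$ u) = (\<Sum>i<n. \<Sum>j<n. g $$ (j, i) * b k $$ (i, j))"
          unfolding sum_idx2 using gc by (intro sum.cong refl) simp
        also have "\<dots> = (\<Sum>j<n. \<Sum>i<n. g $$ (j, i) * b k $$ (i, j))" by (rule sum.swap)
        also have "\<dots> = mtrace n (g * b k)" unfolding mtrace_def
          by (intro sum.cong refl) (simp add: mult_entry[OF gc bc] del: index_mult_mat)
        finally show ?thesis .
      qed
      also have "(\<Sum>y\<in>idx2 n. \<Sum>z\<in>idx2 n. compound2 (transpose_mat g) y z * compound2 (b k) y z)
          = (\<Sum>y\<in>idx2 n. \<Sum>z\<in>idx2 n. compound2 g z y * compound2 (b k) y z)"
        by (intro sum.cong refl) (simp add: norms_transpose(3)[OF gc])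
      also have "\<dots> = (\<Sum>z\<in>idx2 n. \<Sum>y\<in>idx2 n. compound2 g z y * compound2 (b k) y z)" by (rule sum.swap)
      also have "\<dots> = 2 * mtrace2 n (g * b k)" by (rule mtrace2_mult[OF gc bc, symmetric])
      finally show ?thesis .
    qed
    define e where "e k = eig_moduli (g * b k) ! 0 * (eig_moduli (g * b k) ! 0 * eig_moduli (g * b k) ! 1)" for k
    have pe: "\<bar>pairing I x (f k)\<bar> \<le> 2 * real n ^ 3 * e k" if k: "k < N" for k
    proof -
      have gb: "g * b k \<in> carrier_mat n n" using b(1)[OF k] closed \<Gamma> by (auto simp: SL_def)
      note bd = eig_moduli_bounds[OF gb n] and nn = eig_moduli_nonneg[OF gb]
      have "\<bar>pairing I x (f k)\<bar> = 2 * (\<bar>mtrace n (g * b k)\<bar> * \<bar>mtrace2 n (g * b k)\<bar>)"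
        unfolding pair[OF k] by (simp add: abs_mult)
      also have "\<dots> \<le> 2 * ((real n * eig_moduli (g * b k) ! 0) * ((real n)\<^sup>2 * (eig_moduli (g * b k) ! 0 * eig_moduli (g * b k) ! 1)))"
        using bd(3,4) nn[of 0] n by (intro mult_left_mono mult_mono) auto
      also have "\<dots> = 2 * real n ^ 3 * e k" by (simp add: e_def power2_eq_square power3_eq_cube)
      finally show ?thesis .
    qed
    have "\<exists>k<N. mnorm n g * mnorm2 n g \<le> C * e k"
    proof (rule ccontr)
      assume "\<not> ?thesis"
      hence small: "C * e k < mnorm n g * mnorm2 n g" if "k < N" for k using that by force
      define s where "s = mnorm n g * mnorm2 n g"
      have s: "s > 0" unfolding s_def using mnorm_SL[OF gS n] by (intro mult_pos_pos) auto
      have "s \<le> K * (\<Sum>k<N. \<bar>pairing I x (f k)\<bar>)" using lowx sx by (simp add: s_def)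
      also have "\<dots> \<le> K * (\<Sum>k<N. 2 * real n ^ 3 * (s / C))"
      proof (intro mult_left_mono[OF _ K] sum_mono)
        fix k assume "k \<in> {..<N}"
        hence k: "k < N" by simp
        have "e k \<le> s / C" using small[OF k] C by (simp add: s_def field_simps)
        hence "2 * real n ^ 3 * e k \<le> 2 * real n ^ 3 * (s / C)" by (intro mult_left_mono) auto
        thus "\<bar>pairing I x (f k)\<bar> \<le> 2 * real n ^ 3 * (s / C)" using pe[OF k] by linarith
      qed
      also have "\<dots> = (C - 1) * s / C" by (simp add: C_def)
      also have "\<dots> < s" using C s by (simp add: field_simps)
      finally show False by simp
    qed
    thus "\<exists>f\<in>b ` {..<N}. mnorm n g * mnorm2 n g \<le>
        C * (eig_moduli (g * f) ! 0 * (eig_moduli (g * f) ! 0 * eig_moduli (g * f) ! 1))"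
      unfolding e_def by blast
  qed (use b C in auto)
qed

section \<open>Growth rates\<close>

definition exp_bounded :: "(real \<Rightarrow> 'a set) \<Rightarrow> real \<Rightarrow> bool" where
  "exp_bounded N \<beta> \<longleftrightarrow> (\<exists>C. \<forall>R\<ge>0. finite (N R) \<and> real (card (N R)) \<le> C * exp (\<beta> * R))"

lemma growth_rate_le_of_exp_bounded:
  assumes "exp_bounded N \<beta>"
  shows "growth_rate N \<le> ereal \<beta>"
proof -
  obtain C where C: "\<And>R. R \<ge> 0 \<Longrightarrow> finite (N R)" "\<And>R. R \<ge> 0 \<Longrightarrow> real (card (N R)) \<le> C * exp (\<beta> * R)"
    using assms unfolding exp_bounded_def by blast
  define D where "D = max C 1"
  have D: "real (card (N R)) \<le> D * exp (\<beta> * R)" if "R \<ge> 0" for R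
  proof -
    have "C * exp (\<beta> * R) \<le> D * exp (\<beta> * R)" by (intro mult_right_mono) (auto simp: D_def)
    thus ?thesis using C(2)[OF that] by linarith
  qed
  have "growth_rate N \<le> Limsup at_top (\<lambda>R. ereal (ln D / R + \<beta>))"
    unfolding growth_rate_def
  proof (rule Limsup_mono)
    show "\<forall>\<^sub>F R in at_top. log_count_rate (N R) R \<le> ereal (ln D / R + \<beta>)"
      using eventually_gt_at_top[of "0::real"]
    proof eventually_elim
      case (elim R)
      show ?case
      proof (cases "N R = {}")
        case False
        have fin: "finite (N R)" using C(1) elim by simp
        have "real (card (N R)) > 0" using fin False by (simp add: card_gt_0_iff)
        hence "ln (real (card (N R))) \<le> ln (D * exp (\<beta> * R))" using D[of R] elim by (intro ln_mono) auto
        also have "\<dots> = ln D + \<beta> * R" by (simp add: ln_mult_pos D_def)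
        finally have "ln (real (card (N R))) / R \<le> (ln D + \<beta> * R) / R"
          using elim by (intro divide_right_mono) auto
        thus ?thesis using fin False elim by (simp add: log_count_rate_def add_divide_distrib)
      qed (simp add: log_count_rate_def)
    qed
  qed
  also have "\<dots> = ereal \<beta>"
  proof (rule lim_imp_Limsup)
    have "((\<lambda>R. ln D / R) \<longlongrightarrow> 0) at_top"
      by (intro tendsto_divide_0[OF tendsto_const] filterlim_at_top_imp_at_infinity filterlim_ident)
    from tendsto_add[OF this tendsto_const[of \<beta>]]
    show "((\<lambda>R. ereal (ln D / R + \<beta>)) \<longlongrightarrow> ereal \<beta>) at_top" by simp
  qed simp
  finally show ?thesis .
qed

lemma exp_bounded_of_growth_rate_less:
  assumes "growth_rate N < ereal \<beta>" and "\<beta> \<ge> 0"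
    and fin: "\<And>R. finite (N R)" and mono: "\<And>R R'. R \<le> R' \<Longrightarrow> N R \<subseteq> N R'"
  shows "exp_bounded N \<beta>"
proof -
  have "\<forall>\<^sub>F R in at_top. log_count_rate (N R) R < ereal \<beta>"
    using assms(1) unfolding growth_rate_def by (rule Limsup_lessD)
  then obtain R\<^sub>0 where R\<^sub>0: "\<And>R. R \<ge> R\<^sub>0 \<Longrightarrow> log_count_rate (N R) R < ereal \<beta>"
    unfolding eventually_at_top_linorder by blast
  define R\<^sub>1 where "R\<^sub>1 = max R\<^sub>0 1"
  define C where "C = max 1 (real (card (N R\<^sub>1)))"
  have "real (card (N R)) \<le> C * exp (\<beta> * R)" if R: "R \<ge> 0" for R
  proof (cases "R \<ge> R\<^sub>1 \<and> N R \<noteq> {}")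
    case True
    have R1: "R > 0" "R \<ge> R\<^sub>0" using True by (auto simp: R\<^sub>1_def)
    have pos: "real (card (N R)) > 0" using fin True by (simp add: card_gt_0_iff)
    have "ln (real (card (N R))) / R < \<beta>" using R\<^sub>0[OF R1(2)] fin True by (simp add: log_count_rate_def)
    hence "ln (real (card (N R))) < \<beta> * R" using R1 by (simp add: field_simps)
    hence "real (card (N R)) < exp (\<beta> * R)" using pos by (metis exp_less_mono exp_ln)
    also have "\<dots> \<le> C * exp (\<beta> * R)" by (simp add: C_def)
    finally show ?thesis by simp
  next
    case False
    have "1 \<le> exp (\<beta> * R)" using assms(2) R by simp
    have "card (N R) \<le> card (N R\<^sub>1)"
    proof (cases "N R = {}")
      case True
      thus ?thesis by simp
    next
      case ne: False
      hence "R \<le> R\<^sub>1" using False by auto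
      thus ?thesis by (intro card_mono fin mono)
    qed
    hence "real (card (N R)) \<le> C * 1" by (simp add: C_def)
    also have "\<dots> \<le> C * exp (\<beta> * R)" using \<open>1 \<le> exp (\<beta> * R)\<close> by (intro mult_left_mono) (auto simp: C_def)
    finally show ?thesis .
  qed
  thus ?thesis unfolding exp_bounded_def using fin by blast
qed

lemma exp_bounded_of_poly_exp:
  assumes fin: "\<And>R. R \<ge> 0 \<Longrightarrow> finite (N R)"
    and le: "\<And>R. R \<ge> 0 \<Longrightarrow> real (card (N R)) \<le> C * (1 + R)\<^sup>2 * exp (\<beta> * R)"
    and C: "C \<ge> 0" and less: "\<beta> < \<beta>'"
  shows "exp_bounded N \<beta>'"
proof -
  define \<epsilon> where "\<epsilon> = min 1 ((\<beta>' - \<beta>) / 2)"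
  have \<epsilon>: "0 < \<epsilon>" "\<epsilon> \<le> 1" "2 * \<epsilon> \<le> \<beta>' - \<beta>" using less by (auto simp: \<epsilon>_def min_def)
  have "real (card (N R)) \<le> C / \<epsilon>\<^sup>2 * exp (\<beta>' * R)" if R: "R \<ge> 0" for R
  proof -
    have "\<epsilon> * (1 + R) \<le> 1 + \<epsilon> * R" using \<epsilon> by (simp add: algebra_simps)
    also have "\<dots> \<le> exp (\<epsilon> * R)" by (rule exp_ge_add_one_self)
    finally have "(1 + R) \<le> exp (\<epsilon> * R) / \<epsilon>" using \<epsilon> by (simp add: field_simps)
    hence "(1 + R)\<^sup>2 \<le> (exp (\<epsilon> * R) / \<epsilon>)\<^sup>2" using R by (intro power_mono) auto
    also have "\<dots> = exp (2 * \<epsilon> * R) / \<epsilon>\<^sup>2"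
      by (simp add: power_divide exp_double[symmetric] mult.assoc)
    finally have "C * (1 + R)\<^sup>2 * exp (\<beta> * R) \<le> C * (exp (2 * \<epsilon> * R) / \<epsilon>\<^sup>2) * exp (\<beta> * R)"
      using C by (intro mult_right_mono mult_left_mono) auto
    also have "\<dots> = C / \<epsilon>\<^sup>2 * exp ((2 * \<epsilon> + \<beta>) * R)" by (simp add: exp_add distrib_right)
    also have "\<dots> \<le> C / \<epsilon>\<^sup>2 * exp (\<beta>' * R)"
      using C \<epsilon> R by (intro mult_left_mono) (auto intro!: mult_right_mono)
    finally show ?thesis using le[OF R] by linarith
  qed
  thus ?thesis unfolding exp_bounded_def using fin by blast
qed

lemma growth_rate_nonneg:
  assumes "\<forall>\<^sub>F R in at_top. N R \<noteq> {}"
  shows "0 \<le> growth_rate N"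
proof -
  have "0 = Limsup (at_top :: real filter) (\<lambda>_. 0 :: ereal)" by (simp add: Limsup_const)
  also have "\<dots> \<le> growth_rate N" unfolding growth_rate_def
  proof (rule Limsup_mono)
    show "\<forall>\<^sub>F R in at_top. 0 \<le> log_count_rate (N R) R"
      using eventually_gt_at_top[of "0::real"] assms
    proof eventually_elim
      case (elim R)
      have "finite (N R) \<Longrightarrow> 1 \<le> real (card (N R))"
        using elim by (simp add: Suc_le_eq card_gt_0_iff)
      thus ?case using elim by (simp add: log_count_rate_def)
    qed
  qed
  finally show ?thesis .
qed

text \<open>The premise \<open>ne\<close> makes the rate of the second family nonnegative, so that
  an intermediate rate \<open>\<beta>\<close> is nonnegative as well, as
  \<open>exp_bounded_of_growth_rate_less\<close> requires.\<close>

lemma growth_rate_le_of_card_le: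
  fixes N\<^sub>1 :: "real \<Rightarrow> 'a set" and N\<^sub>2 :: "real \<Rightarrow> 'b set"
  assumes fin: "\<And>R. finite (N\<^sub>2 R)" and mono: "\<And>R R'. R \<le> R' \<Longrightarrow> N\<^sub>2 R \<subseteq> N\<^sub>2 R'"
    and ne: "\<forall>\<^sub>F R in at_top. N\<^sub>2 R \<noteq> {}" and c: "c \<ge> 0"
    and fin1: "\<And>R. R \<ge> 0 \<Longrightarrow> finite (N\<^sub>1 R)"
    and le: "\<And>R. R \<ge> 0 \<Longrightarrow> real (card (N\<^sub>1 R)) \<le> c * (1 + R)\<^sup>2 * real (card (N\<^sub>2 (R + c)))"
  shows "growth_rate N\<^sub>1 \<le> growth_rate N\<^sub>2"
proof (rule dense_ge)
  fix z assume z: "growth_rate N\<^sub>2 < z"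
  then obtain w where w: "growth_rate N\<^sub>2 < w" "w < z" using dense by blast
  have "0 \<le> growth_rate N\<^sub>2" by (rule growth_rate_nonneg[OF ne])
  hence "0 < w" using w(1) by (rule order.strict_trans1)
  with w obtain \<beta> where \<beta>: "w = ereal \<beta>" "\<beta> \<ge> 0" by (cases w) auto
  show "growth_rate N\<^sub>1 \<le> z"
  proof (cases z)
    case (real \<beta>')
    obtain C where C: "\<And>R. R \<ge> 0 \<Longrightarrow> real (card (N\<^sub>2 R)) \<le> C * exp (\<beta> * R)"
      using exp_bounded_of_growth_rate_less[OF w(1)[unfolded \<beta>] \<beta>(2) fin mono] unfolding exp_bounded_def by blast
    have C0: "C \<ge> 0" using C[of 0] by simp
    have "exp_bounded N\<^sub>1 \<beta>'"
    proof (rule exp_bounded_of_poly_exp[OF fin1])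
      fix R :: real assume R: "R \<ge> 0"
      have "real (card (N\<^sub>1 R)) \<le> c * (1 + R)\<^sup>2 * (C * exp (\<beta> * (R + c)))"
        using le[OF R] C[of "R + c"] c R mult_left_mono[of "real (card (N\<^sub>2 (R + c)))" "C * exp (\<beta> * (R + c))" "c * (1 + R)\<^sup>2"]
        by simp
      also have "\<dots> = (c * C * exp (\<beta> * c)) * (1 + R)\<^sup>2 * exp (\<beta> * R)"
        by (simp add: distrib_left exp_add mult_ac)
      finally show "real (card (N\<^sub>1 R)) \<le> (c * C * exp (\<beta> * c)) * (1 + R)\<^sup>2 * exp (\<beta> * R)" .
    qed (use c C0 w \<beta> real in auto)
    thus ?thesis unfolding real by (rule growth_rate_le_of_exp_bounded)
  qed (use z in auto)
qed

corollary growth_rate_le_of_shift: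
  fixes N\<^sub>1 :: "real \<Rightarrow> 'a set" and N\<^sub>2 :: "real \<Rightarrow> 'b set"
  assumes fin: "\<And>R. finite (N\<^sub>2 R)" and mono: "\<And>R R'. R \<le> R' \<Longrightarrow> N\<^sub>2 R \<subseteq> N\<^sub>2 R'"
    and ne: "\<forall>\<^sub>F R in at_top. N\<^sub>2 R \<noteq> {}" and c: "c \<ge> 0"
    and fin1: "\<And>R. finite (N\<^sub>1 R)"
    and le: "\<And>R. card (N\<^sub>1 R) \<le> card (N\<^sub>2 (R + c))"
  shows "growth_rate N\<^sub>1 \<le> growth_rate N\<^sub>2"
proof (rule growth_rate_le_of_card_le[where c = "c + 1"])
  fix R :: real assume R: "R \<ge> 0"
  have "1 * 1 \<le> (c + 1) * (1 + R)\<^sup>2" using c R by (intro mult_mono) auto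
  hence "1 * real (card (N\<^sub>2 (R + (c + 1)))) \<le> (c + 1) * (1 + R)\<^sup>2 * real (card (N\<^sub>2 (R + (c + 1))))"
    by (intro mult_right_mono) auto
  moreover have "card (N\<^sub>2 (R + c)) \<le> card (N\<^sub>2 (R + (c + 1)))"
    by (intro card_mono fin mono) simp
  ultimately show "real (card (N\<^sub>1 R)) \<le> (c + 1) * (1 + R)\<^sup>2 * real (card (N\<^sub>2 (R + (c + 1))))"
    using le[of R] by linarith
qed (use assms in auto)

text \<open>If the growth rate \<open>\<delta>\<close> of \<open>N\<close> exceeded that of \<open>H\<close>, every \<open>\<beta> < \<delta>\<close> above \<open>\<delta> / 2\<close> and above the rate
  of \<open>H\<close> would bound each summand by \<open>e\<close> to the power \<open>\<beta> R\<close>, up to a polynomial factor.\<close>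

lemma growth_rate_le_of_halving:
  fixes N :: "real \<Rightarrow> 'a set" and H :: "real \<Rightarrow> 'b set"
  assumes N: "\<And>R. finite (N R)" "\<And>R R'. R \<le> R' \<Longrightarrow> N R \<subseteq> N R'"
    and H: "\<And>R. finite (H R)" "\<And>R R'. R \<le> R' \<Longrightarrow> H R \<subseteq> H R'" "\<forall>\<^sub>F R in at_top. H R \<noteq> {}"
    and A: "exp_bounded N A" and c: "c \<ge> 0"
    and le: "\<And>R. R \<ge> 0 \<Longrightarrow> real (card (N R)) \<le>
      (\<Sum>k\<le>nat \<lfloor>R + c\<rfloor>. real (card (H (real k + 1))) * (c * (2 + real k)) * real (card (N ((R + c - real k) / 2))))"
  shows "growth_rate N \<le> growth_rate H"
proof (rule ccontr)
  assume "\<not> ?thesis"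
  hence less: "growth_rate H < growth_rate N" by simp
  have h0: "0 \<le> growth_rate H" by (rule growth_rate_nonneg[OF H(3)])
  have "growth_rate N \<le> ereal A" by (rule growth_rate_le_of_exp_bounded[OF A])
  with less h0 obtain \<delta> h where \<delta>: "growth_rate N = ereal \<delta>" and h: "growth_rate H = ereal h" "0 \<le> h" "h < \<delta>"
    by (cases "growth_rate N"; cases "growth_rate H") auto
  \<comment> \<open>Strictly between \<open>max h (\<delta> / 2)\<close> and
    \<open>\<delta>\<close>. Since \<open>2 * \<beta>\<close> exceeds \<open>\<delta>\<close>, the
    ball of radius \<open>(R + c - k) / 2\<close> has size at most a constant times
    \<open>exp (\<beta> * (R + c - k))\<close>, which cancels the growth in \<open>k\<close> of the
    number of classes.\<close>
  define \<beta> where "\<beta> = (max h (\<delta> / 2) + \<delta>) / 2"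
  have \<beta>: "h < \<beta>" "\<delta> < 2 * \<beta>" "\<beta> < \<delta>" "\<beta> > 0" using h by (auto simp: \<beta>_def max_def)
  obtain C where C: "\<And>R. R \<ge> 0 \<Longrightarrow> real (card (H R)) \<le> C * exp (\<beta> * R)"
    using exp_bounded_of_growth_rate_less[of H \<beta>] H \<beta> h unfolding exp_bounded_def by auto
  obtain C' where C': "\<And>R. R \<ge> 0 \<Longrightarrow> real (card (N R)) \<le> C' * exp (2 * \<beta> * R)"
    using exp_bounded_of_growth_rate_less[of N "2 * \<beta>"] N \<beta> \<delta> unfolding exp_bounded_def by auto
  have C0: "C \<ge> 0" "C' \<ge> 0" using C[of 0] C'[of 0] by auto
  define B where "B = C * c * C' * exp (\<beta> * (1 + c))"
  have B0: "B \<ge> 0" unfolding B_def using C0 c by simp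
  define \<beta>' where "\<beta>' = (\<beta> + \<delta>) / 2"
  have "exp_bounded N \<beta>'"
  proof (rule exp_bounded_of_poly_exp)
    fix R :: real assume R: "R \<ge> 0"
    let ?m = "nat \<lfloor>R + c\<rfloor>"
    have "real (card (H (real k + 1))) * (c * (2 + real k)) * real (card (N ((R + c - real k) / 2)))
        \<le> B * (2 + c) * (1 + R) * exp (\<beta> * R)" if "k \<le> ?m" for k
    proof -
      have k: "real k \<le> R + c" using that R c by linarith
      have "real (card (H (real k + 1))) * (c * (2 + real k)) * real (card (N ((R + c - real k) / 2)))
        \<le> (C * exp (\<beta> * (real k + 1))) * (c * (2 + (R + c))) * (C' * exp (2 * \<beta> * ((R + c - real k) / 2)))"
        using C[of "real k + 1"] C'[of "(R + c - real k) / 2"] k c C0 R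
        by (intro mult_mono) auto
      also have "\<dots> = C * c * C' * (2 + c + R) * (exp (\<beta> * (real k + 1)) * exp (\<beta> * (R + c - real k)))"
        by (simp add: mult_ac add_ac)
      also have "exp (\<beta> * (real k + 1)) * exp (\<beta> * (R + c - real k)) = exp (\<beta> * (1 + c)) * exp (\<beta> * R)"
        unfolding exp_add[symmetric] by (rule arg_cong[of _ _ exp]) (simp add: algebra_simps)
      also have "C * c * C' * (2 + c + R) * (exp (\<beta> * (1 + c)) * exp (\<beta> * R)) = B * exp (\<beta> * R) * (2 + c + R)"
        by (simp add: B_def mult_ac)
      also have "\<dots> \<le> B * exp (\<beta> * R) * ((2 + c) * (1 + R))"
        using B0 c R by (intro mult_left_mono) (auto simp: algebra_simps)
      finally show ?thesis by (simp add: mult_ac)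
    qed
    hence "real (card (N R)) \<le> (\<Sum>k\<le>?m. B * (2 + c) * (1 + R) * exp (\<beta> * R))"
      by (intro order_trans[OF le[OF R]] sum_mono) auto
    also have "\<dots> = (real ?m + 1) * (B * (2 + c) * (1 + R) * exp (\<beta> * R))" by simp
    also have "\<dots> \<le> ((1 + c) * (1 + R)) * (B * (2 + c) * (1 + R) * exp (\<beta> * R))"
    proof (rule mult_right_mono)
      have "real ?m \<le> R + c" using R c by linarith
      moreover have "0 \<le> c * R" using R c by simp
      ultimately show "real ?m + 1 \<le> (1 + c) * (1 + R)" by (simp add: algebra_simps)
    qed (use B0 c R in simp)
    also have "\<dots> = (B * (2 + c) * (1 + c)) * (1 + R)\<^sup>2 * exp (\<beta> * R)" by (simp add: power2_eq_square mult_ac)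
    finally show "real (card (N R)) \<le> (B * (2 + c) * (1 + c)) * (1 + R)\<^sup>2 * exp (\<beta> * R)" .
  qed (use N B0 c \<beta> in \<open>auto simp: \<beta>'_def\<close>)
  hence "growth_rate N \<le> ereal \<beta>'" by (rule growth_rate_le_of_exp_bounded)
  thus False using \<delta> \<beta> by (simp add: \<beta>'_def)
qed

section \<open>Counting conjugacy classes\<close>

context length_group begin

definition cls :: "'a \<Rightarrow> 'a set" where
  "cls g = {p \<otimes> g \<otimes> inv p | p. p \<in> carrier G}"

lemma clsI: "p \<in> carrier G \<Longrightarrow> p \<otimes> g \<otimes> inv p \<in> cls g"
  by (auto simp: cls_def)

lemma cls_conj:
  assumes p: "p \<in> carrier G" and g: "g \<in> carrier G"
  shows "cls (p \<otimes> g \<otimes> inv p) = cls g"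
proof (intro equalityI subsetI)
  fix x assume "x \<in> cls (p \<otimes> g \<otimes> inv p)"
  then obtain q where q: "q \<in> carrier G" "x = q \<otimes> (p \<otimes> g \<otimes> inv p) \<otimes> inv q" by (auto simp: cls_def)
  have "x = (q \<otimes> p) \<otimes> g \<otimes> inv (q \<otimes> p)" using p g q by (simp add: inv_mult_group m_assoc)
  thus "x \<in> cls g" using clsI[of "q \<otimes> p" g] p q by simp
next
  fix x assume "x \<in> cls g"
  then obtain q where q: "q \<in> carrier G" "x = q \<otimes> g \<otimes> inv q" by (auto simp: cls_def)
  have "x = (q \<otimes> inv p) \<otimes> (p \<otimes> g \<otimes> inv p) \<otimes> inv (q \<otimes> inv p)"
    using p g q by (simp add: inv_mult_group m_assoc)
  thus "x \<in> cls (p \<otimes> g \<otimes> inv p)" using clsI[of "q \<otimes> inv p" "p \<otimes> g \<otimes> inv p"] p q by simp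
qed

lemma cls_self: "g \<in> carrier G \<Longrightarrow> g \<in> cls g"
  using clsI[of \<one> g] by simp

lemma mem_clsE:
  assumes "g \<in> cls h"
  obtains q where "q \<in> carrier G" "g = q \<otimes> h \<otimes> inv q"
  using assms by (auto simp: cls_def)

lemma card_cls_image_le:
  assumes B: "finite B" and A: "A \<subseteq> carrier G"
    and conj: "\<And>g. g \<in> A \<Longrightarrow> \<exists>p\<in>carrier G. p \<otimes> g \<otimes> inv p \<in> B"
  shows "finite (cls ` A)" "card (cls ` A) \<le> card B"
proof -
  have sub: "cls ` A \<subseteq> cls ` B"
  proof
    fix K assume "K \<in> cls ` A"
    then obtain g where g: "g \<in> A" "K = cls g" by blast
    then obtain p where p: "p \<in> carrier G" "p \<otimes> g \<otimes> inv p \<in> B" using conj by blast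
    have "cls (p \<otimes> g \<otimes> inv p) = K" using cls_conj p(1) g A by auto
    thus "K \<in> cls ` B" using p(2) by blast
  qed
  thus "finite (cls ` A)" using B finite_subset by blast
  have "card (cls ` A) \<le> card (cls ` B)" using sub B by (intro card_mono) auto
  also have "\<dots> \<le> card B" using B by (rule card_image_le)
  finally show "card (cls ` A) \<le> card B" .
qed

end

context hyperbolic_length begin

definition ball :: "real \<Rightarrow> 'a set" where "ball R = {g \<in> carrier G. a g \<le> R}"

definition class_set :: "real \<Rightarrow> 'a set set" where "class_set R = cls ` {g \<in> carrier G. tau g \<le> R}"

lemma finite_abs_ball: "finite (ball R)"
proof -
  obtain k :: nat where "real k \<ge> (R + C\<^sub>2) / C\<^sub>1" using real_arch_simple by blast
  hence k: "R + C\<^sub>2 \<le> C\<^sub>1 * real k" using C\<^sub>1 by (simp add: field_simps)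
  have "ball R \<subseteq> {g \<in> carrier G. len g \<le> k}"
  proof
    fix g assume g: "g \<in> ball R"
    hence "C\<^sub>1 * real (len g) \<le> C\<^sub>1 * real k" using a_lower[of g] k by (simp add: ball_def)
    thus "g \<in> {g \<in> carrier G. len g \<le> k}" using g C\<^sub>1 by (simp add: ball_def)
  qed
  thus ?thesis using finite_ball finite_subset by blast
qed

lemma class_set_le_ball: "\<exists>c\<ge>0. \<forall>R. finite (class_set R) \<and> card (class_set R) \<le> card (ball (R + c))"
proof -
  obtain c where c: "\<And>g. g \<in> carrier G \<Longrightarrow> \<exists>p\<in>carrier G. a (p \<otimes> g \<otimes> inv p) \<le> tau g + c"
    using conjugate_close_to_tau by blast
  have *: "\<exists>p\<in>carrier G. p \<otimes> g \<otimes> inv p \<in> ball (R + max 0 c)" if "g \<in> {g \<in> carrier G. tau g \<le> R}" for g R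
  proof -
    have g: "g \<in> carrier G" using that by simp
    obtain p where p: "p \<in> carrier G" "a (p \<otimes> g \<otimes> inv p) \<le> tau g + c" using bexE[OF c[OF g]] .
    moreover have "c \<le> max 0 c" by simp
    ultimately have "a (p \<otimes> g \<otimes> inv p) \<le> R + max 0 c" using that by (simp only: mem_Collect_eq) linarith
    thus ?thesis using p that by (intro bexI[of _ p]) (auto simp: ball_def)
  qed
  show ?thesis
  proof (intro exI[of _ "max 0 c"] conjI allI)
    show "finite (class_set R)" for R unfolding class_set_def
      by (rule card_cls_image_le(1)[OF finite_abs_ball _ *]) auto
    show "card (class_set R) \<le> card (ball (R + max 0 c))" for R unfolding class_set_def
      by (rule card_cls_image_le(2)[OF finite_abs_ball _ *]) auto
  qed simp
qed

lemma finite_class_set: "finite (class_set R)"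
  using class_set_le_ball by blast

text \<open>The set is chosen once per conjugacy class, through a fixed representative. Choosing it
  per element would leave the union over a class without a bound.\<close>

lemma class_choice:
  obtains c X where "c \<ge> 0" "\<And>g. g \<in> carrier G \<Longrightarrow> finite (X (cls g)) \<and> X (cls g) \<subseteq> carrier G \<and>
      real (card (X (cls g))) \<le> c * (1 + tau g)"
    "\<And>g. g \<in> carrier G \<Longrightarrow> \<exists>p\<in>carrier G. \<exists>s\<in>X (cls g). g = p \<otimes> s \<otimes> inv p \<and>
          a p + a (inv p) + tau g \<le> a g + c"
proof (rule class_decomposition)
  fix c assume c: "c \<ge> 0" and dec: "\<And>g. g \<in> carrier G \<Longrightarrow>
     \<exists>X. finite X \<and> X \<subseteq> carrier G \<and> real (card X) \<le> c * (1 + tau g) \<and>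
       (\<forall>q\<in>carrier G. \<exists>p\<in>carrier G. \<exists>s\<in>X. q \<otimes> g \<otimes> inv q = p \<otimes> s \<otimes> inv p \<and>
          a p + a (inv p) + tau g \<le> a (q \<otimes> g \<otimes> inv q) + c)"
  define P where "P g X \<longleftrightarrow> finite X \<and> X \<subseteq> carrier G \<and> real (card X) \<le> c * (1 + tau g) \<and>
       (\<forall>q\<in>carrier G. \<exists>p\<in>carrier G. \<exists>s\<in>X. q \<otimes> g \<otimes> inv q = p \<otimes> s \<otimes> inv p \<and>
          a p + a (inv p) + tau g \<le> a (q \<otimes> g \<otimes> inv q) + c)" for g X
  define Y where "Y g = (SOME X. P g X)" for g
  have Y: "P g (Y g)" if "g \<in> carrier G" for g
    unfolding Y_def using dec[OF that] unfolding P_def by (rule someI_ex)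
  define rep where "rep K = (SOME g. g \<in> carrier G \<and> cls g = K)" for K
  have rep: "rep (cls g) \<in> carrier G \<and> cls (rep (cls g)) = cls g" if "g \<in> carrier G" for g
    unfolding rep_def by (rule someI_ex) (use that in blast)
  show thesis
  proof (rule that[of c "\<lambda>K. Y (rep K)", OF c])
    fix g assume g: "g \<in> carrier G"
    define h where "h = rep (cls g)"
    have h: "h \<in> carrier G" "cls h = cls g" using rep[OF g] by (auto simp: h_def)
    have "g \<in> cls h" using cls_self[OF g] h by simp
    then obtain q where q: "q \<in> carrier G" "g = q \<otimes> h \<otimes> inv q" by (rule mem_clsE)
    have tau: "tau g = tau h" using tau_conj q h by simp
    have Ph: "P h (Y h)" using Y h by simp
    show "finite (Y (rep (cls g))) \<and> Y (rep (cls g)) \<subseteq> carrier G \<and>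
      real (card (Y (rep (cls g)))) \<le> c * (1 + tau g)"
      using Ph unfolding h_def[symmetric] P_def tau by simp
    have "\<forall>q\<in>carrier G. \<exists>p\<in>carrier G. \<exists>s\<in>Y h. q \<otimes> h \<otimes> inv q = p \<otimes> s \<otimes> inv p \<and>
          a p + a (inv p) + tau h \<le> a (q \<otimes> h \<otimes> inv q) + c" using Ph unfolding P_def by simp
    from bspec[OF this q(1)]
    show "\<exists>p\<in>carrier G. \<exists>s\<in>Y (rep (cls g)). g = p \<otimes> s \<otimes> inv p \<and>
          a p + a (inv p) + tau g \<le> a g + c"
      unfolding h_def[symmetric] tau q(2)[symmetric] .
  qed
qed

text \<open>An element with \<open>tau g\<close> between \<open>k\<close> and \<open>k + 1\<close>
  is recovered from its class, a point \<open>s\<close> of the set of that class, and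
  \<open>p\<close>. By symmetry \<open>p\<close> and \<open>inv p\<close> share equally the length
  left over after \<open>tau g\<close>, so \<open>a p \<le> (R + c - k) / 2\<close>.\<close>

lemma ball_halving:
  assumes sym: "\<And>x. x \<in> carrier G \<Longrightarrow> a (inv x) = a x"
  obtains c where "c \<ge> 0" "\<And>R. R \<ge> 0 \<Longrightarrow> real (card (ball R)) \<le>
      (\<Sum>k\<le>nat \<lfloor>R + c\<rfloor>. real (card (class_set (real k + 1))) * (c * (2 + real k)) * real (card (ball ((R + c - real k) / 2))))"
proof -
  obtain c X where c: "c \<ge> 0" and X: "\<And>g. g \<in> carrier G \<Longrightarrow> finite (X (cls g)) \<and> X (cls g) \<subseteq> carrier G \<and>
      real (card (X (cls g))) \<le> c * (1 + tau g)"
    and dec: "\<And>g. g \<in> carrier G \<Longrightarrow> \<exists>p\<in>carrier G. \<exists>s\<in>X (cls g). g = p \<otimes> s \<otimes> inv p \<and>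
          a p + a (inv p) + tau g \<le> a g + c"
    using class_choice by blast
  show thesis
  proof (rule that[OF c])
    fix R :: real assume R: "R \<ge> 0"
    let ?m = "nat \<lfloor>R + c\<rfloor>"
    define B where "B k = ball ((R + c - real k) / 2)" for k :: nat
    define U where "U k K = (\<lambda>(p, s). p \<otimes> s \<otimes> inv p) ` (B k \<times> X K)" for k K
    have XK: "finite (X K) \<and> real (card (X K)) \<le> c * (2 + real k)" if K: "K \<in> class_set (real k + 1)" for K k
    proof -
      obtain g where g: "g \<in> carrier G" "tau g \<le> real k + 1" "K = cls g" using K by (auto simp: class_set_def)
      have "c * (1 + tau g) \<le> c * (2 + real k)" using g c by (intro mult_left_mono) auto
      thus ?thesis using X[OF g(1)] g(3) by auto
    qed
    have finU: "finite (U k K)" and cardU: "real (card (U k K)) \<le> (c * (2 + real k)) * real (card (B k))"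
      if K: "K \<in> class_set (real k + 1)" for k K
    proof -
      have fin: "finite (B k \<times> X K)" using XK[OF K] finite_abs_ball by (simp add: B_def)
      thus "finite (U k K)" by (simp add: U_def)
      have "real (card (U k K)) \<le> real (card (B k \<times> X K))" unfolding U_def using card_image_le[OF fin] by simp
      also have "\<dots> = real (card (X K)) * real (card (B k))" by (simp add: card_cartesian_product)
      also have "\<dots> \<le> (c * (2 + real k)) * real (card (B k))" using XK[OF K] by (intro mult_right_mono) auto
      finally show "real (card (U k K)) \<le> (c * (2 + real k)) * real (card (B k))" .
    qed
    define V where "V k = (\<Union>K\<in>class_set (real k + 1). U k K)" for k
    have finV: "finite (V k)" for k unfolding V_def using finite_class_set finU by blast
    have cardV: "real (card (V k)) \<le> real (card (class_set (real k + 1))) * (c * (2 + real k)) * real (card (B k))" for k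
    proof -
      have "card (V k) \<le> (\<Sum>K\<in>class_set (real k + 1). card (U k K))" unfolding V_def by (rule card_UN_le[OF finite_class_set])
      hence "real (card (V k)) \<le> (\<Sum>K\<in>class_set (real k + 1). real (card (U k K)))"
        by (simp only: of_nat_sum[symmetric] of_nat_le_iff)
      also have "\<dots> \<le> (\<Sum>K\<in>class_set (real k + 1). (c * (2 + real k)) * real (card (B k)))"
        by (intro sum_mono cardU)
      finally show ?thesis by (simp add: mult.assoc)
    qed
    have "ball R \<subseteq> (\<Union>k\<le>?m. V k)"
    proof
      fix g assume "g \<in> ball R"
      hence g: "g \<in> carrier G" "a g \<le> R" by (auto simp: ball_def)
      define k where "k = nat \<lfloor>tau g\<rfloor>"
      have l0: "0 \<le> tau g" "tau g \<le> a g" using tau_nonneg tau_le g by auto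
      have k: "real k \<le> tau g" "tau g \<le> real k + 1" using l0 unfolding k_def by linarith+
      have km: "k \<le> ?m" using l0 g c unfolding k_def by (intro nat_mono floor_mono) linarith
      obtain p s where ps: "p \<in> carrier G" "s \<in> X (cls g)" "g = p \<otimes> s \<otimes> inv p" "a p + a (inv p) + tau g \<le> a g + c"
        using dec[OF g(1)] by blast
      have "a p \<le> (R + c - real k) / 2" using ps sym[OF ps(1)] g(2) k by simp
      hence "p \<in> B k" using ps(1) by (simp add: B_def ball_def)
      hence "g \<in> U k (cls g)" unfolding U_def using ps by (auto intro!: image_eqI[of _ _ "(p, s)"])
      moreover have "cls g \<in> class_set (real k + 1)" unfolding class_set_def using g k by blast
      ultimately have "g \<in> V k" unfolding V_def by blast
      thus "g \<in> (\<Union>k\<le>?m. V k)" using km by blast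
    qed
    hence "card (ball R) \<le> card (\<Union>k\<le>?m. V k)" using finV by (intro card_mono) auto
    also have "\<dots> \<le> (\<Sum>k\<le>?m. card (V k))" by (rule card_UN_le) simp
    finally have "real (card (ball R)) \<le> (\<Sum>k\<le>?m. real (card (V k)))"
      by (simp only: of_nat_sum[symmetric] of_nat_le_iff)
    also have "\<dots> \<le> (\<Sum>k\<le>?m. real (card (class_set (real k + 1))) * (c * (2 + real k)) * real (card (B k)))"
      by (intro sum_mono cardV)
    finally show "real (card (ball R)) \<le>
      (\<Sum>k\<le>?m. real (card (class_set (real k + 1))) * (c * (2 + real k)) * real (card (ball ((R + c - real k) / 2))))"
      unfolding B_def .
  qed
qed

text \<open>If \<open>a h\<close> exceeds \<open>tau h\<close> by at most \<open>B\<close>, the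
  conjugator has no length left: \<open>a p \<le> B + c\<close>. So \<open>p\<close> ranges over a
  fixed finite ball and \<open>s\<close> over the linear-size set of the class.\<close>

lemma card_nearly_reduced_in_class:
  obtains c where "c \<ge> 0" "\<And>g. g \<in> carrier G \<Longrightarrow> finite {h \<in> cls g. a h \<le> tau h + B}"
    "\<And>g. g \<in> carrier G \<Longrightarrow> real (card {h \<in> cls g. a h \<le> tau h + B}) \<le> c * (1 + tau g)"
proof (rule class_choice)
  fix c X assume c: "c \<ge> 0" and X: "\<And>g. g \<in> carrier G \<Longrightarrow> finite (X (cls g)) \<and> X (cls g) \<subseteq> carrier G \<and>
      real (card (X (cls g))) \<le> c * (1 + tau g)"
    and dec: "\<And>g. g \<in> carrier G \<Longrightarrow> \<exists>p\<in>carrier G. \<exists>s\<in>X (cls g). g = p \<otimes> s \<otimes> inv p \<and>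
          a p + a (inv p) + tau g \<le> a g + c"
  define U where "U g = (\<lambda>(p, s). p \<otimes> s \<otimes> inv p) ` (ball (B + c) \<times> X (cls g))" for g
  have sub: "{h \<in> cls g. a h \<le> tau h + B} \<subseteq> U g" if g: "g \<in> carrier G" for g
  proof
    fix h assume h: "h \<in> {h \<in> cls g. a h \<le> tau h + B}"
    then obtain q where q: "q \<in> carrier G" "h = q \<otimes> g \<otimes> inv q" by (auto elim: mem_clsE)
    have hc: "h \<in> carrier G" "cls h = cls g" using q g cls_conj by auto
    obtain p s where ps: "p \<in> carrier G" "s \<in> X (cls h)" "h = p \<otimes> s \<otimes> inv p" "a p + a (inv p) + tau h \<le> a h + c"
      using dec[OF hc(1)] by blast
    have "a p \<le> B + c" using ps(4) h a_nonneg[of "inv p"] ps(1) by simp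
    hence "p \<in> ball (B + c)" using ps(1) by (simp add: ball_def)
    thus "h \<in> U g" unfolding U_def using ps hc by (auto intro!: image_eqI[of _ _ "(p, s)"])
  qed
  have fin: "finite (ball (B + c) \<times> X (cls g))" if "g \<in> carrier G" for g
    using X[OF that] finite_abs_ball by simp
  have finU: "finite (U g)" if "g \<in> carrier G" for g unfolding U_def using fin[OF that] by simp
  show thesis
  proof (rule that[of "real (card (ball (B + c))) * c"])
    fix g assume g: "g \<in> carrier G"
    show "finite {h \<in> cls g. a h \<le> tau h + B}" using finite_subset[OF sub[OF g] finU[OF g]] .
    have "card {h \<in> cls g. a h \<le> tau h + B} \<le> card (U g)" by (rule card_mono[OF finU[OF g] sub[OF g]])
    also have "\<dots> \<le> card (ball (B + c) \<times> X (cls g))" unfolding U_def by (rule card_image_le[OF fin[OF g]])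
    also have "\<dots> = card (ball (B + c)) * card (X (cls g))" by (rule card_cartesian_product)
    finally have "real (card {h \<in> cls g. a h \<le> tau h + B}) \<le> real (card (ball (B + c))) * real (card (X (cls g)))"
      by (simp only: of_nat_mult[symmetric] of_nat_le_iff)
    also have "\<dots> \<le> real (card (ball (B + c))) * (c * (1 + tau g))" using X[OF g] by (intro mult_left_mono) auto
    finally show "real (card {h \<in> cls g. a h \<le> tau h + B}) \<le> real (card (ball (B + c))) * c * (1 + tau g)"
      by (simp add: mult.assoc)
  qed (use c in simp)
qed

section \<open>Exponential growth of balls and comparison of rates\<close>

lemma ball_mono: "R \<le> R' \<Longrightarrow> ball R \<subseteq> ball R'" and class_set_mono: "R \<le> R' \<Longrightarrow> class_set R \<subseteq> class_set R'"
  by (auto simp: ball_def class_set_def)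

lemma eventually_ball_nonempty: "\<forall>\<^sub>F R in at_top. ball R \<noteq> {}"
  using eventually_ge_at_top[of "a \<one>"] by eventually_elim (auto simp: ball_def)

lemma eventually_class_set_nonempty: "\<forall>\<^sub>F R in at_top. class_set R \<noteq> {}"
  using eventually_ge_at_top[of "tau \<one>"] by eventually_elim (auto simp: class_set_def)

lemma card_len_ball_le:
  "card {x \<in> carrier G. len x \<le> k} \<le> card {x \<in> carrier G. len x \<le> 1} ^ k"
proof (induction k)
  case 0
  have "{x \<in> carrier G. len x \<le> 0} = {\<one>}" using len_eq_0_iff by auto
  thus ?case by simp
next
  case (Suc k)
  let ?B = "\<lambda>k. {x \<in> carrier G. len x \<le> k}"
  have "?B (Suc k) \<subseteq> (\<lambda>(y, z). y \<otimes> z) ` (?B k \<times> ?B 1)"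
  proof
    fix x assume x: "x \<in> ?B (Suc k)"
    show "x \<in> (\<lambda>(y, z). y \<otimes> z) ` (?B k \<times> ?B 1)"
    proof (cases "len x \<le> k")
      case True
      thus ?thesis using x by (auto intro!: image_eqI[of _ _ "(x, \<one>)"])
    next
      case False
      hence "len x = Suc k" using x by simp
      then obtain y z where "y \<in> carrier G" "z \<in> carrier G" "x = y \<otimes> z" "len y = k" "len z = 1"
        using len_split[of x k] x by blast
      thus ?thesis by (auto intro!: image_eqI[of _ _ "(y, z)"])
    qed
  qed
  hence "card (?B (Suc k)) \<le> card ((\<lambda>(y, z). y \<otimes> z) ` (?B k \<times> ?B 1))"
    using finite_ball by (intro card_mono) auto
  also have "\<dots> \<le> card (?B k \<times> ?B 1)" using finite_ball by (intro card_image_le) auto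
  also have "\<dots> = card (?B k) * card (?B 1)" by (rule card_cartesian_product)
  also have "\<dots> \<le> card (?B 1) ^ k * card (?B 1)" using Suc by simp
  finally show ?case by (simp add: mult.commute)
qed

text \<open>A crude bound by counting words. The halving argument compares real rates and must know
  beforehand that the rate of balls is not infinite.\<close>

lemma exp_bounded_ball: "\<exists>A. exp_bounded ball A"
proof -
  define s where "s = real (card {x \<in> carrier G. len x \<le> 1})"
  have "\<one> \<in> {x \<in> carrier G. len x \<le> 1}" by simp
  hence "card {x \<in> carrier G. len x \<le> 1} \<ge> 1" using finite_ball[of 1] by (metis One_nat_def Suc_leI card_gt_0_iff empty_iff)
  hence s: "s \<ge> 1" by (simp add: s_def)
  define A where "A = ln s / C\<^sub>1"
  have "real (card (ball R)) \<le> s * exp (A * \<bar>C\<^sub>2\<bar>) * exp (A * R)" if R: "R \<ge> 0" for R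
  proof -
    define k where "k = nat \<lceil>(R + \<bar>C\<^sub>2\<bar>) / C\<^sub>1\<rceil>"
    have q: "0 \<le> (R + \<bar>C\<^sub>2\<bar>) / C\<^sub>1" using R C\<^sub>1 by simp
    have k: "(R + \<bar>C\<^sub>2\<bar>) / C\<^sub>1 \<le> real k" "real k \<le> (R + \<bar>C\<^sub>2\<bar>) / C\<^sub>1 + 1" using q unfolding k_def by linarith+
    have "R + \<bar>C\<^sub>2\<bar> \<le> C\<^sub>1 * real k" using k(1) C\<^sub>1 by (simp add: field_simps)
    have "ball R \<subseteq> {x \<in> carrier G. len x \<le> k}"
    proof
      fix g assume g: "g \<in> ball R"
      hence "C\<^sub>1 * real (len g) \<le> C\<^sub>1 * real k"
        using a_lower[of g] \<open>R + \<bar>C\<^sub>2\<bar> \<le> C\<^sub>1 * real k\<close> abs_ge_self[of C\<^sub>2] by (simp add: ball_def)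
      thus "g \<in> {g \<in> carrier G. len g \<le> k}" using g C\<^sub>1 by (simp add: ball_def)
    qed
    hence "card (ball R) \<le> card {x \<in> carrier G. len x \<le> k}" using finite_ball by (intro card_mono) auto
    also note card_len_ball_le[of k]
    finally have "real (card (ball R)) \<le> s ^ k" unfolding s_def of_nat_power[symmetric] by (rule of_nat_mono)
    also have "s ^ k = exp (ln s * real k)" using s by (simp add: exp_of_nat2_mult)
    also have "\<dots> \<le> exp (ln s * ((R + \<bar>C\<^sub>2\<bar>) / C\<^sub>1 + 1))" using k(2) s by (simp add: mult_left_mono)
    also have "ln s * ((R + \<bar>C\<^sub>2\<bar>) / C\<^sub>1 + 1) = ln s + A * \<bar>C\<^sub>2\<bar> + A * R"
      by (simp add: A_def add_divide_distrib algebra_simps)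
    also have "exp \<dots> = s * exp (A * \<bar>C\<^sub>2\<bar>) * exp (A * R)" using s by (simp add: exp_add)
    finally show ?thesis .
  qed
  thus ?thesis unfolding exp_bounded_def using finite_abs_ball by blast
qed

theorem growth_class_set_le_ball: "growth_rate class_set \<le> growth_rate ball"
proof -
  obtain c where c: "c \<ge> 0" "\<forall>R. finite (class_set R) \<and> card (class_set R) \<le> card (ball (R + c))"
    using class_set_le_ball by blast
  show ?thesis
    by (rule growth_rate_le_of_shift[OF finite_abs_ball ball_mono eventually_ball_nonempty c(1)]) (use c(2) in auto)
qed

lemma a_upper: "\<exists>M\<ge>0. \<forall>x\<in>carrier G. a x \<le> M * (1 + real (len x))"
proof -
  obtain M where M: "M \<ge> 0" "\<And>x. x \<in> carrier G \<Longrightarrow> len x \<le> 1 \<Longrightarrow> a x \<le> M"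
    using a_bounded_on_balls by blast
  have "x \<in> carrier G \<Longrightarrow> len x = k \<Longrightarrow> a x \<le> M * (1 + real k)" for x k
  proof (induction k arbitrary: x)
    case 0
    thus ?case using M(2)[of x] by simp
  next
    case (Suc k)
    obtain y z where yz: "y \<in> carrier G" "z \<in> carrier G" "x = y \<otimes> z" "len y = k" "len z = 1"
      using len_split[OF Suc.prems] by blast
    have "a x \<le> a y + a z" using a_mult yz by simp
    also have "\<dots> \<le> M * (1 + real k) + M" using Suc.IH[OF yz(1,4)] M(2)[of z] yz by simp
    finally show ?case by (simp add: algebra_simps)
  qed
  thus ?thesis using M(1) by blast
qed

theorem growth_ball_le_class_set:
  assumes sym: "\<And>x. x \<in> carrier G \<Longrightarrow> a (inv x) = a x"
  shows "growth_rate ball \<le> growth_rate class_set"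
proof -
  obtain A where A: "exp_bounded ball A" using exp_bounded_ball by blast
  obtain c where c: "c \<ge> 0" "\<And>R. R \<ge> 0 \<Longrightarrow> real (card (ball R)) \<le>
      (\<Sum>k\<le>nat \<lfloor>R + c\<rfloor>. real (card (class_set (real k + 1))) * (c * (2 + real k)) * real (card (ball ((R + c - real k) / 2))))"
    using ball_halving[OF sym] by blast
  show ?thesis
    by (rule growth_rate_le_of_halving[OF finite_abs_ball ball_mono finite_class_set class_set_mono
          eventually_class_set_nonempty A c])
qed

text \<open>The four-point inequalities for x, y, z and for their inverses in reverse order are
  multiplied. The two mixed terms keep one factor \<open>q\<close>, since \<open>A \<le> E\<close>
  and \<open>A' \<le> E'\<close>, and the last has \<open>q\<^sup>2 \<le> q\<close>; this accounts
  for \<open>2 * K + K\<^sup>2\<close> with the same \<open>C\<close>.\<close>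

lemma hyperbolic_length_symmetrized:
  "hyperbolic_length G len (\<lambda>x. a x + a (inv x)) (\<lambda>x. tau x + tau (inv x)) (2 * K + K\<^sup>2) C C\<^sub>1 C\<^sub>2"
proof unfold_locales
  show "0 < 2 * K + K\<^sup>2" using K by (simp add: add_pos_pos)
  show "0 < C" "0 < C\<^sub>1" by (rule C, rule C\<^sub>1)
next
  fix x assume x: "x \<in> carrier G"
  show "0 \<le> a x + a (inv x)" using a_nonneg x by simp
  show "C\<^sub>1 * real (len x) - C\<^sub>2 \<le> a x + a (inv x)" using a_lower[OF x] a_nonneg[of "inv x"] x by simp
  show "0 \<le> tau x + tau (inv x)" using tau_nonneg x by simp
  show "tau x + tau (inv x) \<le> a x + a (inv x)" using tau_le x by (simp add: add_mono)
  fix u assume u: "tau x + tau (inv x) < u"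
  define e where "e = (u - (tau x + tau (inv x))) / 2"
  have "e > 0" using u by (simp add: e_def)
  obtain c where c: "\<And>k. a (x [^] k) \<le> c + (tau x + e) * real k"
    using tau_growth[OF x, of "tau x + e"] \<open>e > 0\<close> by auto
  obtain c' where c': "\<And>k. a (inv x [^] k) \<le> c' + (tau (inv x) + e) * real k"
    using tau_growth[of "inv x" "tau (inv x) + e"] x \<open>e > 0\<close> by auto
  have "a (x [^] k) + a (inv (x [^] k)) \<le> (c + c') + u * real k" for k :: nat
  proof -
    have "(tau x + e) * real k + (tau (inv x) + e) * real k = u * real k"
      by (simp add: e_def field_simps)
    moreover have "inv (x [^] k) = inv x [^] k" using x by (simp add: nat_pow_inv)
    ultimately show ?thesis using c[of k] c'[of k] by simp
  qed
  thus "\<exists>c. \<forall>k. a (x [^] k) + a (inv (x [^] k)) \<le> c + u * real k" by blast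
next
  fix x y assume xy: "x \<in> carrier G" "y \<in> carrier G"
  show "a (x \<otimes> y) + a (inv (x \<otimes> y)) \<le> a x + a (inv x) + (a y + a (inv y))"
    using a_mult[OF xy] a_mult[of "inv y" "inv x"] xy by (simp add: inv_mult_group)
  have "inv (x \<otimes> y \<otimes> inv x) = x \<otimes> inv y \<otimes> inv x" using xy by (simp add: inv_mult_group m_assoc)
  thus "tau (x \<otimes> y \<otimes> inv x) + tau (inv (x \<otimes> y \<otimes> inv x)) = tau y + tau (inv y)"
    using tau_conj[of x y] tau_conj[of x "inv y"] xy by simp
  fix z assume z: "z \<in> carrier G"
  define A where "A = exp (a (x \<otimes> y \<otimes> z) + a y)"
  define A' where "A' = exp (a (inv (x \<otimes> y \<otimes> z)) + a (inv y))"
  define E where "E = exp (a x + a z + 2 * a y)"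
  define E' where "E' = exp (a (inv x) + a (inv z) + 2 * a (inv y))"
  define q where "q = exp (- C * real (len y))"
  have q: "0 < q" "q \<le> 1" unfolding q_def using C by auto
  have 1: "exp (a (x \<otimes> y) + a (y \<otimes> z)) \<le> A + K * (E * q)"
    using a_four[OF xy z] by (simp add: A_def E_def q_def exp_add[symmetric])
  have 2: "exp (a (inv (x \<otimes> y)) + a (inv (y \<otimes> z))) \<le> A' + K * (E' * q)"
  proof -
    have "inv (x \<otimes> y \<otimes> z) = inv z \<otimes> inv y \<otimes> inv x" using xy z by (simp add: inv_mult_group m_assoc)
    thus ?thesis using a_four[of "inv z" "inv y" "inv x"] xy z len_inv[of y]
      by (simp add: A'_def E'_def q_def exp_add[symmetric] inv_mult_group add_ac add_diff_eq)
  qed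
  have "a (x \<otimes> y \<otimes> z) \<le> a x + a y + a z" using a_mult[of "x \<otimes> y" z] a_mult[of x y] xy z by simp
  hence AE: "A \<le> E" by (simp add: A_def E_def)
  have "a (inv (x \<otimes> y \<otimes> z)) \<le> a (inv x) + a (inv y) + a (inv z)"
    using a_mult[of "inv z \<otimes> inv y" "inv x"] a_mult[of "inv z" "inv y"] xy z by (simp add: inv_mult_group m_assoc)
  hence AE': "A' \<le> E'" by (simp add: A'_def E'_def)
  have pos: "0 < A" "0 < A'" "0 < E" "0 < E'" by (simp_all add: A_def A'_def E_def E'_def)
  have "exp (a (x \<otimes> y) + a (y \<otimes> z)) * exp (a (inv (x \<otimes> y)) + a (inv (y \<otimes> z))) \<le> (A + K * (E * q)) * (A' + K * (E' * q))"
    using 1 2 pos q K by (intro mult_mono) auto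
  also have "\<dots> = A * A' + (A * E' * (K * q) + A' * E * (K * q) + (E * E' * q) * (K\<^sup>2 * q))"
    by (simp add: algebra_simps power2_eq_square)
  also have "\<dots> \<le> A * A' + (E * E' * (K * q) + E' * E * (K * q) + (E * E' * q) * (K\<^sup>2 * 1))"
    using AE AE' pos q K by (intro add_mono mult_mono order_refl) auto
  also have "\<dots> = A * A' + (2 * K + K\<^sup>2) * (E * E' * q)" by (simp add: algebra_simps)
  finally show "exp (a (x \<otimes> y) + a (inv (x \<otimes> y)) + (a (y \<otimes> z) + a (inv (y \<otimes> z))))
     \<le> exp (a (x \<otimes> y \<otimes> z) + a (inv (x \<otimes> y \<otimes> z)) + (a y + a (inv y))) +
        (2 * K + K\<^sup>2) * exp (a x + a (inv x) + (a z + a (inv z)) + 2 * (a y + a (inv y)) - C * real (len y))"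
    by (simp add: A_def A'_def E_def E'_def q_def exp_add[symmetric] algebra_simps)
qed

end

section \<open>Word length in matrix groups\<close>

definition matrix_group :: "nat \<Rightarrow> real mat set \<Rightarrow> real mat monoid" where
  "matrix_group n \<Gamma> = \<lparr>carrier = \<Gamma>, monoid.mult = (*), one = 1\<^sub>m n\<rparr>"

lemma matrix_group_simps [simp]:
  "carrier (matrix_group n \<Gamma>) = \<Gamma>" "x \<otimes>\<^bsub>matrix_group n \<Gamma>\<^esub> y = x * y" "\<one>\<^bsub>matrix_group n \<Gamma>\<^esub> = 1\<^sub>m n"
  by (simp_all add: matrix_group_def)

locale matrix_subgroup =
  fixes n :: nat and \<Gamma> :: "real mat set"
  assumes sub: "subgroup_SL n \<Gamma>"
begin

abbreviation "G \<equiv> matrix_group n \<Gamma>"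

lemma mem_SL: "g \<in> \<Gamma> \<Longrightarrow> g \<in> SL n"
  using sub by (auto simp: subgroup_SL_def)

lemma mem_carrier: "g \<in> \<Gamma> \<Longrightarrow> g \<in> carrier_mat n n"
  using mem_SL by (auto simp: SL_def)

sublocale group G
proof (rule groupI)
  fix x assume x: "x \<in> carrier G"
  then obtain y where y: "y \<in> \<Gamma>" "x * y = 1\<^sub>m n" using sub by (auto simp: subgroup_SL_def)
  hence "y * x = 1\<^sub>m n" using mat_mult_left_right_inverse[OF mem_carrier mem_carrier] x by simp
  thus "\<exists>y\<in>carrier G. y \<otimes>\<^bsub>G\<^esub> x = \<one>\<^bsub>G\<^esub>" using y by auto
next
  fix x assume "x \<in> carrier G"
  thus "\<one>\<^bsub>G\<^esub> \<otimes>\<^bsub>G\<^esub> x = x" using mem_carrier[of x] by simp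
next
  fix x y z assume "x \<in> carrier G" "y \<in> carrier G" "z \<in> carrier G"
  thus "x \<otimes>\<^bsub>G\<^esub> y \<otimes>\<^bsub>G\<^esub> z = x \<otimes>\<^bsub>G\<^esub> (y \<otimes>\<^bsub>G\<^esub> z)"
    using assoc_mult_mat[OF mem_carrier mem_carrier mem_carrier] by simp
qed (use sub in \<open>auto simp: subgroup_SL_def\<close>)

lemma inverse_props:
  assumes "g \<in> \<Gamma>"
  shows "inv\<^bsub>G\<^esub> g \<in> \<Gamma>" "g * inv\<^bsub>G\<^esub> g = 1\<^sub>m n" "inv\<^bsub>G\<^esub> g * g = 1\<^sub>m n"
  using inv_closed[of g] r_inv[of g] l_inv[of g] assms by simp_all

lemma pow_eq: "g \<in> \<Gamma> \<Longrightarrow> g [^]\<^bsub>G\<^esub> (k::nat) = g ^\<^sub>m k"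
proof (induction k)
  case 0
  thus ?case using mem_carrier[of g] by simp
next
  case (Suc k)
  thus ?case by simp
qed

lemma inv_unique_right: "g \<in> \<Gamma> \<Longrightarrow> h \<in> \<Gamma> \<Longrightarrow> g * h = 1\<^sub>m n \<Longrightarrow> h = inv\<^bsub>G\<^esub> g"
  using inv_unique'[of g h] inv_equality[of h g] mat_mult_left_right_inverse[OF mem_carrier mem_carrier, of g h]
  by simp

end

locale generated_matrix_subgroup = matrix_subgroup +
  fixes S :: "real mat set"
  assumes finS: "finite S" and gen: "generates n \<Gamma> S"
begin

abbreviation "L \<equiv> letters n \<Gamma> S"
abbreviation "prodw xs \<equiv> foldr (*) xs (1\<^sub>m n :: real mat)"
abbreviation "wl \<equiv> word_length n \<Gamma> S"

lemma letters_subset: "L \<subseteq> \<Gamma>"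
  using gen by (auto simp: letters_def generates_def)

lemma finite_letters: "finite L"
proof -
  have "L \<subseteq> S \<union> (\<lambda>g. inv\<^bsub>G\<^esub> g) ` S"
    using gen inv_unique_right by (auto simp: letters_def generates_def)
  thus ?thesis using finS finite_subset by blast
qed

lemma letters_inv: "x \<in> L \<Longrightarrow> inv\<^bsub>G\<^esub> x \<in> L"
proof -
  assume x: "x \<in> L"
  show "inv\<^bsub>G\<^esub> x \<in> L"
  proof (cases "x \<in> S")
    case True
    hence "x \<in> \<Gamma>" using gen by (auto simp: generates_def)
    thus ?thesis using inverse_props True by (auto simp: letters_def)
  next
    case False
    then obtain s where s: "x \<in> \<Gamma>" "s \<in> S" "s * x = 1\<^sub>m n" using x by (auto simp: letters_def)
    hence sG: "s \<in> \<Gamma>" using gen by (auto simp: generates_def)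
    have "x = inv\<^bsub>G\<^esub> s" using inv_unique_right[OF sG s(1,3)] .
    hence "inv\<^bsub>G\<^esub> x = s" using inv_inv[of s] sG by simp
    thus ?thesis using s by (simp add: letters_def)
  qed
qed

lemma prodw_closed: "set xs \<subseteq> L \<Longrightarrow> prodw xs \<in> \<Gamma>"
  using letters_subset one_closed m_closed by (induction xs) auto

lemma prodw_append:
  "set xs \<subseteq> L \<Longrightarrow> set ys \<subseteq> L \<Longrightarrow> prodw (xs @ ys) = prodw xs * prodw ys"
proof (induction xs)
  case Nil
  thus ?case using mem_carrier[OF prodw_closed[of ys]] by simp
next
  case (Cons x xs)
  have "x \<in> \<Gamma>" "prodw xs \<in> \<Gamma>" "prodw ys \<in> \<Gamma>" using Cons.prems prodw_closed letters_subset by auto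
  thus ?case using Cons assoc_mult_mat[OF mem_carrier mem_carrier mem_carrier] by simp
qed

lemma prodw_inv: "set xs \<subseteq> L \<Longrightarrow> prodw (rev (map (\<lambda>g. inv\<^bsub>G\<^esub> g) xs)) = inv\<^bsub>G\<^esub> (prodw xs)"
proof (induction xs)
  case Nil
  thus ?case using inv_one by simp
next
  case (Cons x xs)
  have cs: "x \<in> \<Gamma>" "prodw xs \<in> \<Gamma>" "inv\<^bsub>G\<^esub> x \<in> \<Gamma>" using Cons.prems prodw_closed letters_subset inverse_props by auto
  have "prodw (rev (map (\<lambda>g. inv\<^bsub>G\<^esub> g) (x # xs))) = prodw (rev (map (\<lambda>g. inv\<^bsub>G\<^esub> g) xs)) * prodw [inv\<^bsub>G\<^esub> x]"
    using prodw_append[of "rev (map (\<lambda>g. inv\<^bsub>G\<^esub> g) xs)" "[inv\<^bsub>G\<^esub> x]"] Cons.prems letters_inv by auto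
  also have "\<dots> = inv\<^bsub>G\<^esub> (prodw xs) * inv\<^bsub>G\<^esub> x" using Cons mem_carrier[OF cs(3)] by simp
  also have "\<dots> = inv\<^bsub>G\<^esub> (x * prodw xs)" using inv_mult_group[of x "prodw xs"] cs by simp
  finally show ?case by simp
qed

lemma wl_le: "set xs \<subseteq> L \<Longrightarrow> wl (prodw xs) \<le> length xs"
  unfolding word_length_def is_word_def by (intro Least_le) auto

lemma wl_word:
  assumes "g \<in> \<Gamma>"
  obtains xs where "set xs \<subseteq> L" "g = prodw xs" "length xs = wl g"
proof -
  have "\<exists>k xs. length xs = k \<and> is_word n \<Gamma> S xs g" using gen assms by (auto simp: generates_def)
  from LeastI_ex[OF this] obtain xs where "length xs = wl g" "is_word n \<Gamma> S xs g"
    unfolding word_length_def by blast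
  thus thesis using that by (auto simp: is_word_def)
qed

sublocale length_group G wl
proof unfold_locales
  fix x assume "x \<in> carrier G"
  hence x: "x \<in> \<Gamma>" by simp
  obtain xs where xs: "set xs \<subseteq> L" "x = prodw xs" "length xs = wl x" using wl_word[OF x] .
  show "wl x = 0 \<longleftrightarrow> x = \<one>\<^bsub>G\<^esub>" using xs wl_le[of "[]"] by auto
  have le: "wl (inv\<^bsub>G\<^esub> y) \<le> wl y" if y: "y \<in> \<Gamma>" for y
  proof -
    obtain ys where ys: "set ys \<subseteq> L" "y = prodw ys" "length ys = wl y" using wl_word[OF y] .
    show ?thesis using wl_le[of "rev (map (\<lambda>g. inv\<^bsub>G\<^esub> g) ys)"] letters_inv ys prodw_inv by auto
  qed
  have "inv\<^bsub>G\<^esub> (inv\<^bsub>G\<^esub> x) = x" using inv_inv[of x] x by simp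
  thus "wl (inv\<^bsub>G\<^esub> x) = wl x" using le[OF x] le[OF inverse_props(1)[OF x]] by simp
  fix k assume k: "wl x = Suc k"
  \<comment> \<open>Cutting the last letter off a shortest word leaves pieces of length at most
    \<open>k\<close> and at most 1. Neither can be shorter, or shortest words for the pieces would
    concatenate to a shorter word for \<open>x\<close>.\<close>
  then obtain ys z where yz: "xs = ys @ [z]" using xs by (cases xs rule: rev_cases) auto
  have L: "set ys \<subseteq> L" "z \<in> L" using xs yz by auto
  have zc: "z \<in> \<Gamma>" using L letters_subset by auto
  have z1: "prodw [z] = z" using mem_carrier[OF zc] by simp
  have eq: "x = prodw ys * z" using prodw_append[of ys "[z]"] L xs(2) yz z1 by simp
  have ly: "wl (prodw ys) \<le> k" using wl_le[OF L(1)] xs(3) k yz by simp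
  have lz: "wl z \<le> 1" using wl_le[of "[z]"] L z1 by simp
  obtain us where us: "set us \<subseteq> L" "prodw ys = prodw us" "length us = wl (prodw ys)" using wl_word[OF prodw_closed[OF L(1)]] .
  obtain vs where vs: "set vs \<subseteq> L" "z = prodw vs" "length vs = wl z" using wl_word[OF zc] .
  have "x = prodw (us @ vs)" using prodw_append[OF us(1) vs(1)] eq us(2) vs(2) by simp
  hence "Suc k \<le> wl (prodw ys) + wl z" using wl_le[of "us @ vs"] us vs k by simp
  hence "wl (prodw ys) = k" "wl z = 1" using ly lz by auto
  thus "\<exists>y\<in>carrier G. \<exists>z\<in>carrier G. x = y \<otimes>\<^bsub>G\<^esub> z \<and> wl y = k \<and> wl z = 1"
    using eq prodw_closed[OF L(1)] zc by auto
next
  fix x y assume "x \<in> carrier G" "y \<in> carrier G"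
  hence xy: "x \<in> \<Gamma>" "y \<in> \<Gamma>" by auto
  obtain xs where xs: "set xs \<subseteq> L" "x = prodw xs" "length xs = wl x" using wl_word[OF xy(1)] .
  obtain ys where ys: "set ys \<subseteq> L" "y = prodw ys" "length ys = wl y" using wl_word[OF xy(2)] .
  have "wl (prodw (xs @ ys)) \<le> length (xs @ ys)" by (rule wl_le) (use xs ys in auto)
  thus "wl (x \<otimes>\<^bsub>G\<^esub> y) \<le> wl x + wl y" using prodw_append[OF xs(1) ys(1)] xs ys by simp
next
  fix k
  have "{x \<in> carrier G. wl x \<le> k} \<subseteq> prodw ` {xs. set xs \<subseteq> L \<and> length xs \<le> k}"
  proof
    fix x assume x: "x \<in> {x \<in> carrier G. wl x \<le> k}"
    then obtain xs where "set xs \<subseteq> L" "x = prodw xs" "length xs = wl x" using wl_word[of x] by auto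
    thus "x \<in> prodw ` {xs. set xs \<subseteq> L \<and> length xs \<le> k}" using x by auto
  qed
  thus "finite {x \<in> carrier G. wl x \<le> k}"
    using finite_subset finite_lists_length_le[OF finite_letters] by blast
qed

lemma conj_class_eq_cls:
  assumes g: "g \<in> \<Gamma>"
  shows "conj_class n \<Gamma> g = cls g"
proof (intro equalityI subsetI)
  fix x assume "x \<in> conj_class n \<Gamma> g"
  then obtain d d' where d: "x = d * g * d'" "d \<in> \<Gamma>" "d' \<in> \<Gamma>" "d * d' = 1\<^sub>m n"
    unfolding conj_class_def by blast
  have "d' = inv\<^bsub>G\<^esub> d" by (rule inv_unique_right[OF d(2-4)])
  thus "x \<in> cls g" using clsI[of d g] d by simp
next
  fix x assume "x \<in> cls g"
  then obtain p where p: "p \<in> carrier G" "x = p \<otimes>\<^bsub>G\<^esub> g \<otimes>\<^bsub>G\<^esub> inv\<^bsub>G\<^esub> p" by (rule mem_clsE)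
  hence "p \<in> \<Gamma>" "x = p * g * inv\<^bsub>G\<^esub> p" by simp_all
  thus "x \<in> conj_class n \<Gamma> g" unfolding conj_class_def using inverse_props[of p] by blast
qed

end

section \<open>Projective Anosov subgroups\<close>

locale anosov_subgroup = generated_matrix_subgroup +
  fixes C C' :: real
  assumes n2: "n \<ge> 2" and C: "C > 0" and C': "C' > 0"
    and gap: "g \<in> \<Gamma> \<Longrightarrow> C * real (wl g) - C' \<le> mu 1 g - mu 2 g"
begin

definition c\<^sub>0 :: real where "c\<^sub>0 = ln (2 * real n ^ 10)"

definition lnorm :: "real mat \<Rightarrow> real" where "lnorm g = ln (mnorm n g)"

definition lnorm2 :: "real mat \<Rightarrow> real" where "lnorm2 g = ln (mnorm2 n g)"

definition lrad :: "real mat \<Rightarrow> real" where "lrad g = ln (eig_moduli g ! 0)"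

text \<open>Logarithm of the spectral radius on the exterior square.\<close>

definition lrad2 :: "real mat \<Rightarrow> real" where "lrad2 g = ln (eig_moduli g ! 0 * eig_moduli g ! 1)"

lemma c\<^sub>0_nonneg: "c\<^sub>0 \<ge> 0"
proof -
  have "1 \<le> real n ^ 10" using n2 by simp
  thus ?thesis by (simp add: c\<^sub>0_def)
qed

lemma mnorm_ge_1: "g \<in> \<Gamma> \<Longrightarrow> 1 \<le> mnorm n g" and mnorm2_ge_1: "g \<in> \<Gamma> \<Longrightarrow> 1 \<le> mnorm2 n g"
  using mnorm_SL[OF mem_SL n2] by auto

lemma exp_lnorm: "g \<in> \<Gamma> \<Longrightarrow> exp (lnorm g) = mnorm n g"
  and exp_lnorm2: "g \<in> \<Gamma> \<Longrightarrow> exp (lnorm2 g) = mnorm2 n g"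
  using mnorm_ge_1[of g] mnorm2_ge_1[of g] by (auto simp: lnorm_def lnorm2_def)

lemma eig_pos: "g \<in> \<Gamma> \<Longrightarrow> i < n \<Longrightarrow> 0 < eig_moduli g ! i"
  using eig_moduli_SL(1)[OF mem_SL n2] .

lemma lnorm_nonneg: "g \<in> \<Gamma> \<Longrightarrow> 0 \<le> lnorm g" and lnorm2_nonneg: "g \<in> \<Gamma> \<Longrightarrow> 0 \<le> lnorm2 g"
  using mnorm_ge_1[of g] mnorm2_ge_1[of g] by (auto simp: lnorm_def lnorm2_def)

lemma mu_lnorm: "g \<in> \<Gamma> \<Longrightarrow> \<bar>mu 1 g - lnorm g\<bar> \<le> c\<^sub>0"
  and mu_lnorm2: "g \<in> \<Gamma> \<Longrightarrow> \<bar>mu 1 g + mu 2 g - lnorm2 g\<bar> \<le> c\<^sub>0"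
  using mu_estimates(1,2)[OF n2, of g] mem_SL[of g] by (auto simp: lnorm_def lnorm2_def c\<^sub>0_def)

lemma mu_n_lnorm: "g \<in> \<Gamma> \<Longrightarrow> \<bar>mu n g + lnorm (inv\<^bsub>G\<^esub> g)\<bar> \<le> c\<^sub>0"
  using mu_estimates(3)[OF n2, of g "inv\<^bsub>G\<^esub> g"] mem_SL inverse_props[of g] by (simp add: lnorm_def c\<^sub>0_def)

lemma lnorm_mult: "g \<in> \<Gamma> \<Longrightarrow> h \<in> \<Gamma> \<Longrightarrow> lnorm (g * h) \<le> lnorm g + lnorm h"
  and lnorm2_mult: "g \<in> \<Gamma> \<Longrightarrow> h \<in> \<Gamma> \<Longrightarrow> lnorm2 (g * h) \<le> lnorm2 g + lnorm2 h"
proof -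
  assume gh: "g \<in> \<Gamma>" "h \<in> \<Gamma>"
  have gh': "g * h \<in> \<Gamma>" using m_closed[of g h] gh by simp
  have "exp (lnorm (g * h)) \<le> exp (lnorm g + lnorm h)"
    using mnorm_mult[OF mem_carrier mem_carrier] gh gh' by (simp add: exp_add exp_lnorm)
  thus "lnorm (g * h) \<le> lnorm g + lnorm h" by simp
  have "exp (lnorm2 (g * h)) \<le> exp (lnorm2 g + lnorm2 h)"
    using mnorm2_mult[OF mem_carrier mem_carrier] gh gh' by (simp add: exp_add exp_lnorm2)
  thus "lnorm2 (g * h) \<le> lnorm2 g + lnorm2 h" by simp
qed

lemma lrad_le_lnorm: "g \<in> \<Gamma> \<Longrightarrow> lrad g \<le> lnorm g" and lrad2_le_lnorm2: "g \<in> \<Gamma> \<Longrightarrow> lrad2 g \<le> lnorm2 g"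
proof -
  assume g: "g \<in> \<Gamma>"
  note b = eig_moduli_bounds[OF mem_carrier[OF g] n2] and p = eig_pos[OF g]
  show "lrad g \<le> lnorm g" unfolding lrad_def lnorm_def using b(1) p[of 0] n2 by (intro ln_mono) auto
  show "lrad2 g \<le> lnorm2 g" unfolding lrad2_def lnorm2_def using b(2) p[of 0] p[of 1] n2 by (intro ln_mono) auto
qed

lemma eig_moduli_conj:
  assumes "p \<in> \<Gamma>" "g \<in> \<Gamma>"
  shows "eig_moduli (p * g * inv\<^bsub>G\<^esub> p) = eig_moduli g"
  using inverse_props[OF assms(1)] mem_carrier assms by (intro eig_moduli_similar) auto

lemma lrad_growth:
  assumes g: "g \<in> \<Gamma>" and u: "lrad g < u"
  shows "\<exists>c. \<forall>k::nat. lnorm (g [^]\<^bsub>G\<^esub> k) \<le> c + u * real k"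
proof -
  have "exp (lrad g) < exp u" using u by simp
  hence "eig_moduli g ! 0 < exp u" using eig_pos[OF g, of 0] n2 by (simp add: lrad_def)
  then obtain c where c: "\<And>k. mnorm n (g ^\<^sub>m k) \<le> c * exp u ^ k"
    using mnorm_pow_bound[OF mem_carrier[OF g], of "exp u"] n2 by auto
  have "lnorm (g [^]\<^bsub>G\<^esub> k) \<le> ln c + u * real k" for k :: nat
  proof -
    have gk: "g ^\<^sub>m k \<in> \<Gamma>" using nat_pow_closed[of g k] pow_eq[OF g] g by simp
    have "0 < c * exp u ^ k" using c[of k] mnorm_ge_1[OF gk] by linarith
    hence c0: "c > 0" by (simp add: zero_less_mult_iff)
    have "ln (mnorm n (g ^\<^sub>m k)) \<le> ln (c * exp u ^ k)" using c[of k] mnorm_ge_1[OF gk] by (intro ln_mono) auto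
    also have "\<dots> = ln c + u * real k" using c0 by (simp add: ln_mult_pos ln_realpow mult.commute)
    finally show ?thesis by (simp add: lnorm_def pow_eq[OF g])
  qed
  thus ?thesis by blast
qed

text \<open>As \<mu>_1 + \<mu>_2 is twice \<mu>_1 minus the gap, \<open>lnorm2 y\<close> is at most
  \<open>2 * lnorm y - C * real (wl y)\<close> up to \<open>3 * c\<^sub>0 + C'\<close>, which turns
  \<open>mnorm_four_point\<close> into \<open>a_four\<close>. The rate \<open>C / 2\<close> arises
  because \<mu>_1 is half the sum of the gap and of \<mu>_1 + \<mu>_2, and the latter is bounded
  below.\<close>

sublocale A: hyperbolic_length G wl lnorm lrad "exp (3 * c\<^sub>0 + C')" C "C / 2" "C' + 2 * c\<^sub>0"
proof unfold_locales
  show "0 < exp (3 * c\<^sub>0 + C')" by simp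
  show "0 < C" by (rule C)
  show "0 < C / 2" using C by simp
next
  fix x assume "x \<in> carrier G"
  hence x: "x \<in> \<Gamma>" by simp
  show "0 \<le> lnorm x" by (rule lnorm_nonneg[OF x])
  have "2 * mu 1 x = (mu 1 x - mu 2 x) + (mu 1 x + mu 2 x)" by simp
  thus "C / 2 * real (wl x) - (C' + 2 * c\<^sub>0) \<le> lnorm x"
    using gap[OF x] mu_lnorm[OF x] mu_lnorm2[OF x] lnorm2_nonneg[OF x] C' c\<^sub>0_nonneg
    by (simp add: abs_le_iff)
  show "0 \<le> lrad x" using eig_moduli_SL(2)[OF mem_SL[OF x] n2] by (simp add: lrad_def)
  show "lrad x \<le> lnorm x" by (rule lrad_le_lnorm[OF x])
  show "\<exists>c. \<forall>k::nat. lnorm (x [^]\<^bsub>G\<^esub> k) \<le> c + u * real k" if "lrad x < u" for u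
    by (rule lrad_growth[OF x that])
next
  fix x y assume "x \<in> carrier G" "y \<in> carrier G"
  hence xy: "x \<in> \<Gamma>" "y \<in> \<Gamma>" by auto
  show "lnorm (x \<otimes>\<^bsub>G\<^esub> y) \<le> lnorm x + lnorm y" using lnorm_mult xy by simp
  show "lrad (x \<otimes>\<^bsub>G\<^esub> y \<otimes>\<^bsub>G\<^esub> inv\<^bsub>G\<^esub> x) = lrad y" using eig_moduli_conj[OF xy] by (simp add: lrad_def)
  fix z assume "z \<in> carrier G"
  hence z: "z \<in> \<Gamma>" by simp
  have cl: "x * y \<in> \<Gamma>" "y * z \<in> \<Gamma>" "x * y * z \<in> \<Gamma>"
    using m_closed[of x y] m_closed[of y z] m_closed[of "x * y" z] xy z by auto
  have "lnorm2 y \<le> (3 * c\<^sub>0 + C') + (2 * lnorm y - C * real (wl y))"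
    using gap[OF xy(2)] mu_lnorm[OF xy(2)] mu_lnorm2[OF xy(2)] by (simp add: abs_le_iff)
  hence "exp (lnorm2 y) \<le> exp ((3 * c\<^sub>0 + C') + (2 * lnorm y - C * real (wl y)))" by simp
  hence "mnorm2 n y \<le> exp (3 * c\<^sub>0 + C') * exp (2 * lnorm y - C * real (wl y))"
    by (simp only: exp_lnorm2[OF xy(2)] exp_add)
  hence "mnorm n x * mnorm n z * mnorm2 n y
      \<le> mnorm n x * mnorm n z * (exp (3 * c\<^sub>0 + C') * exp (2 * lnorm y - C * real (wl y)))"
    by (intro mult_left_mono) (simp_all add: mnorm_nonneg)
  also have "\<dots> = exp (3 * c\<^sub>0 + C') * exp (lnorm x + lnorm z + 2 * lnorm y - C * real (wl y))"
    unfolding exp_lnorm[OF xy(1), symmetric] exp_lnorm[OF z, symmetric] by (simp add: exp_add[symmetric] add_ac add_diff_eq)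
  finally show "exp (lnorm (x \<otimes>\<^bsub>G\<^esub> y) + lnorm (y \<otimes>\<^bsub>G\<^esub> z)) \<le> exp (lnorm (x \<otimes>\<^bsub>G\<^esub> y \<otimes>\<^bsub>G\<^esub> z) + lnorm y)
      + exp (3 * c\<^sub>0 + C') * exp (lnorm x + lnorm z + 2 * lnorm y - C * real (wl y))"
    using mnorm_four_point[OF mem_carrier[OF xy(1)] mem_carrier[OF xy(2)] mem_carrier[OF z]]
    by (simp add: exp_add exp_lnorm cl xy)
qed

text \<open>The symmetric length, within bounded distance of \<mu>_1 - \<mu>_n; its
  \<open>tau\<close> is exactly \<lambda>_1 - \<lambda>_n.\<close>

sublocale B: hyperbolic_length G wl "\<lambda>x. lnorm x + lnorm (inv\<^bsub>G\<^esub> x)" "\<lambda>x. lrad x + lrad (inv\<^bsub>G\<^esub> x)"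
  "2 * exp (3 * c\<^sub>0 + C') + (exp (3 * c\<^sub>0 + C'))\<^sup>2" C "C / 2" "C' + 2 * c\<^sub>0"
  by (rule A.hyperbolic_length_symmetrized)

definition mu_ball :: "nat \<Rightarrow> real \<Rightarrow> real mat set" where
  "mu_ball j R = {g \<in> \<Gamma>. mu 1 g - mu j g \<le> R}"

definition lam_classes :: "nat \<Rightarrow> real \<Rightarrow> real mat set set" where
  "lam_classes j R = cls ` {g \<in> \<Gamma>. lam 1 g - lam j g \<le> R}"

lemma delta1_eq: "delta1 j \<Gamma> = growth_rate (mu_ball j)"
  by (simp add: delta1_def mu_ball_def[abs_def])

lemma h1_eq: "h1 n j \<Gamma> = growth_rate (lam_classes j)"
proof -
  have "{conj_class n \<Gamma> g |g. g \<in> \<Gamma> \<and> lam 1 g - lam j g \<le> R} = lam_classes j R" for R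
    unfolding lam_classes_def using conj_class_eq_cls by (auto simp: image_def)
  thus ?thesis by (simp add: h1_def)
qed

lemma one_mem: "1\<^sub>m n \<in> \<Gamma>"
  using one_closed by simp

lemma mu_ball_mono: "R \<le> R' \<Longrightarrow> mu_ball j R \<subseteq> mu_ball j R'"
  and lam_classes_mono: "R \<le> R' \<Longrightarrow> lam_classes j R \<subseteq> lam_classes j R'"
  by (auto simp: mu_ball_def lam_classes_def)

lemma mu_ball_nonempty: "\<forall>\<^sub>F R in at_top. mu_ball j R \<noteq> {}"
  using eventually_ge_at_top[of "mu 1 (1\<^sub>m n) - mu j (1\<^sub>m n)"]
  by eventually_elim (use one_mem in \<open>auto simp: mu_ball_def\<close>)

lemma lam_classes_nonempty: "\<forall>\<^sub>F R in at_top. lam_classes j R \<noteq> {}"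
  using eventually_ge_at_top[of "lam 1 (1\<^sub>m n) - lam j (1\<^sub>m n)"]
  by eventually_elim (use one_mem in \<open>auto simp: lam_classes_def\<close>)

lemma mu_1n: "g \<in> \<Gamma> \<Longrightarrow> \<bar>(mu 1 g - mu n g) - (lnorm g + lnorm (inv\<^bsub>G\<^esub> g))\<bar> \<le> 2 * c\<^sub>0"
  using mu_lnorm[of g] mu_n_lnorm[of g] by (simp add: abs_le_iff)

lemma lam_1n: "g \<in> \<Gamma> \<Longrightarrow> lam 1 g - lam n g = lrad g + lrad (inv\<^bsub>G\<^esub> g)"
proof -
  assume g: "g \<in> \<Gamma>"
  note i = inverse_props[OF g]
  have "eig_moduli g ! (n - 1) * eig_moduli (inv\<^bsub>G\<^esub> g) ! 0 = 1"
    by (rule eig_moduli_inverse[OF mem_carrier[OF g] mem_carrier[OF i(1)] i(2)]) (use n2 in simp)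
  moreover have "0 < eig_moduli (inv\<^bsub>G\<^esub> g) ! 0" "0 < eig_moduli g ! (n - 1)" using eig_pos[OF i(1)] eig_pos[OF g] n2 by auto
  ultimately have "ln (eig_moduli g ! (n - 1)) + ln (eig_moduli (inv\<^bsub>G\<^esub> g) ! 0) = 0"
    by (metis ln_mult_pos ln_one)
  thus ?thesis by (simp add: lam_def lrad_def)
qed

text \<open>Since \<lambda>_n of an element is minus \<open>lrad\<close> of its inverse, the two
  families of classes coincide. The balls agree up to a shift by \<open>2 * c\<^sub>0\<close>, which
  growth rates do not see.\<close>

theorem h1n_eq_delta1n: "h1 n n \<Gamma> = delta1 n \<Gamma>"
proof -
  have H: "lam_classes n = B.class_set"
    unfolding lam_classes_def B.class_set_def using lam_1n by (intro ext image_cong) auto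
  have 1: "mu_ball n R \<subseteq> B.ball (R + 2 * c\<^sub>0)" for R
    unfolding mu_ball_def B.ball_def using mu_1n by (force simp: abs_le_iff)
  have 2: "B.ball R \<subseteq> mu_ball n (R + 2 * c\<^sub>0)" for R
    unfolding mu_ball_def B.ball_def using mu_1n by (force simp: abs_le_iff)
  have fin: "finite (mu_ball n R)" for R using finite_subset[OF 1 B.finite_abs_ball] .
  have c: "0 \<le> 2 * c\<^sub>0" using c\<^sub>0_nonneg by simp
  have "growth_rate (mu_ball n) \<le> growth_rate B.ball"
    by (rule growth_rate_le_of_shift[OF B.finite_abs_ball B.ball_mono B.eventually_ball_nonempty c fin])
       (assumption, intro card_mono 1 B.finite_abs_ball)
  moreover have "growth_rate B.ball \<le> growth_rate (mu_ball n)"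
    by (rule growth_rate_le_of_shift[OF fin mu_ball_mono mu_ball_nonempty c B.finite_abs_ball])
       (assumption, intro card_mono 2 fin)
  moreover have "growth_rate B.ball \<le> growth_rate B.class_set"
    by (rule B.growth_ball_le_class_set) (simp add: add.commute)
  moreover have "growth_rate B.class_set \<le> growth_rate B.ball" by (rule B.growth_class_set_le_ball)
  ultimately show ?thesis unfolding h1_eq delta1_eq H by (meson order.antisym order.trans)
qed

section \<open>The gap between the first two singular values\<close>

lemma lam_12: "g \<in> \<Gamma> \<Longrightarrow> lam 1 g - lam 2 g = 2 * lrad g - lrad2 g"
  using eig_pos[of g 0] eig_pos[of g 1] n2 by (simp add: lam_def lrad_def lrad2_def ln_mult_pos)

lemma mu_12: "g \<in> \<Gamma> \<Longrightarrow> \<bar>(mu 1 g - mu 2 g) - (2 * lnorm g - lnorm2 g)\<bar> \<le> 3 * c\<^sub>0"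
  using mu_lnorm[of g] mu_lnorm2[of g] by (simp add: abs_le_iff)

lemma finite_mu_ball2: "finite (mu_ball 2 R)"
proof -
  obtain k :: nat where "real k \<ge> (R + C') / C" using real_arch_simple by blast
  hence k: "R + C' \<le> C * real k" using C by (simp add: field_simps)
  have "mu_ball 2 R \<subseteq> {g \<in> carrier G. wl g \<le> k}"
  proof
    fix g assume g: "g \<in> mu_ball 2 R"
    hence "C * real (wl g) \<le> C * real k" using gap[of g] k by (simp add: mu_ball_def)
    thus "g \<in> {g \<in> carrier G. wl g \<le> k}" using g C by (simp add: mu_ball_def)
  qed
  thus ?thesis using finite_ball finite_subset by blast
qed

lemma conj_mem: "p \<in> \<Gamma> \<Longrightarrow> g \<in> \<Gamma> \<Longrightarrow> p * g * inv\<^bsub>G\<^esub> p \<in> \<Gamma>"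
  using m_closed[of "p * g" "inv\<^bsub>G\<^esub> p"] m_closed[of p g] inverse_props(1)[of p] by simp

text \<open>Up to a bounded error \<mu>_1 - \<mu>_2 is \<open>2 * lnorm - lnorm2\<close>. A suitable
  conjugation brings \<open>lnorm\<close> down to \<open>lrad\<close>, while
  \<open>lnorm2 \<ge> lrad2\<close> holds for every conjugate. As \<open>lnorm2\<close> enters with
  a minus sign, no simultaneous minimisation is needed.\<close>

lemma conjugate_mu_12:
  obtains c where "c \<ge> 0" "\<And>g. g \<in> \<Gamma> \<Longrightarrow> \<exists>p\<in>\<Gamma>. mu 1 (p * g * inv\<^bsub>G\<^esub> p) - mu 2 (p * g * inv\<^bsub>G\<^esub> p) \<le> lam 1 g - lam 2 g + c"
proof -
  obtain c where c: "\<And>g. g \<in> carrier G \<Longrightarrow> \<exists>p\<in>carrier G. lnorm (p \<otimes>\<^bsub>G\<^esub> g \<otimes>\<^bsub>G\<^esub> inv\<^bsub>G\<^esub> p) \<le> lrad g + c"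
    using A.conjugate_close_to_tau by blast
  show thesis
  proof (rule that[of "max 0 (2 * c + 3 * c\<^sub>0)"])
    fix g assume g: "g \<in> \<Gamma>"
    have "\<exists>p\<in>\<Gamma>. lnorm (p * g * inv\<^bsub>G\<^esub> p) \<le> lrad g + c" using c[of g] g by simp
    then obtain p where p: "p \<in> \<Gamma>" "lnorm (p * g * inv\<^bsub>G\<^esub> p) \<le> lrad g + c" by (rule bexE)
    define h where "h = p * g * inv\<^bsub>G\<^esub> p"
    have h: "h \<in> \<Gamma>" using conj_mem[OF p(1) g] by (simp add: h_def)
    have "lrad2 h = lrad2 g" using eig_moduli_conj[OF p(1) g] by (simp add: lrad2_def h_def)
    hence "lrad2 g \<le> lnorm2 h" using lrad2_le_lnorm2[OF h] by simp
    hence "mu 1 h - mu 2 h \<le> lam 1 g - lam 2 g + (2 * c + 3 * c\<^sub>0)"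
      using mu_12[OF h] p(2) unfolding lam_12[OF g] h_def[symmetric] by (simp add: abs_le_iff)
    also have "\<dots> \<le> lam 1 g - lam 2 g + max 0 (2 * c + 3 * c\<^sub>0)" by simp
    finally show "\<exists>p\<in>\<Gamma>. mu 1 (p * g * inv\<^bsub>G\<^esub> p) - mu 2 (p * g * inv\<^bsub>G\<^esub> p)
        \<le> lam 1 g - lam 2 g + max 0 (2 * c + 3 * c\<^sub>0)" using p(1) unfolding h_def by blast
  qed simp
qed

lemma lam_classes2_le:
  obtains c where "c \<ge> 0" "\<And>R. finite (lam_classes 2 R)" "\<And>R. card (lam_classes 2 R) \<le> card (mu_ball 2 (R + c))"
proof (rule conjugate_mu_12)
  fix c assume c: "c \<ge> 0" "\<And>g. g \<in> \<Gamma> \<Longrightarrow> \<exists>p\<in>\<Gamma>. mu 1 (p * g * inv\<^bsub>G\<^esub> p) - mu 2 (p * g * inv\<^bsub>G\<^esub> p) \<le> lam 1 g - lam 2 g + c"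
  have *: "\<exists>p\<in>carrier G. p \<otimes>\<^bsub>G\<^esub> g \<otimes>\<^bsub>G\<^esub> inv\<^bsub>G\<^esub> p \<in> mu_ball 2 (R + c)" if "g \<in> {g \<in> \<Gamma>. lam 1 g - lam 2 g \<le> R}" for g R
  proof -
    have g: "g \<in> \<Gamma>" "lam 1 g - lam 2 g \<le> R" using that by auto
    obtain p where p: "p \<in> \<Gamma>" "mu 1 (p * g * inv\<^bsub>G\<^esub> p) - mu 2 (p * g * inv\<^bsub>G\<^esub> p) \<le> lam 1 g - lam 2 g + c"
      using bexE[OF c(2)[OF g(1)]] .
    hence "p * g * inv\<^bsub>G\<^esub> p \<in> mu_ball 2 (R + c)" using g conj_mem[OF p(1) g(1)] by (simp add: mu_ball_def)
    thus ?thesis using p(1) by (intro bexI[of _ p]) simp_all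
  qed
  show thesis
  proof (rule that[OF c(1)])
    show "finite (lam_classes 2 R)" for R unfolding lam_classes_def
      by (rule card_cls_image_le(1)[OF finite_mu_ball2 _ *]) auto
    show "card (lam_classes 2 R) \<le> card (mu_ball 2 (R + c))" for R unfolding lam_classes_def
      by (rule card_cls_image_le(2)[OF finite_mu_ball2 _ *]) auto
  qed
qed

theorem h12_le_delta12: "h1 n 2 \<Gamma> \<le> delta1 2 \<Gamma>"
proof (rule lam_classes2_le)
  fix c assume c: "c \<ge> 0" "\<And>R. finite (lam_classes 2 R)" "\<And>R. card (lam_classes 2 R) \<le> card (mu_ball 2 (R + c))"
  show ?thesis unfolding h1_eq delta1_eq
    by (rule growth_rate_le_of_shift[OF finite_mu_ball2 mu_ball_mono mu_ball_nonempty c(1,2,3)])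
qed

text \<open>The number of nearly reduced elements of a class is bounded in terms of
  \<open>lrad\<close>, while classes are counted by \<lambda>_1 - \<lambda>_2. The bridge is a
  conjugate with small gap \<mu>_1 - \<mu>_2: the Anosov condition makes it a short word, and
  \<open>lnorm\<close> is at most linear in word length.\<close>

lemma lrad_le_lam_12:
  obtains c where "c \<ge> 0" "\<And>g R. g \<in> \<Gamma> \<Longrightarrow> R \<ge> 0 \<Longrightarrow> lam 1 g - lam 2 g \<le> R \<Longrightarrow> lrad g \<le> c * (1 + R)"
proof (rule conjugate_mu_12)
  fix c assume c: "c \<ge> 0" "\<And>g. g \<in> \<Gamma> \<Longrightarrow> \<exists>p\<in>\<Gamma>. mu 1 (p * g * inv\<^bsub>G\<^esub> p) - mu 2 (p * g * inv\<^bsub>G\<^esub> p) \<le> lam 1 g - lam 2 g + c"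
  obtain M where M: "M \<ge> 0" "\<forall>x\<in>\<Gamma>. lnorm x \<le> M * (1 + real (wl x))" using A.a_upper by auto
  define d where "d = M * (1 + (1 + c + C') / C)"
  show thesis
  proof (rule that[of d])
    show "d \<ge> 0" using M c C C' by (simp add: d_def)
    fix g and R :: real assume g: "g \<in> \<Gamma>" and R: "R \<ge> 0" and l: "lam 1 g - lam 2 g \<le> R"
    obtain p where p: "p \<in> \<Gamma>" "mu 1 (p * g * inv\<^bsub>G\<^esub> p) - mu 2 (p * g * inv\<^bsub>G\<^esub> p) \<le> lam 1 g - lam 2 g + c"
      using bexE[OF c(2)[OF g]] .
    define h where "h = p * g * inv\<^bsub>G\<^esub> p"
    have h: "h \<in> \<Gamma>" using conj_mem[OF p(1) g] by (simp add: h_def)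
    have "C * real (wl h) \<le> R + c + C'" using gap[OF h] p(2) l by (simp add: h_def)
    hence "real (wl h) \<le> (R + c + C') / C" using C by (simp add: field_simps)
    also have "\<dots> \<le> (1 + c + C') / C * (1 + R)"
    proof -
      have "R + c + C' \<le> (1 + c + C') * (1 + R)"
      proof -
        have "0 \<le> c * R" "0 \<le> C' * R" using c R C' by auto
        thus ?thesis by (simp add: algebra_simps)
      qed
      hence "(R + c + C') / C \<le> ((1 + c + C') * (1 + R)) / C" using C by (intro divide_right_mono) auto
      thus ?thesis by simp
    qed
    finally have wlh: "1 + real (wl h) \<le> (1 + (1 + c + C') / C) * (1 + R)" using R by (simp add: distrib_right)
    have "lrad g = lrad h" using eig_moduli_conj[OF p(1) g] by (simp add: lrad_def h_def)
    also have "\<dots> \<le> lnorm h" by (rule lrad_le_lnorm[OF h])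
    also have "\<dots> \<le> M * (1 + real (wl h))" using M(2) h by blast
    also have "\<dots> \<le> M * ((1 + (1 + c + C') / C) * (1 + R))" by (rule mult_left_mono[OF wlh M(1)])
    finally show "lrad g \<le> d * (1 + R)" by (simp add: d_def mult.assoc)
  qed
qed

text \<open>Each \<open>g\<close> of the ball is moved by some \<open>f\<close> in the finite set to
  a nearly reduced \<open>h\<close> whose gap \<lambda>_1 - \<lambda>_2 exceeds \<open>R\<close> by
  at most a constant. At most \<open>card F\<close> elements \<open>g\<close> reach the same
  \<open>h\<close>, and one class contains at most linearly many such \<open>h\<close>, so only a
  polynomial factor is lost.\<close>

theorem delta12_le_h12:
  assumes zd: "zariski_dense_SL n \<Gamma>"
  shows "delta1 2 \<Gamma> \<le> h1 n 2 \<Gamma>"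
proof -
  have "\<Gamma> \<subseteq> SL n" using mem_SL by blast
  from zariski_dense_large_trace[OF n2 this zd] obtain F Z where F: "finite F" "F \<subseteq> \<Gamma>" and Z: "Z > 0"
    and tr: "\<And>g. g \<in> \<Gamma> \<Longrightarrow> (\<forall>f\<in>\<Gamma>. g * f \<in> \<Gamma>) \<Longrightarrow> \<exists>f\<in>F. mnorm n g * mnorm2 n g \<le>
        Z * (eig_moduli (g * f) ! 0 * (eig_moduli (g * f) ! 0 * eig_moduli (g * f) ! 1))" by metis
  define cF where "cF = (\<Sum>f\<in>F. lnorm f + lnorm2 f)"
  have cF: "lnorm f \<le> cF" "lnorm2 f \<le> cF" if "f \<in> F" for f
  proof -
    have nn: "0 \<le> lnorm f + lnorm2 f" if "f \<in> F" for f using lnorm_nonneg lnorm2_nonneg that F by (simp add: subset_iff)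
    have "lnorm f + lnorm2 f \<le> cF" unfolding cF_def
      using that F(1) nn by (intro member_le_sum[of f F "\<lambda>f. lnorm f + lnorm2 f"]) auto
    thus "lnorm f \<le> cF" "lnorm2 f \<le> cF" using lnorm_nonneg[of f] lnorm2_nonneg[of f] that F by auto
  qed
  define B where "B = ln Z + 2 * cF"
  define c1 where "c1 = max 0 (3 * c\<^sub>0 + 3 * cF + ln Z)"
  define E where "E R = {h \<in> \<Gamma>. lnorm h \<le> lrad h + B \<and> lam 1 h - lam 2 h \<le> R + c1}" for R
  have key: "\<exists>f\<in>F. g * f \<in> E R" if g: "g \<in> mu_ball 2 R" for g R
  proof -
    have gG: "g \<in> \<Gamma>" "mu 1 g - mu 2 g \<le> R" using g by (auto simp: mu_ball_def)
    have "\<forall>f\<in>\<Gamma>. g * f \<in> \<Gamma>" using m_closed[of g] gG by simp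
    from tr[OF gG(1) this] obtain f where f: "f \<in> F" and le: "mnorm n g * mnorm2 n g \<le>
        Z * (eig_moduli (g * f) ! 0 * (eig_moduli (g * f) ! 0 * eig_moduli (g * f) ! 1))" by blast
    have fG: "f \<in> \<Gamma>" using f F by blast
    define h where "h = g * f"
    have h: "h \<in> \<Gamma>" using m_closed[of g f] gG fG by (simp add: h_def)
    have pos: "0 < eig_moduli h ! 0" "0 < eig_moduli h ! 1" using eig_pos[OF h] n2 by auto
    have "ln (mnorm n g * mnorm2 n g) \<le> ln (Z * (eig_moduli h ! 0 * (eig_moduli h ! 0 * eig_moduli h ! 1)))"
      using le mnorm_ge_1[OF gG(1)] mnorm2_ge_1[OF gG(1)] unfolding h_def
      by (intro ln_mono) (auto intro!: mult_pos_pos)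
    moreover have "ln (mnorm n g * mnorm2 n g) = lnorm g + lnorm2 g"
      using mnorm_ge_1[OF gG(1)] mnorm2_ge_1[OF gG(1)] by (simp add: lnorm_def lnorm2_def ln_mult_pos)
    moreover have "ln (Z * (eig_moduli h ! 0 * (eig_moduli h ! 0 * eig_moduli h ! 1))) = ln Z + (lrad h + lrad2 h)"
      using Z pos by (simp add: lrad_def lrad2_def ln_mult_pos)
    ultimately have 1: "lnorm g + lnorm2 g \<le> ln Z + lrad h + lrad2 h" by simp
    have 2: "lnorm h \<le> lnorm g + cF" "lnorm2 h \<le> lnorm2 g + cF"
      using lnorm_mult[OF gG(1) fG] lnorm2_mult[OF gG(1) fG] cF[OF f] by (auto simp: h_def)
    have 3: "lrad h \<le> lnorm h" "lrad2 h \<le> lnorm2 h" using lrad_le_lnorm[OF h] lrad2_le_lnorm2[OF h] by auto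
    \<comment> \<open>A lower bound on \<open>lrad h + lrad2 h\<close> suffices: each summand is at
      most \<open>cF\<close> above the corresponding norm of \<open>g\<close>, so neither falls
      short of its norm by more than \<open>ln Z + cF\<close>. This determines \<open>B\<close> and
      \<open>c1\<close>.\<close>
    have "lnorm h \<le> lrad h + B" unfolding B_def using 1 2 3 by linarith
    moreover have "lam 1 h - lam 2 h \<le> R + c1"
    proof -
      have "2 * lnorm g - lnorm2 g \<le> R + 3 * c\<^sub>0" using mu_12[OF gG(1)] gG(2) by (simp add: abs_le_iff)
      moreover have "3 * c\<^sub>0 + 3 * cF + ln Z \<le> c1" by (simp add: c1_def)
      ultimately show ?thesis unfolding lam_12[OF h] using 1 2 3 by linarith
    qed
    ultimately have "h \<in> E R" using h by (simp add: E_def)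
    thus ?thesis using f unfolding h_def by blast
  qed
  show ?thesis
  proof (rule A.card_nearly_reduced_in_class[of B])
    fix c2 assume c2: "c2 \<ge> 0" "\<And>g. g \<in> carrier G \<Longrightarrow> finite {h \<in> cls g. lnorm h \<le> lrad h + B}"
      "\<And>g. g \<in> carrier G \<Longrightarrow> real (card {h \<in> cls g. lnorm h \<le> lrad h + B}) \<le> c2 * (1 + lrad g)"
    show ?thesis
    proof (rule lrad_le_lam_12)
      fix c3 assume c3: "c3 \<ge> 0" "\<And>g R. g \<in> \<Gamma> \<Longrightarrow> R \<ge> 0 \<Longrightarrow> lam 1 g - lam 2 g \<le> R \<Longrightarrow> lrad g \<le> c3 * (1 + R)"
      show ?thesis
      proof (rule lam_classes2_le)
        fix c4 :: real assume finH: "\<And>R. finite (lam_classes 2 R)"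
        define D where "D = real (card F) * (c2 * (1 + c3 * (1 + c1)))"
        have c1: "c1 \<ge> 0" by (simp add: c1_def)
        have D: "D \<ge> 0" unfolding D_def using c2(1) c3(1) c1 by simp
        have cardE: "finite (E R) \<and> real (card (E R)) \<le> c2 * (1 + c3 * (1 + c1)) * (1 + R) * real (card (lam_classes 2 (R + c1)))"
          if R: "R \<ge> 0" for R
        proof -
          let ?Y = "\<lambda>K. {h \<in> K. lnorm h \<le> lrad h + B}"
          have sub: "E R \<subseteq> (\<Union>K\<in>lam_classes 2 (R + c1). ?Y K)"
            unfolding E_def lam_classes_def using cls_self by fastforce
          have fin: "finite (?Y K)" and cd: "real (card (?Y K)) \<le> c2 * (1 + c3 * (1 + c1)) * (1 + R)"
            if K: "K \<in> lam_classes 2 (R + c1)" for K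
          proof -
            obtain g where g: "g \<in> \<Gamma>" "lam 1 g - lam 2 g \<le> R + c1" "K = cls g"
              using K by (auto simp: lam_classes_def)
            show "finite (?Y K)" using c2(2)[of g] g by simp
            have "real (card (?Y K)) \<le> c2 * (1 + lrad g)" using c2(3)[of g] g by simp
            also have "\<dots> \<le> c2 * (1 + c3 * (1 + (R + c1)))"
              using c3(2)[OF g(1) _ g(2)] R c1 c2(1) by (intro mult_left_mono) auto
            also have "\<dots> \<le> c2 * ((1 + c3 * (1 + c1)) * (1 + R))"
            proof (rule mult_left_mono[OF _ c2(1)])
              have "0 \<le> c3 * c1 * R" using c3 c1 R by simp
              thus "1 + c3 * (1 + (R + c1)) \<le> (1 + c3 * (1 + c1)) * (1 + R)" using R by (simp add: algebra_simps)
            qed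
            finally show "real (card (?Y K)) \<le> c2 * (1 + c3 * (1 + c1)) * (1 + R)" by (simp add: mult.assoc)
          qed
          have finU: "finite (\<Union>K\<in>lam_classes 2 (R + c1). ?Y K)" using finH fin by blast
          have "card (E R) \<le> card (\<Union>K\<in>lam_classes 2 (R + c1). ?Y K)" by (rule card_mono[OF finU sub])
          also have "\<dots> \<le> (\<Sum>K\<in>lam_classes 2 (R + c1). card (?Y K))" by (rule card_UN_le[OF finH])
          finally have "real (card (E R)) \<le> (\<Sum>K\<in>lam_classes 2 (R + c1). real (card (?Y K)))"
            by (simp only: of_nat_sum[symmetric] of_nat_le_iff)
          also have "\<dots> \<le> (\<Sum>K\<in>lam_classes 2 (R + c1). c2 * (1 + c3 * (1 + c1)) * (1 + R))" by (intro sum_mono cd)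
          also have "\<dots> = c2 * (1 + c3 * (1 + c1)) * (1 + R) * real (card (lam_classes 2 (R + c1)))" by simp
          finally show ?thesis using finite_subset[OF sub finU] by blast
        qed
        have cardM: "real (card (mu_ball 2 R)) \<le> D * (1 + R) * real (card (lam_classes 2 (R + c1)))" if R: "R \<ge> 0" for R
        proof -
          have sub: "mu_ball 2 R \<subseteq> (\<Union>f\<in>F. (\<lambda>h. h * inv\<^bsub>G\<^esub> f) ` E R)"
          proof
            fix g assume g: "g \<in> mu_ball 2 R"
            obtain f where f: "f \<in> F" "g * f \<in> E R" using key[OF g] by blast
            have "g \<in> \<Gamma>" "f \<in> \<Gamma>" using g f F by (auto simp: mu_ball_def)
            hence "g = (g * f) * inv\<^bsub>G\<^esub> f" using inv_solve_right'[of g "g * f" f] m_assoc[of g f "inv\<^bsub>G\<^esub> f"] r_inv[of f] r_one[of g] inv_closed[of f] by simp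
            thus "g \<in> (\<Union>f\<in>F. (\<lambda>h. h * inv\<^bsub>G\<^esub> f) ` E R)" using f by blast
          qed
          have finE: "finite (E R)" using cardE[OF R] by blast
          have "card (mu_ball 2 R) \<le> card (\<Union>f\<in>F. (\<lambda>h. h * inv\<^bsub>G\<^esub> f) ` E R)"
            using F(1) finE by (intro card_mono sub) auto
          also have "\<dots> \<le> (\<Sum>f\<in>F. card ((\<lambda>h. h * inv\<^bsub>G\<^esub> f) ` E R))" by (rule card_UN_le[OF F(1)])
          also have "\<dots> \<le> (\<Sum>f\<in>F. card (E R))" by (intro sum_mono card_image_le finE)
          finally have "real (card (mu_ball 2 R)) \<le> real (card F) * real (card (E R))"
            by (simp only: sum_constant of_nat_mult[symmetric] of_nat_le_iff of_nat_id)
          also have "\<dots> \<le> real (card F) * (c2 * (1 + c3 * (1 + c1)) * (1 + R) * real (card (lam_classes 2 (R + c1))))"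
            using cardE[OF R] by (intro mult_left_mono) auto
          finally show ?thesis by (simp add: D_def mult.assoc)
        qed
        show ?thesis unfolding h1_eq delta1_eq
        proof (rule growth_rate_le_of_card_le[OF finH lam_classes_mono lam_classes_nonempty, where c = "D + c1"])
          show "0 \<le> D + c1" using D c1 by simp
          show "finite (mu_ball 2 R)" for R by (rule finite_mu_ball2)
          fix R :: real assume R: "R \<ge> 0"
          have "D * (1 + R) \<le> (D + c1) * (1 + R)\<^sup>2"
            using D c1 R by (intro mult_mono) (auto simp: power2_eq_square)
          moreover have "real (card (lam_classes 2 (R + c1))) \<le> real (card (lam_classes 2 (R + (D + c1))))"
            using card_mono[OF finH lam_classes_mono[of "R + c1" "R + (D + c1)"]] D by simp
          ultimately have "D * (1 + R) * real (card (lam_classes 2 (R + c1)))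
              \<le> (D + c1) * (1 + R)\<^sup>2 * real (card (lam_classes 2 (R + (D + c1))))"
            by (rule mult_mono) (use D c1 in simp_all)
          thus "real (card (mu_ball 2 R)) \<le> (D + c1) * (1 + R)\<^sup>2 * real (card (lam_classes 2 (R + (D + c1))))"
            using cardM[OF R] by linarith
        qed
      qed
    qed
  qed
qed

end

text \<open>With \<open>n \<ge> 2\<close> the list \<open>eig_moduli\<close> has a second entry, so
  \<open>mu 2\<close> and \<open>lam 2\<close> have their meaning. The generating set supplied by
  the Anosov condition is fixed throughout; the growth rates do not refer to it.\<close>

theorem theorem2p30:
  fixes n :: nat and \<Gamma> :: "real mat set"
  assumes "n \<ge> 2"
    and "subgroup_SL n \<Gamma>"
    and "projective_anosov n \<Gamma>"
  shows "h1 n 2 \<Gamma> \<le> delta1 2 \<Gamma> \<and> h1 n n \<Gamma> = delta1 n \<Gamma> \<and>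
         (zariski_dense_SL n \<Gamma> \<longrightarrow> h1 n 2 \<Gamma> = delta1 2 \<Gamma>)"
proof -
  obtain S C C' where S: "finite S" "generates n \<Gamma> S" "C > 0" "C' > 0"
    "\<And>g. g \<in> \<Gamma> \<Longrightarrow> C * real (word_length n \<Gamma> S g) - C' \<le> mu 1 g - mu 2 g"
    using assms(3) unfolding projective_anosov_def by blast
  interpret anosov_subgroup n \<Gamma> S C C'
    by unfold_locales (use assms S in auto)
  show ?thesis using h12_le_delta12 h1n_eq_delta1n delta12_le_h12 by (blast intro: order.antisym)
qed

end
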